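(* There exist absolute constants $C,c>0$ and a function $\delta:\mathbb{N}\to[0,1]$ with $\delta(n)\to 0$ as $n\to\infty$ such that the following holds. Let $n\ge 2$ be an integer, $k_1,k_2\in[0,n]$, $b_1,b_2\ge 0$ integers and $\varepsilon\in(0,1)$ satisfy $$k_1+k_2-\max(b_1,b_2) > n + C\log^3(n/\varepsilon),$$ and let $$m=\Big\lfloor(1-\delta(n))\max\big(k_1-\tfrac{b_1}{2},\,k_2-\tfrac{b_2}{2}\big)+\tfrac12\,(k_1-b_1+k_2-b_2-n)-9\log\varepsilon^{-1}-c\Big\rfloor .$$ If $m\ge 1$, then the DEOR-construction (see context) gives an explicit function $E:\{0,1\}^n\times\{0,1\}^n\to\{0,1\}^m$ that is a $(k_1,k_2,\varepsilon)$ two-source extractor against $(b_1,b_2)$ non-entangled quantum storage.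
   Context: Logarithms are base 2. For a matrix $A$, $|A|_{\mathrm{tr}}=\frac12\mathrm{Tr}\sqrt{A^\dagger A}$. $U_m$ is the uniform distribution on $\{0,1\}^m$ (identified with the maximally mixed state). A source $X$ on $\{0,1\}^n$ has min-entropy (at least) $k$ if $\Pr[X=x]\le 2^{-k}$ for all $x$. Non-entangled storage: for independent sources $X,Y$, a $(b_1,b_2)$ non-entangled (quantum) storage is a family of states $\rho_{xy}=\rho_x\otimes\rho_y$, where $\rho_x$ is a density matrix on $b_1$ qubits for each $x$ and $\rho_y$ is a density matrix on $b_2$ qubits for each $y$. $E:\{0,1\}^n\times\{0,1\}^n\to\{0,1\}^m$ is a $(k_1,k_2,\varepsilon)$ two-source extractor against $(b_1,b_2)$ non-entangled quantum storage if for all independent $n$-bit sources $X,Y$ with min-entropies $k_1,k_2$ and every $(b_1,b_2)$ non-entangled storage $\rho_{XY}$, $$\Big|\sum_{x,y}p(x)p(y)\,|E(x,y)\rangle\langle E(x,y)|\otimes\rho_{xy}-U_m\otimes\sum_{x,y}p(x)p(y)\rho_{xy}\Big|_{\mathrm{tr}}\le\varepsilon .$$ DEOR-construction. Let $A_1,\dots,A_n$ be an efficiently computable set of $n\times n$ matrices over $GF(2)$ such that $\sum_{i\in S}A_i$ has full rank for every nonempty $S\subseteq[n]$ (such a set exists by Dodis et al.). For $\ell\le n$ let $E_D:\{0,1\}^n\times\{0,1\}^n\to\{0,1\}^\ell$, $E_D(x,y)=(A_1x\cdot y,\dots,A_\ell x\cdot y)$, where $x\cdot y=\sum_j x_jy_j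 \bmod 2$. The construction is $E(x,y)=E_S(x,E_D(x,y))$ or $E(x,y)=E_S(y,E_D(x,y))$ (whichever gives better parameters), possibly truncated to $m$ bits, where $E_S$ is the explicit seeded extractor of De, Portmann, Vidick and Renner. A function $E_S:\{0,1\}^n\times\{0,1\}^d\to\{0,1\}^{m'}$ is a $(k,\varepsilon')$ seeded extractor against $b$ quantum storage if for every $n$-bit source $X$ with min-entropy $k$ and every family of $b$-qubit states $\{\rho_x\}$, $|\sum_x p(x)\,\mathbb{E}_{u\in\{0,1\}^d}|E_S(x,u)\rangle\langle E_S(x,u)|\otimes\rho_x-U_{m'}\otimes\sum_xp(x)\rho_x|_{\mathrm{tr}}\le\varepsilon'$. The extractor of De et al. is an explicit $(k,\varepsilon')$ seeded extractor against $b$ quantum storage with seed length $d=O(\log^3(n/\varepsilon'))$ and $m'=d+k-b-8\log(k-b)-8\log\varepsilon'^{-1}-O(1)$ output bits; it may be used with a longer seed by copying the surplus seed bits to the output. *)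

theory Defs
  imports
    "HOL-Library.Z2"
    "HOL-Probability.Probability_Mass_Function"
    "Jordan_Normal_Form.Schur_Decomposition"
    "Jordan_Normal_Form.DL_Rank"
begin

section \<open>Matrices and quantum states\<close>

definition mat_sum :: "nat \<Rightarrow> ('i \<Rightarrow> 'a :: comm_monoid_add mat) \<Rightarrow> 'i set \<Rightarrow> 'a mat" where
  "mat_sum d f S = mat d d (\<lambda>(r, c). \<Sum>i\<in>S. f i $$ (r, c))"

definition mat_trace :: "'a :: comm_monoid_add mat \<Rightarrow> 'a" where
  "mat_trace A = (\<Sum>i<dim_row A. A $$ (i, i))"

definition tensor_mat :: "'a :: times mat \<Rightarrow> 'a mat \<Rightarrow> 'a mat"  (infixr \<open>\<otimes>\<^sub>M\<close> 72) where
  "A \<otimes>\<^sub>M B = mat (dim_row A * dim_row B) (dim_col A * dim_col B)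
     (\<lambda>(i, j). A $$ (i div dim_row B, j div dim_col B) * B $$ (i mod dim_row B, j mod dim_col B))"

definition psd :: "nat \<Rightarrow> complex mat \<Rightarrow> bool" where
  "psd d A \<longleftrightarrow> A \<in> carrier_mat d d \<and> mat_adjoint A = A \<and>
     (\<forall>v \<in> carrier_vec d. 0 \<le> Re ((A *\<^sub>v v) \<bullet>c v))"

definition psd_sqrt :: "nat \<Rightarrow> complex mat \<Rightarrow> complex mat" where
  "psd_sqrt d A = (THE B. psd d B \<and> B * B = A)"

text \<open>Only used for square matrices. Note the factor one half.\<close>

definition tr_norm :: "complex mat \<Rightarrow> real" where
  "tr_norm A = Re (mat_trace (psd_sqrt (dim_col A) (mat_adjoint A * A))) / 2"

definition density :: "nat \<Rightarrow> complex mat \<Rightarrow> bool" where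
  "density b \<rho> \<longleftrightarrow> psd (2 ^ b) \<rho> \<and> mat_trace \<rho> = 1"

definition max_mixed :: "nat \<Rightarrow> complex mat" where
  "max_mixed m = (1 / 2 ^ m) \<cdot>\<^sub>m 1\<^sub>m (2 ^ m)"

definition bits :: "nat \<Rightarrow> bit list set" where
  "bits n = {x. length x = n}"

text \<open>The computational basis of \<open>m\<close> qubits is ordered by reading bit strings as binary
  numbers, least significant bit first.\<close>

definition basis_index :: "bit list \<Rightarrow> nat" where
  "basis_index z = horner_sum (\<lambda>a. of_bool (a = 1)) 2 z"

definition ket_bra :: "bit list \<Rightarrow> complex mat" where
  "ket_bra z = mat (2 ^ length z) (2 ^ length z)
     (\<lambda>(i, j). of_bool (i = basis_index z \<and> j = basis_index z))"


section \<open>Sources, storage and extractors\<close>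

definition source :: "nat \<Rightarrow> real \<Rightarrow> bit list pmf \<Rightarrow> bool" where
  "source n k X \<longleftrightarrow> set_pmf X \<subseteq> bits n \<and> (\<forall>x. pmf X x \<le> 2 powr (- k))"

definition storage :: "nat \<Rightarrow> nat \<Rightarrow> (bit list \<Rightarrow> complex mat) \<Rightarrow> bool" where
  "storage n b \<rho> \<longleftrightarrow> (\<forall>x \<in> bits n. density b (\<rho> x))"

text \<open>\<open>F : {0,1}\<^sup>n \<times> {0,1}\<^sup>d \<rightarrow> {0,1}\<^sup>m\<close> is a \<open>(k, \<epsilon>)\<close> seeded extractor against \<open>b\<close> qubits of storage.\<close>

definition seeded_extractor ::
  "nat \<Rightarrow> nat \<Rightarrow> nat \<Rightarrow> real \<Rightarrow> real \<Rightarrow> nat \<Rightarrow> (bit list \<Rightarrow> bit list \<Rightarrow> bit list) \<Rightarrow> bool" where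
  "seeded_extractor n d m k \<epsilon> b F \<longleftrightarrow>
     (\<forall>x \<in> bits n. \<forall>u \<in> bits d. F x u \<in> bits m) \<and>
     (\<forall>X \<rho>. source n k X \<longrightarrow> storage n b \<rho> \<longrightarrow>
        tr_norm
          (mat_sum (2 ^ m * 2 ^ b)
             (\<lambda>(x, u). complex_of_real (pmf X x / 2 ^ d) \<cdot>\<^sub>m (ket_bra (F x u) \<otimes>\<^sub>M \<rho> x))
             (bits n \<times> bits d)
           - max_mixed m \<otimes>\<^sub>M
               mat_sum (2 ^ b) (\<lambda>x. complex_of_real (pmf X x) \<cdot>\<^sub>m \<rho> x) (bits n))
        \<le> \<epsilon>)"

text \<open>\<open>E : {0,1}\<^sup>n \<times> {0,1}\<^sup>n \<rightarrow> {0,1}\<^sup>m\<close> is a \<open>(k\<^sub>1, k\<^sub>2, \<epsilon>)\<close> two-source extractor against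
  \<open>(b\<^sub>1, b\<^sub>2)\<close> non-entangled storage; independence of the sources is the product weight.\<close>

definition two_source_extractor ::
  "nat \<Rightarrow> nat \<Rightarrow> real \<Rightarrow> real \<Rightarrow> real \<Rightarrow> nat \<Rightarrow> nat \<Rightarrow> (bit list \<Rightarrow> bit list \<Rightarrow> bit list) \<Rightarrow> bool" where
  "two_source_extractor n m k1 k2 \<epsilon> b1 b2 E \<longleftrightarrow>
     (\<forall>x \<in> bits n. \<forall>y \<in> bits n. E x y \<in> bits m) \<and>
     (\<forall>X Y \<rho> \<sigma>. source n k1 X \<longrightarrow> source n k2 Y \<longrightarrow> storage n b1 \<rho> \<longrightarrow> storage n b2 \<sigma> \<longrightarrow>
        tr_norm
          (mat_sum (2 ^ m * (2 ^ b1 * 2 ^ b2))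
             (\<lambda>(x, y). complex_of_real (pmf X x * pmf Y y) \<cdot>\<^sub>m
                (ket_bra (E x y) \<otimes>\<^sub>M \<rho> x \<otimes>\<^sub>M \<sigma> y))
             (bits n \<times> bits n)
           - max_mixed m \<otimes>\<^sub>M
               mat_sum (2 ^ b1 * 2 ^ b2)
                 (\<lambda>(x, y). complex_of_real (pmf X x * pmf Y y) \<cdot>\<^sub>m (\<rho> x \<otimes>\<^sub>M \<sigma> y))
                 (bits n \<times> bits n))
        \<le> \<epsilon>)"


section \<open>Polynomial time\<close>

text \<open>Explicitness is deterministic polynomial time. The machine model is a structured program
  over finitely many stacks of bits; up to a polynomial this is a multi-tape Turing machine
  (two stacks make a tape, and \<open>Copy\<close> is charged its length). \<open>Branch r a c d\<close> runs \<open>c\<close> if the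
  top of stack \<open>r\<close> is \<open>a\<close>, and \<open>d\<close> otherwise, in particular if \<open>r\<close> is empty; \<open>While r c\<close> loops
  as long as \<open>r\<close> is not empty.\<close>

datatype com =
    Skip
  | Push nat bit
  | Pop nat
  | Copy nat nat
  | Seq com com
  | Branch nat bit com com
  | While nat com

type_synonym state = "nat \<Rightarrow> bit list"

inductive exec :: "com \<Rightarrow> state \<Rightarrow> nat \<Rightarrow> state \<Rightarrow> bool" where
  exec_Skip: "exec Skip s 1 s"
| exec_Push: "exec (Push r a) s 1 (s(r := a # s r))"
| exec_Pop: "exec (Pop r) s 1 (s(r := tl (s r)))"
| exec_Copy: "exec (Copy r q) s (Suc (length (s q))) (s(r := s q))"
| exec_Seq: "exec c s t s' \<Longrightarrow> exec d s' t' s'' \<Longrightarrow> exec (Seq c d) s (t + t') s''"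
| exec_Branch_True:
    "s r \<noteq> [] \<Longrightarrow> hd (s r) = a \<Longrightarrow> exec c s t s' \<Longrightarrow> exec (Branch r a c d) s (Suc t) s'"
| exec_Branch_False:
    "s r = [] \<or> hd (s r) \<noteq> a \<Longrightarrow> exec d s t s' \<Longrightarrow> exec (Branch r a c d) s (Suc t) s'"
| exec_While_Nil: "s r = [] \<Longrightarrow> exec (While r c) s 1 s"
| exec_While_Cons:
    "s r \<noteq> [] \<Longrightarrow> exec c s t s' \<Longrightarrow> exec (While r c) s' t' s'' \<Longrightarrow>
     exec (While r c) s (Suc (t + t')) s''"

definition init_state :: "bit list list \<Rightarrow> state" where
  "init_state ws r = (if r < length ws then ws ! r else [])"

text \<open>\<open>R\<close> is the graph of a (partial) function on tuples of bit strings: one program computes it,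
  leaving the value in stack \<open>0\<close>, in time polynomial in the total input length.\<close>

definition polytime :: "(bit list list \<times> bit list) set \<Rightarrow> bool" where
  "polytime R \<longleftrightarrow>
     (\<exists>c a. \<forall>(ws, z) \<in> R. \<exists>t s. exec c (init_state ws) t s \<and> s 0 = z \<and>
        t \<le> a + (sum_list (map length ws)) ^ a)"

definition unary :: "nat \<Rightarrow> bit list" where
  "unary n = replicate n 1"


section \<open>The DEOR-construction\<close>

text \<open>\<open>A n 0, \<dots>, A n (n - 1)\<close> are the matrices for dimension \<open>n\<close> (indices shifted to start from 0).\<close>

definition deor_matrices :: "(nat \<Rightarrow> nat \<Rightarrow> bit mat) \<Rightarrow> bool" where
  "deor_matrices A \<longleftrightarrow>
     (\<forall>n \<ge> 1. (\<forall>i < n. A n i \<in> carrier_mat n n) \<and>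
        (\<forall>S \<subseteq> {..<n}. S \<noteq> {} \<longrightarrow> vec_space.rank n (mat_sum n (A n) S) = n)) \<and>
     polytime {([unary n], concat (map (\<lambda>i. concat (map list_of_vec (rows (A n i)))) [0..<n])) | n.
        n \<ge> 1}"

definition E_D :: "(nat \<Rightarrow> nat \<Rightarrow> bit mat) \<Rightarrow> nat \<Rightarrow> nat \<Rightarrow> bit list \<Rightarrow> bit list \<Rightarrow> bit list" where
  "E_D A n l x y = map (\<lambda>i. (A n i *\<^sub>v vec_of_list x) \<bullet> vec_of_list y) [0..<l]"

text \<open>The properties of the seeded extractor of De, Portmann, Vidick and Renner. For parameters
  \<open>n, k, b\<close> and \<open>\<epsilon>' = 2\<^sup>-\<^sup>e\<close>, the number \<open>d n k b e\<close> is the seed length and \<open>E\<^sub>S n k b e\<close> the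
  extractor. \<open>K\<close> and \<open>\<kappa>\<close> are the constants hidden in the two O-terms. Only integral \<open>k > b\<close> and \<open>e \<ge> 1\<close>
  are used, so that parameters can be passed to an algorithm (in unary, i.e. time is polynomial in
  \<open>n\<close> and \<open>log (1/\<epsilon>')\<close>); rounding general parameters to these only changes \<open>K\<close> and \<open>\<kappa>\<close>.\<close>

definition dpvr_extractor ::
  "real \<Rightarrow> real \<Rightarrow> (nat \<Rightarrow> nat \<Rightarrow> nat \<Rightarrow> nat \<Rightarrow> nat) \<Rightarrow>
   (nat \<Rightarrow> nat \<Rightarrow> nat \<Rightarrow> nat \<Rightarrow> bit list \<Rightarrow> bit list \<Rightarrow> bit list) \<Rightarrow> bool" where
  "dpvr_extractor K \<kappa> d E\<^sub>S \<longleftrightarrow>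
     (\<forall>n k b e. 2 \<le> n \<and> b < k \<and> k \<le> n \<and> 1 \<le> e \<longrightarrow>
        real (d n k b e) \<le> K * (log 2 (real n / 2 powr (- real e))) ^ 3 \<and>
        (\<exists>m'. real m' \<ge> real (d n k b e) + real k - real b - 8 * log 2 (real k - real b)
                        - 8 * real e - \<kappa> \<and>
           seeded_extractor n (d n k b e) m' (real k) (2 powr (- real e)) b (E\<^sub>S n k b e))) \<and>
     polytime {([unary n, unary k, unary b, unary e], unary (d n k b e)) | n k b e.
        2 \<le> n \<and> b < k \<and> k \<le> n \<and> 1 \<le> e} \<and>
     polytime {([unary n, unary k, unary b, unary e, x, u], E\<^sub>S n k b e x u) | n k b e x u.
        2 \<le> n \<and> b < k \<and> k \<le> n \<and> 1 \<le> e \<and> x \<in> bits n \<and> u \<in> bits (d n k b e)}"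

text \<open>A seeded extractor with seed length \<open>d\<close>, used with a longer seed.\<close>

definition copy_surplus ::
  "nat \<Rightarrow> (bit list \<Rightarrow> bit list \<Rightarrow> bit list) \<Rightarrow> bit list \<Rightarrow> bit list \<Rightarrow> bit list" where
  "copy_surplus d F x u = F x (take d u) @ drop d u"

text \<open>The construction truncated to \<open>m\<close> bits. The flag \<open>fst_src\<close> selects which of the two sources is
  the input of the seeded extractor; \<open>l\<close> is the output length of \<open>E\<^sub>D\<close>.\<close>

definition deor ::
  "(nat \<Rightarrow> nat \<Rightarrow> bit mat) \<Rightarrow> (nat \<Rightarrow> nat \<Rightarrow> nat \<Rightarrow> nat \<Rightarrow> nat) \<Rightarrow>
   (nat \<Rightarrow> nat \<Rightarrow> nat \<Rightarrow> nat \<Rightarrow> bit list \<Rightarrow> bit list \<Rightarrow> bit list) \<Rightarrow>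
   nat \<Rightarrow> bool \<Rightarrow> nat \<Rightarrow> nat \<Rightarrow> nat \<Rightarrow> nat \<Rightarrow> nat \<Rightarrow> bit list \<Rightarrow> bit list \<Rightarrow> bit list" where
  "deor A d E\<^sub>S n fst_src l k b e m x y =
     take m (copy_surplus (d n k b e) (E\<^sub>S n k b e) (if fst_src then x else y) (E_D A n l x y))"

text \<open>Admissible parameters. All of them are integers up to \<open>n\<close>, so that polynomial time in the
  unary parameters below means polynomial time in \<open>n\<close> (and \<open>m\<close>).\<close>

definition deor_params :: "(nat \<Rightarrow> nat \<Rightarrow> nat \<Rightarrow> nat \<Rightarrow> nat) \<Rightarrow> nat \<Rightarrow> nat \<Rightarrow> nat \<Rightarrow> nat \<Rightarrow> nat \<Rightarrow> bool" where
  "deor_params d n l k b e \<longleftrightarrow>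
     2 \<le> n \<and> b < k \<and> k \<le> n \<and> 1 \<le> e \<and> e \<le> n \<and> d n k b e \<le> l \<and> l \<le> n"

definition deor_explicit ::
  "(nat \<Rightarrow> nat \<Rightarrow> bit mat) \<Rightarrow> (nat \<Rightarrow> nat \<Rightarrow> nat \<Rightarrow> nat \<Rightarrow> nat) \<Rightarrow>
   (nat \<Rightarrow> nat \<Rightarrow> nat \<Rightarrow> nat \<Rightarrow> bit list \<Rightarrow> bit list \<Rightarrow> bit list) \<Rightarrow> bool" where
  "deor_explicit A d E\<^sub>S \<longleftrightarrow>
     polytime
       {([unary n, [of_bool fst_src], unary l, unary k, unary b, unary e, unary m, x, y],
         deor A d E\<^sub>S n fst_src l k b e m x y) | n fst_src l k b e m x y.
        deor_params d n l k b e \<and> x \<in> bits n \<and> y \<in> bits n}"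

end

theory Submission
  imports Defs "HOL-Analysis.L2_Norm"
begin

text \<open>
  Let \<open>x\<close> be the source fed to the seeded extractor. The trace norm of a Hermitian matrix is half
  the maximum of \<open>\<bar>Tr (V A)\<bar>\<close> over contractions \<open>V\<close>, and for a classical-quantum state \<open>V\<close>
  may be taken block diagonal. With such a family of tests fixed, the distance splits in two.
  Replacing \<open>E\<^sub>D(x,y)\<close> by a uniform seed, for fixed \<open>x\<close> and with the storage of \<open>x\<close> traced out, is
  controlled by the Hilbert-Schmidt norm: full rank of the sums of the matrices makes \<open>E\<^sub>D\<close>
  collide on two distinct \<open>y\<close> with probability exactly \<open>2\<^sup>-\<^sup>l\<close> over uniform \<open>x\<close>, so the error is at most
  \<open>2 powr ((b\<^sub>2 + l + n - k\<^sub>1 - k\<^sub>2) / 2)\<close>. Replacing the output of the seeded extractor by a uniform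
  string, with the storage of \<open>y\<close> traced out and averaged, is its defining property.

  The first bound admits \<open>l\<close> close to \<open>T = k\<^sub>1 + k\<^sub>2 - b\<^sub>2 - n\<close>, whereas the claimed output length only
  uses \<open>T / 2\<close>. As \<open>T\<close> exceeds \<open>C log\<^sup>3(n/\<epsilon>)\<close>, the surplus pays for all logarithmic losses, and
  \<open>\<delta> = 0\<close> suffices.
\<close>

section \<open>Programs\<close>

text \<open>The obstacle is that \<open>x\<close> is used twice, in the hash and again as input of
  the seeded extractor. The hash therefore has to look uniform to tests that know \<open>x\<close>;
  this is why collisions are counted over \<open>x\<close> for fixed \<open>y \<noteq> y'\<close>,
  and why the tests in \<open>hash_bound\<close> may depend on \<open>x\<close>. A maximising test
  acts on both storages jointly, yet its partial trace against a density is again a contraction,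
  since a density is a convex combination of rank-one projections; so each half of the argument only
  sees a test on one storage. The factor 2^(b/2) of the hash bound is the largest Hilbert-Schmidt
  norm of a contraction on b qubits. Because \<open>tr_norm\<close> carries a factor one half, tests
  are compared with \<open>2 * \<epsilon>\<close>: one \<epsilon> pays for the hash, the other for
  the seeded extractor, which is run with error at most \<epsilon> / 2. Explicitness is independent
  of all this. The hypotheses only provide some unknown programs for the matrices, the seed length
  and the extractor, so these must be called on private stacks by a program written out in
  full.\<close>

declare add_bit_eq_xor [simp del] mult_bit_eq_and [simp del]

text \<open>\<open>exec\<close> fixes the exact number of steps. Upper bounds compose just as well
  and leave room for slack, so that \<open>runs_cong\<close> can adjust the bound and the form of
  the final state together.\<close>

definition runs :: "com \<Rightarrow> state \<Rightarrow> nat \<Rightarrow> state \<Rightarrow> bool" where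
  "runs c s T s' \<longleftrightarrow> (\<exists>t\<le>T. exec c s t s')"

lemma runsI: "exec c s t s' \<Longrightarrow> runs c s t s'"
  unfolding runs_def by blast

lemma runs_mono: "runs c s T s' \<Longrightarrow> T \<le> T' \<Longrightarrow> runs c s T' s'"
  unfolding runs_def by (meson order_trans)

lemma runs_cong: "runs c s T s' \<Longrightarrow> T \<le> T' \<Longrightarrow> s' = s'' \<Longrightarrow> runs c s T' s''"
  using runs_mono by blast

lemmas runs_Skip = runsI[OF exec_Skip]
  and runs_Push = runsI[OF exec_Push]
  and runs_Pop = runsI[OF exec_Pop]
  and runs_Copy = runsI[OF exec_Copy]
  and runs_While_Nil = runsI[OF exec_While_Nil]

lemma runs_Seq: "runs c s T s' \<Longrightarrow> runs d s' T' s'' \<Longrightarrow> runs (Seq c d) s (T + T') s''"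
  unfolding runs_def by (meson add_mono exec_Seq)

lemma runs_Branch_True: "s r \<noteq> [] \<Longrightarrow> hd (s r) = a \<Longrightarrow> runs c s T s' \<Longrightarrow> runs (Branch r a c d) s (Suc T) s'"
  unfolding runs_def by (meson Suc_le_mono exec_Branch_True)

lemma runs_Branch_False: "s r = [] \<or> hd (s r) \<noteq> a \<Longrightarrow> runs d s T s' \<Longrightarrow> runs (Branch r a c d) s (Suc T) s'"
  unfolding runs_def by (meson Suc_le_mono exec_Branch_False)

lemma runs_While_Cons:
  "s r \<noteq> [] \<Longrightarrow> runs c s T s' \<Longrightarrow> runs (While r c) s' T' s'' \<Longrightarrow> runs (While r c) s (Suc (T + T')) s''"
  unfolding runs_def by (meson Suc_le_mono add_mono exec_While_Cons)

text \<open>A \<open>Copy\<close> makes nothing longer than what is already present, and any other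
  step adds at most one bit to a stack. This bounds the output length of the seeded extractor by its
  running time.\<close>

lemma exec_length_le:
  assumes "exec c s t s'" "\<And>r. length (s r) \<le> M"
  shows "length (s' r) \<le> M + t"
proof -
  have "(\<forall>r. length (s r) \<le> M) \<longrightarrow> (\<forall>r. length (s' r) \<le> M + t)" for M
    using assms(1)
  proof (induction arbitrary: M rule: exec.induct)
    case (exec_Seq c s t s' d t' s'')
    thus ?case by (auto simp: add.assoc[symmetric])
  next
    case (exec_While_Cons s r c t s' t' s'')
    thus ?case by (auto simp: add.assoc[symmetric] intro!: le_SucI)
  qed (auto simp: le_SucI trans_le_add1 intro: le_SucI order_trans[OF diff_le_self])
  thus ?thesis using assms(2) by blast
qed

section \<open>Running an unknown program on private stacks\<close>

primrec rename :: "(nat \<Rightarrow> nat) \<Rightarrow> com \<Rightarrow> com" where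
  "rename f Skip = Skip"
| "rename f (Push r a) = Push (f r) a"
| "rename f (Pop r) = Pop (f r)"
| "rename f (Copy r q) = Copy (f r) (f q)"
| "rename f (Seq c d) = Seq (rename f c) (rename f d)"
| "rename f (Branch r a c d) = Branch (f r) a (rename f c) (rename f d)"
| "rename f (While r c) = While (f r) (rename f c)"

text \<open>The composition \<open>\<sigma> \<circ> f\<close> is the part of the big state that the
  renamed program sees. Injectivity of \<open>f\<close> makes an update of stack \<open>f r\<close>
  look like an update of stack \<open>r\<close> alone.\<close>

lemma exec_rename:
  assumes f: "inj f" and "exec c s t s'" and "s = \<sigma> \<circ> f"
  shows "\<exists>\<sigma>'. exec (rename f c) \<sigma> t \<sigma>' \<and> s' = \<sigma>' \<circ> f \<and> (\<forall>q. q \<notin> range f \<longrightarrow> \<sigma>' q = \<sigma> q)"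
  using assms(2,3)
proof (induction arbitrary: \<sigma> rule: exec.induct)
  case (exec_Skip s)
  thus ?case using exec.exec_Skip[of \<sigma>] by (intro exI[of _ \<sigma>]) (simp del: One_nat_def)
next
  case (exec_Push r a s)
  show ?case
  proof (intro exI conjI)
    show "exec (rename f (Push r a)) \<sigma> 1 (\<sigma>(f r := a # \<sigma> (f r)))"
      unfolding rename.simps using exec.exec_Push[of "f r" a \<sigma>] exec_Push by simp
    show "s(r := a # s r) = (\<sigma>(f r := a # \<sigma> (f r))) \<circ> f"
      using exec_Push f by (auto simp: fun_eq_iff inj_eq)
  qed auto
next
  case (exec_Pop r s)
  show ?case
  proof (intro exI conjI)
    show "exec (rename f (Pop r)) \<sigma> 1 (\<sigma>(f r := tl (\<sigma> (f r))))"
      unfolding rename.simps using exec.exec_Pop[of "f r" \<sigma>] exec_Pop by simp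
    show "s(r := tl (s r)) = (\<sigma>(f r := tl (\<sigma> (f r)))) \<circ> f"
      using exec_Pop f by (auto simp: fun_eq_iff inj_eq)
  qed auto
next
  case (exec_Copy r q s)
  show ?case
  proof (intro exI conjI)
    show "exec (rename f (Copy r q)) \<sigma> (Suc (length (s q))) (\<sigma>(f r := \<sigma> (f q)))"
      unfolding rename.simps using exec.exec_Copy[of "f r" "f q" \<sigma>] exec_Copy by simp
    show "s(r := s q) = (\<sigma>(f r := \<sigma> (f q))) \<circ> f"
      using exec_Copy f by (auto simp: fun_eq_iff inj_eq)
  qed auto
next
  case (exec_Seq c s t s' d t' s'')
  from exec_Seq.IH(1)[OF exec_Seq.prems] obtain \<sigma>1 where
    1: "exec (rename f c) \<sigma> t \<sigma>1" "s' = \<sigma>1 \<circ> f" "\<forall>q. q \<notin> range f \<longrightarrow> \<sigma>1 q = \<sigma> q" by blast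
  from exec_Seq.IH(2)[OF 1(2)] obtain \<sigma>2 where
    2: "exec (rename f d) \<sigma>1 t' \<sigma>2" "s'' = \<sigma>2 \<circ> f" "\<forall>q. q \<notin> range f \<longrightarrow> \<sigma>2 q = \<sigma>1 q" by blast
  show ?case
    using exec.exec_Seq[OF 1(1) 2(1)] 1(3) 2(2,3) by (intro exI[of _ \<sigma>2]) auto
next
  case (exec_Branch_True s r a c t s' d)
  from exec_Branch_True.IH[OF exec_Branch_True.prems] obtain \<sigma>1 where
    1: "exec (rename f c) \<sigma> t \<sigma>1" "s' = \<sigma>1 \<circ> f" "\<forall>q. q \<notin> range f \<longrightarrow> \<sigma>1 q = \<sigma> q" by blast
  show ?case
    using exec.exec_Branch_True[of \<sigma> "f r" a, OF _ _ 1(1)] exec_Branch_True 1 by (intro exI[of _ \<sigma>1]) auto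
next
  case (exec_Branch_False s r a d t s' c)
  from exec_Branch_False.IH[OF exec_Branch_False.prems] obtain \<sigma>1 where
    1: "exec (rename f d) \<sigma> t \<sigma>1" "s' = \<sigma>1 \<circ> f" "\<forall>q. q \<notin> range f \<longrightarrow> \<sigma>1 q = \<sigma> q" by blast
  show ?case
    using exec.exec_Branch_False[of \<sigma> "f r" a, OF _ 1(1)] exec_Branch_False 1 by (intro exI[of _ \<sigma>1]) auto
next
  case (exec_While_Nil s r c)
  thus ?case using exec.exec_While_Nil[of \<sigma> "f r" "rename f c"]
    by (intro exI[of _ \<sigma>]) (auto simp del: One_nat_def)
next
  case (exec_While_Cons s r c t s' t' s'')
  from exec_While_Cons.IH(1)[OF exec_While_Cons.prems] obtain \<sigma>1 where
    1: "exec (rename f c) \<sigma> t \<sigma>1" "s' = \<sigma>1 \<circ> f" "\<forall>q. q \<notin> range f \<longrightarrow> \<sigma>1 q = \<sigma> q" by blast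
  from exec_While_Cons.IH(2)[OF 1(2)] obtain \<sigma>2 where
    2: "exec (rename f (While r c)) \<sigma>1 t' \<sigma>2" "s'' = \<sigma>2 \<circ> f" "\<forall>q. q \<notin> range f \<longrightarrow> \<sigma>2 q = \<sigma>1 q" by blast
  show ?case
    using exec.exec_While_Cons[of \<sigma> "f r", OF _ 1(1)] 2 1(3) exec_While_Cons.hyps exec_While_Cons.prems
    by (intro exI[of _ \<sigma>2]) auto
qed

text \<open>The main program uses the stacks below \<open>30\<close>; its \<open>j\<close>-th subroutine uses the stacks
  from \<open>30\<close> on that are congruent to \<open>j\<close> modulo \<open>3\<close>.\<close>

definition sub :: "nat \<Rightarrow> nat \<Rightarrow> nat" where
  "sub j r = 30 + 3 * r + j"

text \<open>The whole residue class has to look like a fresh initial state, with empty stacks beyond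
  the arguments, since nothing is known about which stacks the program reads. Each class therefore
  serves one call only.\<close>

lemma runs_call:
  assumes ex: "exec c (init_state ws) t s'" and \<sigma>: "\<And>r. \<sigma> (sub j r) = init_state ws r" and j: "j < 3"
  obtains \<sigma>' where "runs (rename (sub j) c) \<sigma> t \<sigma>'" "\<sigma>' (30 + j) = s' 0"
    "\<And>q. q < 30 \<or> q mod 3 \<noteq> j \<Longrightarrow> \<sigma>' q = \<sigma> q"
proof -
  have "inj (sub j)" by (auto simp: inj_def sub_def)
  moreover have "init_state ws = \<sigma> \<circ> sub j" using \<sigma> by auto
  ultimately obtain \<sigma>' where \<sigma>': "exec (rename (sub j) c) \<sigma> t \<sigma>'" "s' = \<sigma>' \<circ> sub j"
    "\<forall>q. q \<notin> range (sub j) \<longrightarrow> \<sigma>' q = \<sigma> q"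
    using exec_rename[OF _ ex] by blast
  have "(30 + 3 * r + j) mod 3 = j" for r
  proof -
    have "30 + 3 * r + j = j + 3 * (10 + r)" by simp
    thus ?thesis using j by (simp only: mod_mult_self2 mod_less)
  qed
  hence "q \<notin> range (sub j)" if "q < 30 \<or> q mod 3 \<noteq> j" for q
    using that by (auto simp: sub_def)
  with \<sigma>' show ?thesis
    by (intro that[of \<sigma>']) (auto simp: runs_def sub_def)
qed

section \<open>Elementary stack programs\<close>

definition push_top :: "nat \<Rightarrow> nat \<Rightarrow> com" where
  "push_top r q = Branch r 1 (Push q 1) (Branch r 0 (Push q 0) Skip)"

text \<open>On an empty stack both branches fail and nothing is pushed. The form
  \<open>take 1 (s r)\<close> includes this case, so that \<open>move_upto\<close> stays correct
  when its source is shorter than the counter.\<close>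

lemma runs_push_top: "runs (push_top r q) s 3 (s(q := take 1 (s r) @ s q))"
proof (cases "s r")
  case Nil
  have "runs (push_top r q) s 3 s"
    unfolding push_top_def
    by (rule runs_mono, rule runs_Branch_False, simp add: Nil, rule runs_Branch_False, simp add: Nil, rule runs_Skip) simp
  thus ?thesis using Nil by simp
next
  case (Cons a xs)
  show ?thesis
  proof (cases "a = 1")
    case True
    have "runs (push_top r q) s 3 (s(q := 1 # s q))"
      unfolding push_top_def
      by (rule runs_mono, rule runs_Branch_True, simp_all add: Cons True, rule runs_Push) simp
    thus ?thesis using Cons True by simp
  next
    case False
    hence a: "a = 0" by (cases a) auto
    have "runs (push_top r q) s 3 (s(q := 0 # s q))"
      unfolding push_top_def
      by (rule runs_mono, rule runs_Branch_False, simp add: Cons a, rule runs_Branch_True, simp_all add: Cons a, rule runs_Push) simp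
    thus ?thesis using Cons a by simp
  qed
qed

definition move :: "nat \<Rightarrow> nat \<Rightarrow> com" where
  "move r q = While r (Seq (push_top r q) (Pop r))"

lemma runs_move:
  assumes "r \<noteq> q"
  shows "runs (move r q) s (1 + 5 * length (s r)) (s(q := rev (s r) @ s q, r := []))"
proof (induction "s r" arbitrary: s)
  case Nil
  show ?case
    unfolding move_def by (rule runs_cong[OF runs_While_Nil]) (use Nil in auto)
next
  case (Cons a xs)
  note c = Cons(2)[symmetric]
  let ?s = "s(q := a # s q, r := xs)"
  have b: "runs (Seq (push_top r q) (Pop r)) s 4 ?s"
    by (rule runs_cong[OF runs_Seq[OF runs_push_top runs_Pop]]) (use c assms in auto)
  have w: "runs (move r q) ?s (1 + 5 * length (?s r)) (?s(q := rev (?s r) @ ?s q, r := []))"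
    by (rule Cons(1)) simp
  show ?case
    unfolding move_def
    by (rule runs_cong[OF runs_While_Cons[OF _ b w[unfolded move_def]]]) (use c assms in \<open>auto simp: fun_eq_iff\<close>)
qed

text \<open>Stack \<open>k\<close> is a unary counter and is used up. The prefix arrives reversed,
  so each use is followed by a \<open>move\<close> that restores the order.\<close>

definition move_upto :: "nat \<Rightarrow> nat \<Rightarrow> nat \<Rightarrow> com" where
  "move_upto k r q = While k (Seq (push_top r q) (Seq (Pop r) (Pop k)))"

lemma runs_move_upto:
  assumes "r \<noteq> q" "k \<noteq> r" "k \<noteq> q"
  shows "runs (move_upto k r q) s (1 + 6 * length (s k))
    (s(q := rev (take (length (s k)) (s r)) @ s q, r := drop (length (s k)) (s r), k := []))"
proof (induction "s k" arbitrary: s)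
  case Nil
  show ?case
    unfolding move_upto_def by (rule runs_cong[OF runs_While_Nil]) (use Nil in auto)
next
  case (Cons a ks)
  note c = Cons(2)[symmetric]
  let ?s = "s(q := take 1 (s r) @ s q, r := tl (s r), k := ks)"
  have b: "runs (Seq (push_top r q) (Seq (Pop r) (Pop k))) s 5 ?s"
    by (rule runs_cong[OF runs_Seq[OF runs_push_top runs_Seq[OF runs_Pop runs_Pop]]]) (use c assms in auto)
  have w: "runs (move_upto k r q) ?s (1 + 6 * length (?s k))
    (?s(q := rev (take (length (?s k)) (?s r)) @ ?s q, r := drop (length (?s k)) (?s r), k := []))"
    by (rule Cons(1)) simp
  have "rev (take (length ks) (tl (s r))) @ take 1 (s r) = rev (take (Suc (length ks)) (s r))"
    "drop (length ks) (tl (s r)) = drop (Suc (length ks)) (s r)"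
    by (cases "s r"; simp)+
  thus ?case
    unfolding move_upto_def
    by (intro runs_cong[OF runs_While_Cons[OF _ b w[unfolded move_upto_def]]])
      (use c assms in \<open>auto simp: fun_eq_iff\<close>)
qed

definition flip :: "nat \<Rightarrow> com" where
  "flip r = Branch r 1 (Seq (Pop r) (Push r 0)) (Seq (Pop r) (Push r 1))"

lemma runs_flip:
  assumes "s r = v # vs"
  shows "runs (flip r) s 3 (s(r := (v + 1) # vs))"
proof -
  have p: "runs (Seq (Pop r) (Push r a)) s 2 (s(r := a # vs))" for a
    by (rule runs_cong[OF runs_Seq[OF runs_Pop runs_Push]]) (use assms in auto)
  show ?thesis
  proof (cases "v = 1")
    case True
    show ?thesis
      unfolding flip_def by (rule runs_cong[OF runs_Branch_True[OF _ _ p]]) (use assms True in auto)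
  next
    case False
    hence "v = 0" by (cases v) auto
    thus ?thesis
      unfolding flip_def by (intro runs_cong[OF runs_Branch_False[OF _ p]]) (use assms in auto)
  qed
qed

section \<open>Evaluating the hash from a stream of matrix entries\<close>

definition add_top :: "nat \<Rightarrow> nat \<Rightarrow> nat \<Rightarrow> nat \<Rightarrow> com" where
  "add_top p q r w = Branch p 1 (Branch q 1 (Branch r 1 (flip w) Skip) Skip) Skip"

text \<open>Over GF(2) the product of the three bits is 1 only if all of them are, so three nested
  branches around one \<open>flip\<close> multiply and add at once.\<close>

lemma runs_add_top:
  assumes "s p = a # as" "s q = b # bs" "s r = c # cs" "s w = v # vs"
  shows "runs (add_top p q r w) s 6 (s(w := (v + a * b * c) # vs))"
proof (cases "a = 1 \<and> b = 1 \<and> c = 1")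
  case True
  have "runs (add_top p q r w) s (Suc (Suc (Suc 3))) (s(w := (v + 1) # vs))"
    unfolding add_top_def using assms True by (intro runs_Branch_True runs_flip) auto
  thus ?thesis using True by (simp add: eval_nat_numeral)
next
  case False
  hence z: "a * b * c = 0" by (cases a; cases b; cases c) auto
  have "runs (add_top p q r w) s 6 s"
  proof (cases "a = 1")
    case a: True
    show ?thesis
    proof (cases "b = 1")
      case b: True
      have "runs (add_top p q r w) s (Suc (Suc (Suc 1))) s"
        unfolding add_top_def
        by (intro runs_Branch_True runs_Branch_False[where r = r] runs_Skip) (use assms a b False in auto)
      thus ?thesis by (rule runs_mono) simp
    next
      case b: False
      have "runs (add_top p q r w) s (Suc (Suc 1)) s"
        unfolding add_top_def
        by (intro runs_Branch_True runs_Branch_False[where r = q] runs_Skip) (use assms a b in auto)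
      thus ?thesis by (rule runs_mono) simp
    qed
  next
    case a: False
    have "runs (add_top p q r w) s (Suc 1) s"
      unfolding add_top_def by (intro runs_Branch_False runs_Skip) (use assms a in auto)
    thus ?thesis by (rule runs_mono) simp
  qed
  moreover have "s(w := (v + a * b * c) # vs) = s" using z assms by auto
  ultimately show ?thesis by simp
qed

definition dot_list :: "bit list \<Rightarrow> bit list \<Rightarrow> bit" where
  "dot_list as xs = (\<Sum>(a, x)\<leftarrow>zip as xs. a * x)"

text \<open>The order of summation follows the row-major stream of entries: each entry is met once
  and can be popped, while \<open>x\<close> is reloaded for each row and \<open>y\<close> is
  consumed along the rows.\<close>

definition bilinear_list :: "bit list list \<Rightarrow> bit list \<Rightarrow> bit list \<Rightarrow> bit" where
  "bilinear_list M xs ys = (\<Sum>(row, y)\<leftarrow>zip M ys. y * dot_list row xs)"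

text \<open>Stack \<open>30\<close> holds the remaining matrix entries, \<open>11\<close> the rest of \<open>x\<close>, \<open>10\<close> the rest of \<open>y\<close>,
  and the top of \<open>12\<close> is the accumulator.\<close>

definition row_prog :: com where
  "row_prog = While 11 (Seq (add_top 10 30 11 12) (Seq (Pop 30) (Pop 11)))"

lemma runs_row_prog:
  assumes "s 10 = y # ys" "s 11 = xs" "s 30 = as @ rest" "length as = length xs" "s 12 = v # vs"
  shows "runs row_prog s (1 + 9 * length xs) (s(30 := rest, 11 := [], 12 := (v + y * dot_list as xs) # vs))"
  using assms
proof (induction xs arbitrary: s as v)
  case Nil
  show ?case
    unfolding row_prog_def
    by (rule runs_cong[OF runs_While_Nil]) (use Nil in \<open>auto simp: dot_list_def fun_eq_iff\<close>)
next
  case (Cons x xs)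
  then obtain a as' where as: "as = a # as'" by (cases as) auto
  let ?s = "s(12 := (v + y * a * x) # vs, 30 := as' @ rest, 11 := xs)"
  have b: "runs (Seq (add_top 10 30 11 12) (Seq (Pop 30) (Pop 11))) s 8 ?s"
    by (rule runs_cong[OF runs_Seq[OF runs_add_top runs_Seq[OF runs_Pop runs_Pop]]])
      (use Cons.prems as in auto)
  have w: "runs row_prog ?s (1 + 9 * length xs)
      (?s(30 := rest, 11 := [], 12 := (v + y * a * x + y * dot_list as' xs) # vs))"
    by (rule Cons.IH) (use Cons.prems as in auto)
  have "v + y * a * x + y * dot_list as' xs = v + y * dot_list as (x # xs)"
    by (simp add: as dot_list_def distrib_left mult.assoc add.assoc)
  thus ?case
    unfolding row_prog_def
    by (intro runs_cong[OF runs_While_Cons[OF _ b w[unfolded row_prog_def]]])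
      (use Cons.prems in \<open>auto simp: fun_eq_iff\<close>)
qed

definition matrix_prog :: com where
  "matrix_prog = While 10 (Seq (Copy 11 7) (Seq row_prog (Pop 10)))"

lemma runs_matrix_prog:
  assumes "s 10 = ys" "s 30 = concat M @ rest" "length M = length ys" "\<forall>row\<in>set M. length row = length (s 7)"
    "s 12 = v # vs" "s 11 = []"
  shows "runs matrix_prog s (1 + (4 + 10 * length (s 7)) * length ys)
    (s(30 := rest, 10 := [], 12 := (v + bilinear_list M (s 7) ys) # vs))"
  using assms
proof (induction ys arbitrary: s M v)
  case Nil
  show ?case
    unfolding matrix_prog_def
    by (rule runs_cong[OF runs_While_Nil]) (use Nil in \<open>auto simp: bilinear_list_def fun_eq_iff\<close>)
next
  case (Cons y ys)
  then obtain row M' where M: "M = row # M'" by (cases M) auto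
  let ?s1 = "s(11 := s 7)"
  let ?s = "s(30 := concat M' @ rest, 12 := (v + y * dot_list row (s 7)) # vs, 10 := ys)"
  have r: "runs row_prog ?s1 (1 + 9 * length (s 7))
      (?s1(30 := concat M' @ rest, 11 := [], 12 := (v + y * dot_list row (s 7)) # vs))"
    by (rule runs_row_prog) (use Cons.prems M in auto)
  have b: "runs (Seq (Copy 11 7) (Seq row_prog (Pop 10))) s (3 + 10 * length (s 7)) ?s"
    by (rule runs_cong[OF runs_Seq[OF runs_Copy runs_Seq[OF r runs_Pop]]])
      (use Cons.prems in \<open>auto simp: fun_eq_iff\<close>)
  have w: "runs matrix_prog ?s (1 + (4 + 10 * length (?s 7)) * length ys)
      (?s(30 := rest, 10 := [], 12 := (v + y * dot_list row (s 7) + bilinear_list M' (?s 7) ys) # vs))"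
    by (rule Cons.IH) (use Cons.prems M in auto)
  have "v + y * dot_list row (s 7) + bilinear_list M' (s 7) ys = v + bilinear_list M (s 7) (y # ys)"
    by (simp add: M bilinear_list_def add.assoc)
  thus ?case
    unfolding matrix_prog_def
    by (intro runs_cong[OF runs_While_Cons[OF _ b w[unfolded matrix_prog_def]]])
      (use Cons.prems in \<open>auto simp: fun_eq_iff\<close>)
qed

definition hash_prog :: com where
  "hash_prog = While 9 (Seq (Pop 9) (Seq (Push 12 0) (Seq (Copy 10 8) matrix_prog)))"

text \<open>Every matrix pushes a fresh accumulator, so the hash bits pile up in reverse order. The
  tail \<open>rest\<close> stands for the matrices of index at least \<open>l\<close>, which are in
  the table but do not belong to the hash.\<close>

lemma runs_hash_prog:
  assumes "length (s 9) = length Ms" "s 30 = concat (map concat Ms) @ rest"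
    "\<forall>M\<in>set Ms. length M = length (s 8) \<and> (\<forall>row\<in>set M. length row = length (s 7))"
    "s 10 = []" "s 11 = []"
  shows "runs hash_prog s (1 + (5 + length (s 8) + (4 + 10 * length (s 7)) * length (s 8)) * length Ms)
    (s(30 := rest, 9 := [], 12 := rev (map (\<lambda>M. bilinear_list M (s 7) (s 8)) Ms) @ s 12))"
  using assms
proof (induction Ms arbitrary: s)
  case Nil
  show ?case
    unfolding hash_prog_def by (rule runs_cong[OF runs_While_Nil]) (use Nil in \<open>auto simp: fun_eq_iff\<close>)
next
  case (Cons M Ms)
  let ?b = "bilinear_list M (s 7) (s 8)"
  let ?s1 = "s(9 := tl (s 9), 12 := 0 # s 12, 10 := s 8)"
  let ?s = "s(9 := tl (s 9), 30 := concat (map concat Ms) @ rest, 12 := ?b # s 12)"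
  have m: "runs matrix_prog ?s1 (1 + (4 + 10 * length (?s1 7)) * length (s 8))
      (?s1(30 := concat (map concat Ms) @ rest, 10 := [], 12 := (0 + bilinear_list M (?s1 7) (s 8)) # s 12))"
    by (rule runs_matrix_prog) (use Cons.prems in auto)
  have b: "runs (Seq (Pop 9) (Seq (Push 12 0) (Seq (Copy 10 8) matrix_prog))) s
      (4 + length (s 8) + (4 + 10 * length (s 7)) * length (s 8)) ?s"
  proof (rule runs_cong[OF runs_Seq[OF runs_Pop runs_Seq[OF runs_Push runs_Seq[OF runs_Copy]]]])
    show "runs matrix_prog ((s(9 := tl (s 9), 12 := 0 # (s(9 := tl (s 9))) 12))
        (10 := (s(9 := tl (s 9), 12 := 0 # (s(9 := tl (s 9))) 12)) 8))
      (1 + (4 + 10 * length (s 7)) * length (s 8)) ?s"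
      by (rule runs_cong[OF m[THEN back_subst[of "\<lambda>s. runs matrix_prog s _ _"]]]) (use Cons.prems in \<open>auto simp: fun_eq_iff\<close>)
  qed auto
  have w: "runs hash_prog ?s (1 + (5 + length (?s 8) + (4 + 10 * length (?s 7)) * length (?s 8)) * length Ms)
    (?s(30 := rest, 9 := [], 12 := rev (map (\<lambda>M. bilinear_list M (?s 7) (?s 8)) Ms) @ ?s 12))"
    by (rule Cons.IH) (use Cons.prems in auto)
  show ?case
    unfolding hash_prog_def
    by (rule runs_cong[OF runs_While_Cons[OF _ b w[unfolded hash_prog_def]]])
      (use Cons.prems in \<open>auto simp: fun_eq_iff algebra_simps\<close>)
qed

lemma sum_list_zip:
  "length as = length bs \<Longrightarrow> (\<Sum>(a, b)\<leftarrow>zip as bs. g a b) = (\<Sum>i<length as. g (as ! i) (bs ! i))"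
  by (simp add: sum_list_sum_nth case_prod_beta atLeast0LessThan)

lemma E_D_eq_bilinear_list:
  assumes A: "\<And>i. i < l \<Longrightarrow> A n i \<in> carrier_mat n n" and x: "x \<in> bits n" and y: "y \<in> bits n"
  shows "E_D A n l x y = map (\<lambda>i. bilinear_list (map list_of_vec (rows (A n i))) x y) [0..<l]"
proof -
  have "(A n i *\<^sub>v vec_of_list x) \<bullet> vec_of_list y = bilinear_list (map list_of_vec (rows (A n i))) x y" if "i < l" for i
  proof -
    note Ai = A[OF that]
    have r: "dot_list (map list_of_vec (rows (A n i)) ! r) x = (A n i *\<^sub>v vec_of_list x) $ r" if "r < n" for r
      using Ai x that
      by (auto simp: dot_list_def sum_list_zip bits_def scalar_prod_def list_of_vec_index vec_of_list_index atLeast0LessThan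
          intro!: sum.cong)
    have "bilinear_list (map list_of_vec (rows (A n i))) x y =
        (\<Sum>r<n. y ! r * dot_list (map list_of_vec (rows (A n i)) ! r) x)"
      unfolding bilinear_list_def using Ai y by (subst sum_list_zip) (auto simp: bits_def)
    also have "\<dots> = (\<Sum>r<n. (A n i *\<^sub>v vec_of_list x) $ r * y ! r)"
      using r by (intro sum.cong refl) (simp add: mult.commute)
    also have "\<dots> = (A n i *\<^sub>v vec_of_list x) \<bullet> vec_of_list y"
      using y by (auto simp: scalar_prod_def bits_def vec_of_list_index atLeast0LessThan intro!: sum.cong)
    finally show ?thesis ..
  qed
  thus ?thesis by (simp add: E_D_def)
qed

text \<open>The inputs \<open>n\<close>, flag, \<open>l\<close>, \<open>k\<close>, \<open>b\<close>, \<open>e\<close>, \<open>m\<close>, \<open>x\<close>, \<open>y\<close> are on stacks \<open>0\<close> to \<open>8\<close>. Stack \<open>13\<close> holds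
  the hash, then its surplus bits, then the untruncated output. The results of the subroutines
  (matrices, seed length, seeded extractor) appear on stacks \<open>30\<close>, \<open>31\<close>, \<open>32\<close>.\<close>

definition deor_prog :: "com \<Rightarrow> com \<Rightarrow> com \<Rightarrow> com" where
  "deor_prog cA cD cE =
    Seq (Seq (Copy 30 0) (rename (sub 0) cA))
   (Seq (Seq (Copy 31 0) (Seq (Copy 34 3) (Seq (Copy 37 4) (Seq (Copy 40 5) (rename (sub 1) cD)))))
   (Seq (Seq (Copy 9 2) (Seq hash_prog (move 12 13)))
   (Seq (Seq (move_upto 31 13 14) (move 14 47))
   (Seq (Seq (Copy 32 0) (Seq (Copy 35 3) (Seq (Copy 38 4) (Seq (Copy 41 5)
          (Seq (Branch 1 1 (Copy 44 7) (Copy 44 8)) (rename (sub 2) cE))))))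
        (Seq (move 32 15) (Seq (move 15 13) (Seq (move_upto 6 13 16) (Seq (Copy 0 17) (move 16 0)))))))))"

lemma length_unary [simp]: "length (unary n) = n"
  by (simp add: unary_def)

lemma runs_deor_prog:
  fixes A d E\<^sub>S and n k b e :: nat
  defines "D \<equiv> d n k b e"
  assumes exA: "exec cA (init_state [unary n]) tA sA"
      "sA 0 = concat (map (\<lambda>i. concat (map list_of_vec (rows (A n i)))) [0..<n])"
    and exD: "exec cD (init_state [unary n, unary k, unary b, unary e]) tD sD" "sD 0 = unary D"
    and exE: "exec cE (init_state [unary n, unary k, unary b, unary e, if fst_src then x else y, take D (E_D A n l x y)]) tE sE"
      "sE 0 = E\<^sub>S n k b e (if fst_src then x else y) (take D (E_D A n l x y))"
    and A: "\<And>i. i < l \<Longrightarrow> A n i \<in> carrier_mat n n" and x: "x \<in> bits n" and y: "y \<in> bits n"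
    and l: "l \<le> n" and D: "D \<le> l"
    and N: "n \<le> N" "k \<le> N" "b \<le> N" "e \<le> N" "m \<le> N"
  obtains s where
    "runs (deor_prog cA cD cE) (init_state [unary n, [of_bool fst_src], unary l, unary k, unary b, unary e, unary m, x, y])
      (tA + tD + 11 * tE + 100 * N + 100 + (5 + N + (4 + 10 * N) * N) * N) s"
    "s 0 = deor A d E\<^sub>S n fst_src l k b e m x y"
proof -
  define s0 where "s0 = init_state [unary n, [of_bool fst_src], unary l, unary k, unary b, unary e, unary m, x, y]"
  have s0: "s0 0 = unary n" "s0 1 = [of_bool fst_src]" "s0 2 = unary l" "s0 3 = unary k" "s0 4 = unary b"
    "s0 5 = unary e" "s0 6 = unary m" "s0 7 = x" "s0 8 = y"
    by (simp_all add: s0_def init_state_def)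
  have s0': "s0 q = []" if "9 \<le> q" for q
    using that by (simp add: s0_def init_state_def)
  define u where "u = E_D A n l x y"
  define Ms where "Ms = map (\<lambda>i. map list_of_vec (rows (A n i))) [0..<l]"
  define rest where "rest = concat (map (\<lambda>i. concat (map list_of_vec (rows (A n i)))) [l..<n])"
  have lu: "length u = l" by (simp add: u_def E_D_def)
  have lx: "length x = n" "length y = n" using x y by (auto simp: bits_def)
  have tab: "sA 0 = concat (map concat Ms) @ rest"
  proof -
    have "[0..<n] = [0..<l] @ [l..<n]" using l by (metis le_add_diff_inverse upt_add_eq_append zero_le)
    thus ?thesis by (simp add: exA(2) Ms_def rest_def comp_def)
  qed
  let ?s1 = "s0(30 := s0 0)"
  have i1: "?s1 (sub 0 r) = init_state [unary n] r" for r
    using s0 s0' by (cases "r = 0") (auto simp: sub_def init_state_def)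
  obtain s2 where s2: "runs (rename (sub 0) cA) ?s1 tA s2" "s2 (30 + 0) = sA 0"
    and s2': "\<And>q. q < 30 \<or> q mod 3 \<noteq> 0 \<Longrightarrow> s2 q = ?s1 q"
    by (rule runs_call[where j = 0 and \<sigma> = ?s1, OF exA(1) i1]) (simp, erule that, assumption, blast)
  have A': "runs (Seq (Copy 30 0) (rename (sub 0) cA)) s0 (N + 1 + tA) s2"
    by (rule runs_cong[OF runs_Seq[OF runs_Copy s2(1)]]) (use s0 N in auto)
  let ?s3 = "s2(31 := unary n, 34 := unary k, 37 := unary b, 40 := unary e)"
  have i3: "?s3 (sub 1 r) = init_state [unary n, unary k, unary b, unary e] r" for r
  proof -
    consider "r = 0" | "r = 1" | "r = 2" | "r = 3" | "4 \<le> r" by linarith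
    thus ?thesis
    proof cases
      case 5
      have "(30 + 3 * r + 1) mod 3 = 1" by presburger
      thus ?thesis using 5 s2'[of "30 + 3 * r + 1"] s0'[of "30 + 3 * r + 1"] by (simp add: sub_def init_state_def)
    qed (simp_all add: sub_def init_state_def)
  qed
  obtain s4 where s4: "runs (rename (sub 1) cD) ?s3 tD s4" "s4 (30 + 1) = sD 0"
    and s4': "\<And>q. q < 30 \<or> q mod 3 \<noteq> 1 \<Longrightarrow> s4 q = ?s3 q"
    by (rule runs_call[where j = 1 and \<sigma> = ?s3, OF exD(1) i3]) (simp, erule that, assumption, blast)
  have D': "runs (Seq (Copy 31 0) (Seq (Copy 34 3) (Seq (Copy 37 4) (Seq (Copy 40 5) (rename (sub 1) cD))))) s2
      (4 * N + 4 + tD) s4"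
  proof -
    have "runs (rename (sub 1) cD) (s2(31 := s2 0, 34 := (s2(31 := s2 0)) 3, 37 := (s2(31 := s2 0, 34 := (s2(31 := s2 0)) 3)) 4,
        40 := (s2(31 := s2 0, 34 := (s2(31 := s2 0)) 3, 37 := (s2(31 := s2 0, 34 := (s2(31 := s2 0)) 3)) 4)) 5)) tD s4"
      using s4(1) s0 s2' by simp
    from runs_Seq[OF runs_Copy runs_Seq[OF runs_Copy runs_Seq[OF runs_Copy runs_Seq[OF runs_Copy this]]]]
    show ?thesis by (rule runs_cong) (use s0 s2' N in auto)
  qed
  have m4: "s4 q = s0 q" if "q < 30" for q
    using that s4'[of q] s2'[of q] by simp
  \<comment> \<open>The first two calls leave residue class 2 alone. This makes the class fresh for
    the third call, including stack 47, its sixth argument, which receives the seed before the other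
    arguments are copied.\<close>
  have e4: "s4 (30 + 3 * r + 2) = []" for r
  proof -
    have "(30 + 3 * r + 2) mod 3 = 2" "3 * r \<noteq> 2" "3 * r \<noteq> 5" "3 * r \<noteq> 8" by presburger+
    thus ?thesis using s4'[of "30 + 3 * r + 2"] s2'[of "30 + 3 * r + 2"] s0'[of "30 + 3 * r + 2"] by simp
  qed
  let ?s5 = "s4(9 := unary l)"
  let ?s7 = "s4(30 := rest, 13 := u)"
  have t4: "s4 30 = sA 0" using s4'[of 30] s2(2) by simp
  have rows: "dim_row (A n i) = n" "\<forall>v\<in>set (rows (A n i)). dim_vec v = n" if "i < l" for i
    using A[OF that] by (auto simp: rows_def)
  have u_eq: "u = map (\<lambda>i. bilinear_list (map list_of_vec (rows (A n i))) x y) [0..<l]"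
    unfolding u_def by (rule E_D_eq_bilinear_list) (use A x y in auto)
  have "runs hash_prog ?s5 (1 + (5 + length (?s5 8) + (4 + 10 * length (?s5 7)) * length (?s5 8)) * length Ms)
    (?s5(30 := rest, 9 := [], 12 := rev (map (\<lambda>M. bilinear_list M (?s5 7) (?s5 8)) Ms) @ ?s5 12))"
    by (rule runs_hash_prog) (use m4 s0 s0' t4 tab rows in \<open>auto simp: Ms_def lx\<close>)
  hence h: "runs hash_prog ?s5 (1 + (5 + n + (4 + 10 * n) * n) * l) (s4(30 := rest, 9 := [], 12 := rev u))"
    by (rule runs_cong)
      (use m4 s0 s0' in \<open>auto simp: Ms_def lx u_eq comp_def fun_eq_iff\<close>)
  have H': "runs (Seq (Copy 9 2) (Seq hash_prog (move 12 13))) s4 (10 * N + 10 + (5 + N + (4 + 10 * N) * N) * N) ?s7"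
  proof -
    have h': "runs hash_prog (s4(9 := s4 2)) (1 + (5 + n + (4 + 10 * n) * n) * l) (s4(30 := rest, 9 := [], 12 := rev u))"
      using h m4[of 2] s0 by simp
    have "(5 + n + (4 + 10 * n) * n) * l \<le> (5 + N + (4 + 10 * N) * N) * N"
      using N l by (intro mult_le_mono add_le_mono) auto
    thus ?thesis
      by (intro runs_cong[OF runs_Seq[OF runs_Copy runs_Seq[OF h' runs_move]]])
        (use m4 s0 s0' lu N l in \<open>auto simp: fun_eq_iff\<close>)
  qed
  let ?s9 = "s4(30 := rest, 13 := drop D u, 31 := [], 47 := take D u)"
  have S': "runs (Seq (move_upto 31 13 14) (move 14 47)) ?s7 (12 * N + 12) ?s9"
    by (rule runs_cong[OF runs_Seq[OF runs_move_upto runs_move]])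
      (use m4 s0' s4(2) exD(2) lu N l D e4[of 5] in \<open>auto simp: fun_eq_iff\<close>)
  let ?v = "if fst_src then x else y"
  let ?s10 = "?s9(32 := unary n, 35 := unary k, 38 := unary b, 41 := unary e, 44 := ?v)"
  have i10: "?s10 (sub 2 r) = init_state [unary n, unary k, unary b, unary e, ?v, take D u] r" for r
  proof -
    consider "r = 0" | "r = 1" | "r = 2" | "r = 3" | "r = 4" | "r = 5" | "6 \<le> r" by linarith
    thus ?thesis
    proof cases
      case 7
      thus ?thesis using e4[of r] by (auto simp: sub_def init_state_def)
    qed (simp_all add: sub_def init_state_def)
  qed
  obtain s11 where s11: "runs (rename (sub 2) cE) ?s10 tE s11" "s11 (30 + 2) = sE 0"
    and s11': "\<And>q. q < 30 \<or> q mod 3 \<noteq> 2 \<Longrightarrow> s11 q = ?s10 q"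
    by (rule runs_call[where j = 2 and \<sigma> = ?s10, OF exE(1)[folded u_def] i10]) (simp, erule that, assumption, blast)
  let ?t9 = "?s9(32 := unary n, 35 := unary k, 38 := unary b, 41 := unary e)"
  have br: "runs (Branch 1 1 (Copy 44 7) (Copy 44 8)) ?t9 (N + 2) ?s10"
  proof (cases fst_src)
    case True
    show ?thesis
      by (rule runs_cong[OF runs_Branch_True[OF _ _ runs_Copy]]) (use True m4 s0 lx N in auto)
  next
    case False
    show ?thesis
      by (rule runs_cong[OF runs_Branch_False[OF _ runs_Copy]]) (use False m4 s0 lx N in auto)
  qed
  have E1: "runs (Seq (Copy 32 0) (Seq (Copy 35 3) (Seq (Copy 38 4) (Seq (Copy 41 5)
          (Seq (Branch 1 1 (Copy 44 7) (Copy 44 8)) (rename (sub 2) cE)))))) ?s9 (5 * N + 6 + tE) s11"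
  proof -
    have "runs (Seq (Branch 1 1 (Copy 44 7) (Copy 44 8)) (rename (sub 2) cE))
      (?s9(32 := ?s9 0, 35 := (?s9(32 := ?s9 0)) 3, 38 := (?s9(32 := ?s9 0, 35 := (?s9(32 := ?s9 0)) 3)) 4,
        41 := (?s9(32 := ?s9 0, 35 := (?s9(32 := ?s9 0)) 3, 38 := (?s9(32 := ?s9 0, 35 := (?s9(32 := ?s9 0)) 3)) 4)) 5)) (N + 2 + tE) s11"
      using runs_Seq[OF br s11(1)] m4 s0 by simp
    from runs_Seq[OF runs_Copy runs_Seq[OF runs_Copy runs_Seq[OF runs_Copy runs_Seq[OF runs_Copy this]]]]
    show ?thesis by (rule runs_cong) (use m4 s0 N in auto)
  qed
  define w where "w = E\<^sub>S n k b e ?v (take D u)"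
  have w: "s11 32 = w" using s11(2) exE(2) by (simp add: w_def u_def)
  \<comment> \<open>The output is moved twice, at five steps per bit each time. With this bound that
    costs another \<open>10 * tE\<close>, which explains the coefficient 11 in the time
    bound.\<close>
  have lw: "length w \<le> 2 * N + tE + 1"
  proof -
    have "length (init_state [unary n, unary k, unary b, unary e, ?v, take D u] r) \<le> N + N + 1" for r
    proof -
      consider "r = 0" | "r = 1" | "r = 2" | "r = 3" | "r = 4" | "r = 5" | "6 \<le> r" by linarith
      thus ?thesis by cases (use N lx lu l D in \<open>auto simp: init_state_def\<close>)
    qed
    from exec_length_le[OF exE(1)[folded u_def] this, of 0] show ?thesis using exE(2) by (simp add: w_def u_def)
  qed
  have e11: "s11 13 = drop D u" "s11 15 = []" "s11 16 = []" "s11 17 = []" "s11 6 = unary m"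
    using s11'[of 13] s11'[of 15] s11'[of 16] s11'[of 17] s11'[of 6] m4 s0 s0' by simp_all
  obtain s where F': "runs (Seq (move 32 15) (Seq (move 15 13) (Seq (move_upto 6 13 16) (Seq (Copy 0 17) (move 16 0)))))
      s11 (10 * length w + 11 * N + 20) s" and s: "s 0 = take m (w @ drop D u)"
  proof -
    let ?t1 = "s11(15 := rev w, 32 := [])"
    let ?t2 = "s11(15 := [], 32 := [], 13 := w @ drop D u)"
    let ?t3 = "s11(15 := [], 32 := [], 16 := rev (take m (w @ drop D u)), 13 := drop m (w @ drop D u), 6 := [])"
    let ?t4 = "s11(15 := [], 32 := [], 16 := rev (take m (w @ drop D u)), 13 := drop m (w @ drop D u), 6 := [], 0 := [])"
    let ?t5 = "s11(15 := [], 32 := [], 13 := drop m (w @ drop D u), 6 := [], 0 := take m (w @ drop D u), 16 := [])"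
    have 1: "runs (move 32 15) s11 (1 + 5 * length w) ?t1"
      by (rule runs_cong[OF runs_move]) (use w e11 in \<open>auto simp: fun_eq_iff\<close>)
    have 2: "runs (move 15 13) ?t1 (1 + 5 * length w) ?t2"
      by (rule runs_cong[OF runs_move]) (use e11 in \<open>auto simp: fun_eq_iff\<close>)
    have 3: "runs (move_upto 6 13 16) ?t2 (1 + 6 * N) ?t3"
      by (rule runs_cong[OF runs_move_upto]) (use e11 N in \<open>auto simp: fun_eq_iff\<close>)
    \<comment> \<open>Stack 17 has never been written. Copying it empties stack 0, which still holds
      the input \<open>n\<close>, before the result is moved there.\<close>
    have 4: "runs (Copy 0 17) ?t3 1 ?t4"
      by (rule runs_cong[OF runs_Copy]) (use e11 in \<open>auto simp: fun_eq_iff\<close>)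
    have 5: "runs (move 16 0) ?t4 (1 + 5 * N) ?t5"
      by (rule runs_cong[OF runs_move]) (use N in \<open>auto simp: fun_eq_iff\<close>)
    show ?thesis
      by (rule that[OF runs_mono[OF runs_Seq[OF 1 runs_Seq[OF 2 runs_Seq[OF 3 runs_Seq[OF 4 5]]]]]]) auto
  qed
  show ?thesis
  proof (rule that[of s])
    show "s 0 = deor A d E\<^sub>S n fst_src l k b e m x y"
      by (simp add: s deor_def copy_surplus_def w_def u_def D_def)
    show "runs (deor_prog cA cD cE) (init_state [unary n, [of_bool fst_src], unary l, unary k, unary b, unary e, unary m, x, y])
      (tA + tD + 11 * tE + 100 * N + 100 + (5 + N + (4 + 10 * N) * N) * N) s"
      unfolding deor_prog_def s0_def[symmetric]
      by (rule runs_mono[OF runs_Seq[OF A' runs_Seq[OF D' runs_Seq[OF H' runs_Seq[OF S' runs_Seq[OF E1 F']]]]]])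
        (use lw in linarith)
  qed
qed

section \<open>Polynomial time bounds\<close>

definition poly_bounded :: "(nat \<Rightarrow> nat) \<Rightarrow> bool" where
  "poly_bounded f \<longleftrightarrow> (\<exists>a. \<forall>N\<ge>2. f N \<le> N ^ a)"

text \<open>A constant is absorbed through c \<le> 2^c \<le> N^c. This is why bounds are only
  demanded from 2 on, and why a single power of \<open>N\<close> suffices for all of them.\<close>

lemma poly_bounded_const: "poly_bounded (\<lambda>_. c)"
  unfolding poly_bounded_def
proof (intro exI[of _ c] allI impI)
  fix N :: nat assume "2 \<le> N"
  have "c \<le> 2 ^ c" by (rule less_imp_le[OF less_exp])
  also have "\<dots> \<le> N ^ c" using \<open>2 \<le> N\<close> by (intro power_mono) auto
  finally show "c \<le> N ^ c" .
qed

lemma poly_bounded_id: "poly_bounded (\<lambda>N. N)"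
  unfolding poly_bounded_def by (rule exI[of _ 1]) simp

lemma poly_bounded_mult:
  assumes "poly_bounded f" "poly_bounded g"
  shows "poly_bounded (\<lambda>N. f N * g N)"
proof -
  obtain a b where "\<forall>N\<ge>2. f N \<le> N ^ a" "\<forall>N\<ge>2. g N \<le> N ^ b"
    using assms by (auto simp: poly_bounded_def)
  hence "\<forall>N\<ge>2. f N * g N \<le> N ^ (a + b)" by (auto simp: power_add intro: mult_le_mono)
  thus ?thesis unfolding poly_bounded_def by blast
qed

lemma poly_bounded_add:
  assumes "poly_bounded f" "poly_bounded g"
  shows "poly_bounded (\<lambda>N. f N + g N)"
proof -
  obtain a b where ab: "\<forall>N\<ge>2. f N \<le> N ^ a" "\<forall>N\<ge>2. g N \<le> N ^ b"
    using assms by (auto simp: poly_bounded_def)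
  have "f N + g N \<le> N ^ (a + b + 1)" if N: "2 \<le> N" for N
  proof -
    have "N ^ a \<le> N ^ (a + b)" "N ^ b \<le> N ^ (a + b)" using N by (auto intro: power_increasing)
    hence "f N + g N \<le> 2 * N ^ (a + b)" using ab(1)[rule_format, OF N] ab(2)[rule_format, OF N] by linarith
    also have "\<dots> \<le> N * N ^ (a + b)" using N by (intro mult_le_mono) auto
    finally show ?thesis by simp
  qed
  thus ?thesis unfolding poly_bounded_def by blast
qed

lemma poly_bounded_power: "poly_bounded (\<lambda>N. N ^ a)"
  unfolding poly_bounded_def by blast

text \<open>The three subprograms are fixed before any parameter, so one program serves all
  parameters. Every subroutine argument is bounded by the total input length \<open>N\<close>; for
  the seed this uses that its length is at most \<open>l\<close>, which is part of the input in
  unary.\<close>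

lemma deor_explicitI:
  assumes A: "deor_matrices A" and ES: "dpvr_extractor K \<kappa> d E\<^sub>S"
  shows "deor_explicit A d E\<^sub>S"
proof -
  obtain cA aA where cA: "\<And>n. 1 \<le> n \<Longrightarrow> \<exists>t s. exec cA (init_state [unary n]) t s \<and>
      s 0 = concat (map (\<lambda>i. concat (map list_of_vec (rows (A n i)))) [0..<n]) \<and> t \<le> aA + n ^ aA"
  proof -
    let ?R = "{([unary n], concat (map (\<lambda>i. concat (map list_of_vec (rows (A n i)))) [0..<n])) | n. n \<ge> 1}"
    have "polytime ?R" using A by (simp add: deor_matrices_def)
    then obtain c a where c: "\<forall>(ws, z) \<in> ?R. \<exists>t s. exec c (init_state ws) t s \<and> s 0 = z \<and>
        t \<le> a + (sum_list (map length ws)) ^ a" unfolding polytime_def by blast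
    show ?thesis
    proof (rule that[of c a])
      fix n :: nat assume "1 \<le> n"
      hence "([unary n], concat (map (\<lambda>i. concat (map list_of_vec (rows (A n i)))) [0..<n])) \<in> ?R" by blast
      from bspec[OF c this]
      show "\<exists>t s. exec c (init_state [unary n]) t s \<and>
        s 0 = concat (map (\<lambda>i. concat (map list_of_vec (rows (A n i)))) [0..<n]) \<and> t \<le> a + n ^ a" by simp
    qed
  qed
  obtain cD aD where cD: "\<And>n k b e. 2 \<le> n \<Longrightarrow> b < k \<Longrightarrow> k \<le> n \<Longrightarrow> 1 \<le> e \<Longrightarrow>
      \<exists>t s. exec cD (init_state [unary n, unary k, unary b, unary e]) t s \<and> s 0 = unary (d n k b e) \<and>
        t \<le> aD + (n + k + b + e) ^ aD"
  proof -
    have "polytime {([unary n, unary k, unary b, unary e], unary (d n k b e)) | n k b e.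
        2 \<le> n \<and> b < k \<and> k \<le> n \<and> 1 \<le> e}" using ES by (simp add: dpvr_extractor_def)
    then obtain c a where c: "\<forall>(ws, z) \<in> {([unary n, unary k, unary b, unary e], unary (d n k b e)) | n k b e.
        2 \<le> n \<and> b < k \<and> k \<le> n \<and> 1 \<le> e}. \<exists>t s. exec c (init_state ws) t s \<and> s 0 = z \<and>
        t \<le> a + (sum_list (map length ws)) ^ a" unfolding polytime_def by blast
    show ?thesis
    proof (rule that[of c a])
      fix n k b e :: nat assume "2 \<le> n" "b < k" "k \<le> n" "1 \<le> e"
      with bspec[OF c, of "([unary n, unary k, unary b, unary e], unary (d n k b e))"]
      show "\<exists>t s. exec c (init_state [unary n, unary k, unary b, unary e]) t s \<and> s 0 = unary (d n k b e) \<and>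
        t \<le> a + (n + k + b + e) ^ a" by (simp add: add.assoc) blast
    qed
  qed
  obtain cE aE where cE: "\<And>n k b e x u. 2 \<le> n \<Longrightarrow> b < k \<Longrightarrow> k \<le> n \<Longrightarrow> 1 \<le> e \<Longrightarrow> x \<in> bits n \<Longrightarrow> u \<in> bits (d n k b e) \<Longrightarrow>
      \<exists>t s. exec cE (init_state [unary n, unary k, unary b, unary e, x, u]) t s \<and> s 0 = E\<^sub>S n k b e x u \<and>
        t \<le> aE + (n + k + b + e + n + d n k b e) ^ aE"
  proof -
    let ?R = "{([unary n, unary k, unary b, unary e, x, u], E\<^sub>S n k b e x u) | n k b e x u.
        2 \<le> n \<and> b < k \<and> k \<le> n \<and> 1 \<le> e \<and> x \<in> bits n \<and> u \<in> bits (d n k b e)}"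
    have "polytime ?R" using ES by (simp add: dpvr_extractor_def)
    then obtain c a where c: "\<forall>(ws, z) \<in> ?R. \<exists>t s. exec c (init_state ws) t s \<and> s 0 = z \<and>
        t \<le> a + (sum_list (map length ws)) ^ a" unfolding polytime_def by blast
    show ?thesis
    proof (rule that[of c a])
      fix n k b e :: nat and x u assume *: "2 \<le> n" "b < k" "k \<le> n" "1 \<le> e" "x \<in> bits n" "u \<in> bits (d n k b e)"
      with bspec[OF c, of "([unary n, unary k, unary b, unary e, x, u], E\<^sub>S n k b e x u)"]
      have "\<exists>t s. exec c (init_state [unary n, unary k, unary b, unary e, x, u]) t s \<and> s 0 = E\<^sub>S n k b e x u \<and>
        t \<le> a + (n + (k + (b + (e + (length x + length u))))) ^ a" by simp blast
      thus "\<exists>t s. exec c (init_state [unary n, unary k, unary b, unary e, x, u]) t s \<and> s 0 = E\<^sub>S n k b e x u \<and>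
        t \<le> a + (n + k + b + e + n + d n k b e) ^ a" using * by (simp add: bits_def add.assoc)
    qed
  qed
  \<comment> \<open>The bound of \<open>runs_deor_prog\<close>, with each subroutine charged as if
    its input had the full length \<open>N\<close>.\<close>
  define P where "P N = (aA + N ^ aA) + (aD + N ^ aD) + 11 * (aE + N ^ aE) + 100 * N + 100 + (5 + N + (4 + 10 * N) * N) * N" for N
  have "poly_bounded P"
    unfolding P_def
    by (intro poly_bounded_add poly_bounded_mult poly_bounded_const poly_bounded_id poly_bounded_power)
  then obtain a where a: "\<And>N. 2 \<le> N \<Longrightarrow> P N \<le> N ^ a" by (auto simp: poly_bounded_def)
  show ?thesis
    unfolding deor_explicit_def polytime_def
  proof (intro exI[of _ "deor_prog cA cD cE"] exI[of _ a] ballI, clarify)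
    fix n fst_src l k b e m and x y :: "bit list"
    assume pr: "deor_params d n l k b e" and x: "x \<in> bits n" and y: "y \<in> bits n"
    let ?ws = "[unary n, [of_bool fst_src], unary l, unary k, unary b, unary e, unary m, x, y]"
    define N where "N = sum_list (map length ?ws)"
    have p: "2 \<le> n" "b < k" "k \<le> n" "1 \<le> e" "d n k b e \<le> l" "l \<le> n"
      using pr by (auto simp: deor_params_def)
    have N: "N = n + 1 + l + k + b + e + m + n + n" using x y by (simp add: N_def bits_def)
    let ?v = "if fst_src then x else y" and ?u = "take (d n k b e) (E_D A n l x y)"
    have v: "?v \<in> bits n" and u: "?u \<in> bits (d n k b e)" using x y p by (auto simp: bits_def E_D_def)
    obtain tA sA where tA: "exec cA (init_state [unary n]) tA sA"
      "sA 0 = concat (map (\<lambda>i. concat (map list_of_vec (rows (A n i)))) [0..<n])" "tA \<le> aA + n ^ aA"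
      using cA[of n] p by auto
    obtain tD sD where tD: "exec cD (init_state [unary n, unary k, unary b, unary e]) tD sD" "sD 0 = unary (d n k b e)"
        "tD \<le> aD + (n + k + b + e) ^ aD"
      using cD[OF p(1-4)] by auto
    obtain tE sE where tE: "exec cE (init_state [unary n, unary k, unary b, unary e, ?v, ?u]) tE sE" "sE 0 = E\<^sub>S n k b e ?v ?u"
        "tE \<le> aE + (n + k + b + e + n + d n k b e) ^ aE"
      using cE[OF p(1-4) v u] by blast
    have Ac: "A n i \<in> carrier_mat n n" if "i < l" for i
      using A that p by (auto simp: deor_matrices_def)
    obtain s where s: "runs (deor_prog cA cD cE) (init_state ?ws)
      (tA + tD + 11 * tE + 100 * N + 100 + (5 + N + (4 + 10 * N) * N) * N) s"
      "s 0 = deor A d E\<^sub>S n fst_src l k b e m x y"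
      by (rule runs_deor_prog[where A = A and d = d and E\<^sub>S = E\<^sub>S and n = n and k = k and b = b and e = e and x = x and y = y
            and fst_src = fst_src and l = l and m = m and N = N, OF tA(1,2) tD(1,2) tE(1,2) Ac x y p(6,5)])
        (use N in \<open>auto intro: that\<close>)
    have "n ^ aA \<le> N ^ aA" "(n + k + b + e) ^ aD \<le> N ^ aD" "(n + k + b + e + n + d n k b e) ^ aE \<le> N ^ aE"
      using N p by (auto intro!: power_mono)
    hence "tA \<le> aA + N ^ aA" "tD \<le> aD + N ^ aD" "tE \<le> aE + N ^ aE"
      using tA(3) tD(3) tE(3) by linarith+
    hence "tA + tD + 11 * tE + 100 * N + 100 + (5 + N + (4 + 10 * N) * N) * N \<le> P N"
      unfolding P_def by (intro add_le_mono mult_le_mono order_refl)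
    also have "\<dots> \<le> N ^ a" using a N p by simp
    finally have "runs (deor_prog cA cD cE) (init_state ?ws) (a + N ^ a) s"
      by (intro runs_mono[OF s(1)]) simp
    thus "\<exists>t s. exec (deor_prog cA cD cE) (init_state ?ws) t s \<and> s 0 = deor A d E\<^sub>S n fst_src l k b e m x y \<and>
        t \<le> a + sum_list (map length ?ws) ^ a"
      using s(2) unfolding runs_def N_def by blast
  qed
qed

section \<open>Hermitian matrices and the trace norm\<close>

definition ip :: "nat \<Rightarrow> (nat \<Rightarrow> complex) \<Rightarrow> (nat \<Rightarrow> complex) \<Rightarrow> complex" where
  "ip d u v = (\<Sum>i<d. u i * cnj (v i))"

definition app :: "nat \<Rightarrow> (nat \<Rightarrow> nat \<Rightarrow> complex) \<Rightarrow> (nat \<Rightarrow> complex) \<Rightarrow> nat \<Rightarrow> complex" where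
  "app d M v = (\<lambda>i. \<Sum>j<d. M i j * v j)"

definition nrm :: "nat \<Rightarrow> (nat \<Rightarrow> complex) \<Rightarrow> real" where
  "nrm d u = L2_set (\<lambda>i. cmod (u i)) {..<d}"

definition herm :: "nat \<Rightarrow> (nat \<Rightarrow> nat \<Rightarrow> complex) \<Rightarrow> bool" where
  "herm d M \<longleftrightarrow> (\<forall>i<d. \<forall>j<d. M j i = cnj (M i j))"

definition orthonormal :: "nat \<Rightarrow> nat \<Rightarrow> (nat \<Rightarrow> nat \<Rightarrow> complex) \<Rightarrow> bool" where
  "orthonormal d k u \<longleftrightarrow> (\<forall>i<k. \<forall>j<k. ip d (u i) (u j) = of_bool (i = j))"

text \<open>This is Tr (V A). Vectors and matrices are plain functions with the dimension as a
  parameter, so that sums can be exchanged without carrier conditions.\<close>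

definition fn_trace :: "nat \<Rightarrow> (nat \<Rightarrow> nat \<Rightarrow> complex) \<Rightarrow> (nat \<Rightarrow> nat \<Rightarrow> complex) \<Rightarrow> complex" where
  "fn_trace d V A = (\<Sum>r<d. \<Sum>c<d. V c r * A r c)"

text \<open>Operator norm at most one, stated through the sesquilinear form: in this shape it passes
  at once to diagonal blocks, convex combinations and partial traces.\<close>

definition contraction :: "nat \<Rightarrow> (nat \<Rightarrow> nat \<Rightarrow> complex) \<Rightarrow> bool" where
  "contraction d V \<longleftrightarrow> (\<forall>u v. cmod (ip d (app d V u) v) \<le> nrm d u * nrm d v)"

lemma nrm_nonneg [simp]: "0 \<le> nrm d u"
  by (simp add: nrm_def)

lemma nrm_sq: "(nrm d u)\<^sup>2 = (\<Sum>i<d. (cmod (u i))\<^sup>2)"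
  by (simp add: nrm_def L2_set_def sum_nonneg)

lemma ip_self: "ip d u u = of_real ((nrm d u)\<^sup>2)"
  unfolding ip_def nrm_sq of_real_sum complex_norm_square ..

lemma ip_cnj: "cnj (ip d u v) = ip d v u"
  by (simp add: ip_def mult.commute)

lemma nrm_eq_0_iff: "nrm d u = 0 \<longleftrightarrow> (\<forall>i<d. u i = 0)"
  by (auto simp: nrm_def L2_set_eq_0_iff)

lemma ip_cong: "(\<And>i. i < d \<Longrightarrow> u i = u' i) \<Longrightarrow> (\<And>i. i < d \<Longrightarrow> v i = v' i) \<Longrightarrow> ip d u v = ip d u' v'"
  by (simp add: ip_def)

lemma ip_sum_left: "ip d (\<lambda>r. \<Sum>i\<in>I. f i * u i r) v = (\<Sum>i\<in>I. f i * ip d (u i) v)"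
  unfolding ip_def sum_distrib_right sum_distrib_left
  by (subst sum.swap) (simp add: mult.assoc)

lemma ip_sum_right: "ip d v (\<lambda>r. \<Sum>i\<in>I. f i * u i r) = (\<Sum>i\<in>I. cnj (f i) * ip d v (u i))"
proof -
  have "ip d v (\<lambda>r. \<Sum>i\<in>I. f i * u i r) = cnj (ip d (\<lambda>r. \<Sum>i\<in>I. f i * u i r) v)"
    by (simp add: ip_cnj)
  also have "\<dots> = (\<Sum>i\<in>I. cnj (f i) * ip d v (u i))"
    by (simp add: ip_sum_left ip_cnj)
  finally show ?thesis .
qed

lemma ip_scale_left: "ip d (\<lambda>r. a * u r) v = a * ip d u v"
  by (simp add: ip_def sum_distrib_left mult.assoc)

lemma ip_scale_right: "ip d u (\<lambda>r. a * v r) = cnj a * ip d u v"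
  by (simp add: ip_def sum_distrib_left mult_ac)

lemma ip_diff_left: "ip d (\<lambda>r. u r - u' r) v = ip d u v - ip d u' v"
  by (simp add: ip_def sum_subtractf algebra_simps)

lemma ip_diff_right: "ip d v (\<lambda>r. u r - u' r) = ip d v u - ip d v u'"
  by (simp add: ip_def sum_subtractf algebra_simps)

lemma ip_add_left: "ip d (\<lambda>r. u r + u' r) v = ip d u v + ip d u' v"
  by (simp add: ip_def sum.distrib algebra_simps)

lemma hermD: "herm d M \<Longrightarrow> i < d \<Longrightarrow> j < d \<Longrightarrow> cnj (M j i) = M i j"
  unfolding herm_def by (metis complex_cnj_cnj)

lemma ip_app_herm:
  assumes "herm d M"
  shows "ip d (app d M u) v = ip d u (app d M v)"
proof -
  have "ip d (app d M u) v = (\<Sum>i<d. \<Sum>j<d. M i j * u j * cnj (v i))"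
    by (simp add: ip_def app_def sum_distrib_right)
  also have "\<dots> = (\<Sum>j<d. \<Sum>i<d. M i j * u j * cnj (v i))"
    by (rule sum.swap)
  also have "\<dots> = (\<Sum>j<d. \<Sum>i<d. u j * cnj (M j i * v i))"
    using hermD[OF assms] by (intro sum.cong refl) simp
  also have "\<dots> = ip d u (app d M v)"
    by (simp add: ip_def app_def sum_distrib_left)
  finally show ?thesis .
qed

lemma app_outer:
  "app d (\<lambda>r c. \<Sum>i\<in>I. a i * u i r * cnj (u i c)) v = (\<lambda>r. \<Sum>i\<in>I. (a i * ip d v (u i)) * u i r)"
proof
  fix r
  have "app d (\<lambda>r c. \<Sum>i\<in>I. a i * u i r * cnj (u i c)) v r = (\<Sum>j<d. \<Sum>i\<in>I. a i * u i r * cnj (u i j) * v j)"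
    by (simp add: app_def sum_distrib_right)
  also have "\<dots> = (\<Sum>i\<in>I. \<Sum>j<d. a i * u i r * cnj (u i j) * v j)"
    by (rule sum.swap)
  also have "\<dots> = (\<Sum>i\<in>I. (a i * ip d v (u i)) * u i r)"
    by (simp add: ip_def sum_distrib_left sum_distrib_right mult_ac)
  finally show "app d (\<lambda>r c. \<Sum>i\<in>I. a i * u i r * cnj (u i c)) v r = (\<Sum>i\<in>I. (a i * ip d v (u i)) * u i r)" .
qed

lemma app_diff: "app d (\<lambda>r c. M r c - N r c) v = (\<lambda>r. app d M v r - app d N v r)"
  by (simp add: app_def fun_eq_iff sum_subtractf algebra_simps)

lemma app_scale: "app d M (\<lambda>r. a * v r) = (\<lambda>r. a * app d M v r)"
  by (simp add: app_def fun_eq_iff sum_distrib_left mult_ac)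

lemma nrm_scale: "nrm d (\<lambda>r. a * v r) = cmod a * nrm d v"
  unfolding nrm_def norm_mult by (rule L2_set_right_distrib[symmetric]) simp

text \<open>The projection \<open>p\<close> of \<open>v\<close> onto the span satisfies |v - p|^2 =
  |v|^2 - S. The bound limits the size of orthonormal families and later controls the norm of
  spectral sums.\<close>

lemma bessel:
  assumes "orthonormal d k u"
  shows "(\<Sum>i<k. (cmod (ip d v (u i)))\<^sup>2) \<le> (nrm d v)\<^sup>2"
proof -
  define p where "p = (\<lambda>r. \<Sum>i<k. ip d v (u i) * u i r)"
  have pu: "ip d p (u j) = ip d v (u j)" if "j < k" for j
  proof -
    have "ip d p (u j) = (\<Sum>i<k. ip d v (u i) * of_bool (i = j))"
      unfolding p_def ip_sum_left using assms that
      by (intro sum.cong) (auto simp: orthonormal_def)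
    also have "\<dots> = ip d v (u j)"
      using that by simp
    finally show ?thesis .
  qed
  define S where "S = (\<Sum>i<k. (cmod (ip d v (u i)))\<^sup>2)"
  have vp: "ip d v p = of_real S"
    unfolding p_def ip_sum_right S_def of_real_sum complex_norm_square
    by (simp only: mult.commute)
  have pv: "ip d p v = of_real S"
    using vp by (metis ip_cnj complex_cnj_complex_of_real)
  have "ip d p p = (\<Sum>i<k. cnj (ip d v (u i)) * ip d p (u i))"
    by (subst (2) p_def) (simp add: ip_sum_right)
  also have "\<dots> = of_real S"
    unfolding S_def of_real_sum complex_norm_square using pu
    by (intro sum.cong) (auto simp: mult.commute)
  finally have pp: "ip d p p = of_real S" .
  have "ip d (\<lambda>r. v r - p r) (\<lambda>r. v r - p r) = of_real ((nrm d v)\<^sup>2 - S)"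
    unfolding ip_diff_left ip_diff_right vp pv pp by (simp add: ip_self)
  hence "of_real ((nrm d (\<lambda>r. v r - p r))\<^sup>2) = (of_real ((nrm d v)\<^sup>2 - S) :: complex)"
    by (simp add: ip_self)
  hence "(nrm d (\<lambda>r. v r - p r))\<^sup>2 = (nrm d v)\<^sup>2 - S"
    by (simp only: of_real_eq_iff)
  thus ?thesis unfolding S_def by (metis zero_le_power2 diff_ge_0_iff_ge)
qed

text \<open>Double counting of the |u i r|^2: each \<open>u i\<close> contributes one, while by
  Bessel for the standard basis vectors each coordinate \<open>r\<close> carries at most one. It
  makes the greatest family in \<open>spectral\<close> exist.\<close>

lemma orthonormal_le_dim:
  assumes "orthonormal d k u"
  shows "k \<le> d"
proof -
  have u1: "(\<Sum>r<d. (cmod (u i r))\<^sup>2) = 1" if "i < k" for i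
  proof -
    have "(of_real ((nrm d (u i))\<^sup>2) :: complex) = of_real 1"
      using assms that unfolding orthonormal_def ip_self[symmetric] by simp
    thus ?thesis by (simp only: of_real_eq_iff nrm_sq)
  qed
  have b1: "(\<Sum>i<k. (cmod (u i r))\<^sup>2) \<le> 1" if r: "r < d" for r
  proof -
    let ?e = "\<lambda>i. of_bool (i = r) :: complex"
    have "ip d ?e (u i) = cnj (u i r)" for i
    proof -
      have "ip d ?e (u i) = (\<Sum>j<d. if j = r then cnj (u i j) else 0)"
        unfolding ip_def by (intro sum.cong) auto
      thus ?thesis using r by simp
    qed
    moreover have "(nrm d ?e)\<^sup>2 = 1"
    proof -
      have "(nrm d ?e)\<^sup>2 = (\<Sum>j<d. if j = r then 1 else 0)"
        unfolding nrm_sq by (intro sum.cong) auto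
      thus ?thesis using r by simp
    qed
    ultimately show ?thesis using bessel[OF assms, of ?e] by simp
  qed
  have "real k = (\<Sum>i<k. \<Sum>r<d. (cmod (u i r))\<^sup>2)" using u1 by simp
  also have "\<dots> = (\<Sum>r<d. \<Sum>i<k. (cmod (u i r))\<^sup>2)" by (rule sum.swap)
  also have "\<dots> \<le> (\<Sum>r<d. 1)" using b1 by (intro sum_mono) auto
  finally show ?thesis by simp
qed

lemma mat_trace_comm:
  assumes "X \<in> carrier_mat n m" "Y \<in> carrier_mat m n"
  shows "mat_trace (X * Y :: complex mat) = mat_trace (Y * X)"
proof -
  have "mat_trace (X * Y) = (\<Sum>i<n. \<Sum>j<m. X $$ (i, j) * Y $$ (j, i))"
    using assms by (auto simp: mat_trace_def scalar_prod_def lessThan_atLeast0 intro!: sum.cong)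
  also have "\<dots> = (\<Sum>j<m. \<Sum>i<n. X $$ (i, j) * Y $$ (j, i))" by (rule sum.swap)
  also have "\<dots> = mat_trace (Y * X)"
    using assms by (auto simp: mat_trace_def scalar_prod_def lessThan_atLeast0 mult.commute intro!: sum.cong)
  finally show ?thesis .
qed

text \<open>Otherwise the Schur form of \<open>M\<close> is strictly upper triangular, and the sum of the
  \<open>\<bar>M i j\<bar>\<^sup>2\<close>, which is the trace of \<open>M\<^sup>2\<close>, vanishes.\<close>

lemma herm_nonzero_eigenvalue:
  assumes h: "herm d M" and nz: "\<exists>i<d. \<exists>j<d. M i j \<noteq> 0"
  shows "\<exists>\<mu> v. \<mu> \<noteq> 0 \<and> nrm d v \<noteq> 0 \<and> (\<forall>i<d. app d M v i = \<mu> * v i)"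
proof -
  define A where "A = mat d d (\<lambda>(i, j). M i j)"
  have A: "A \<in> carrier_mat d d" by (simp add: A_def)
  obtain es where cp: "char_poly A = (\<Prod>a\<leftarrow>es. [:- a, 1:])"
    using char_poly_factorized[OF A] by blast
  obtain B P Q where sd: "schur_decomposition A es = (B, P, Q)"
    by (cases "schur_decomposition A es") auto
  from schur_decomposition[OF A cp sd]
  have sim: "similar_mat_wit A B P Q" and ut: "upper_triangular B" and diag: "diag_mat B = es"
    by auto
  note S = similar_mat_witD2[OF A sim]
  have "\<exists>e\<in>set es. e \<noteq> 0"
  proof (rule ccontr)
    assume "\<not> ?thesis"
    hence B0: "B $$ (i, i) = 0" if "i < d" for i
      using diag that S by (force simp: diag_mat_def)
    have B: "B \<in> carrier_mat d d" and P: "P \<in> carrier_mat d d" and Q: "Q \<in> carrier_mat d d"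
      and QP: "Q * P = 1\<^sub>m d" and APQ: "A = P * B * Q"
      using S by auto
    have "mat_trace (A * A) = mat_trace (P * (B * (Q * (P * (B * Q)))))"
      using B P Q by (simp add: APQ assoc_mult_mat[of _ d d _ d _ d])
    also have "Q * (P * (B * Q)) = B * Q"
    proof -
      have "Q * (P * (B * Q)) = (Q * P) * (B * Q)"
        using B P Q by (intro assoc_mult_mat[symmetric, of _ d d _ d _ d]) auto
      thus ?thesis using B Q QP by simp
    qed
    also have "mat_trace (P * (B * (B * Q))) = mat_trace ((B * (B * Q)) * P)"
      using B P Q by (intro mat_trace_comm[of _ d d]) auto
    also have "(B * (B * Q)) * P = B * (B * (Q * P))"
      using B P Q by (simp add: assoc_mult_mat[of _ d d _ d _ d])
    also have "\<dots> = B * B" using B QP by simp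
    also have "mat_trace (B * B) = (\<Sum>i<d. \<Sum>j<d. B $$ (i, j) * B $$ (j, i))"
      using B by (auto simp: mat_trace_def scalar_prod_def lessThan_atLeast0 intro!: sum.cong)
    also have "\<dots> = 0"
    proof (intro sum.neutral ballI)
      fix i j assume "i \<in> {..<d}" "j \<in> {..<d}"
      thus "B $$ (i, j) * B $$ (j, i) = 0"
        using upper_triangularD[OF ut, of i j] upper_triangularD[OF ut, of j i] B B0[of i]
        by (cases i j rule: linorder_cases) auto
    qed
    finally have t0: "mat_trace (A * A) = 0" .
    have "mat_trace (A * A) = (\<Sum>i<d. \<Sum>j<d. M i j * M j i)"
      using A by (auto simp: mat_trace_def scalar_prod_def lessThan_atLeast0 A_def intro!: sum.cong)
    also have "\<dots> = (\<Sum>i<d. \<Sum>j<d. of_real ((cmod (M i j))\<^sup>2))"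
    proof (intro sum.cong refl)
      fix i j assume "i \<in> {..<d}" "j \<in> {..<d}"
      hence "M j i = cnj (M i j)" using hermD[OF h] by simp
      thus "M i j * M j i = of_real ((cmod (M i j))\<^sup>2)"
        by (simp only: complex_norm_square)
    qed
    also have "\<dots> = of_real (\<Sum>i<d. \<Sum>j<d. (cmod (M i j))\<^sup>2)"
      unfolding of_real_sum ..
    finally have "(\<Sum>i<d. \<Sum>j<d. (cmod (M i j))\<^sup>2) = 0"
      unfolding t0 by (metis of_real_eq_0_iff)
    hence "\<forall>i<d. \<forall>j<d. M i j = 0"
      by (simp add: sum_nonneg_eq_0_iff sum_nonneg)
    thus False using nz by blast
  qed
  then obtain e where e: "e \<in> set es" "e \<noteq> 0" by blast
  have "poly (char_poly A) e = 0"
    unfolding cp poly_prod_list using e(1) by (auto simp: prod_list_zero_iff)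
  hence "eigenvalue A e" using eigenvalue_root_char_poly[OF A] by simp
  then obtain v where v: "v \<in> carrier_vec d" "v \<noteq> 0\<^sub>v d" "A *\<^sub>v v = e \<cdot>\<^sub>v v"
    using A unfolding eigenvalue_def eigenvector_def by auto
  define w where "w = (\<lambda>i. v $ i)"
  have "app d M w i = e * w i" if "i < d" for i
  proof -
    have "(A *\<^sub>v v) $ i = e * w i" using v that by (simp add: w_def)
    moreover have "(A *\<^sub>v v) $ i = app d M w i"
      using v(1) that A by (auto simp: app_def w_def A_def scalar_prod_def lessThan_atLeast0 intro!: sum.cong)
    ultimately show ?thesis by simp
  qed
  moreover have "nrm d w \<noteq> 0"
    using v by (auto simp: nrm_eq_0_iff w_def vec_eq_iff)
  ultimately show ?thesis using e(2) by blast
qed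

lemma herm_eigenvalue_real:
  assumes "herm d M" "nrm d v \<noteq> 0" "\<forall>i<d. app d M v i = \<mu> * v i"
  shows "\<mu> = of_real (Re \<mu>)"
proof -
  have "\<mu> * ip d v v = ip d (app d M v) v"
    unfolding ip_scale_left[symmetric] using assms by (intro ip_cong) auto
  also have "\<dots> = ip d v (app d M v)"
    by (rule ip_app_herm[OF assms(1)])
  also have "\<dots> = cnj \<mu> * ip d v v"
    unfolding ip_scale_right[symmetric] using assms by (intro ip_cong) auto
  finally have "\<mu> = cnj \<mu>"
    using assms(2) by (simp add: ip_self)
  thus ?thesis by (simp add: complex_eq_iff)
qed

text \<open>Deflation of a maximal orthonormal family of eigenvectors leaves no nonzero eigenvalue.\<close>

lemma spectral:
  assumes h: "herm d M"
  obtains k u ev where "orthonormal d k u" "\<And>i. i < k \<Longrightarrow> ev i \<noteq> (0 :: real)"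
    "\<And>i r. i < k \<Longrightarrow> r < d \<Longrightarrow> app d M (u i) r = ev i * u i r"
    "\<And>r c. r < d \<Longrightarrow> c < d \<Longrightarrow> M r c = (\<Sum>i<k. of_real (ev i) * u i r * cnj (u i c))"
proof -
  define Pr where "Pr k u ev \<longleftrightarrow> orthonormal d k u \<and> (\<forall>i<k. ev i \<noteq> (0 :: real)) \<and>
     (\<forall>i<k. \<forall>r<d. app d M (u i) r = of_real (ev i) * u i r)" for k u ev
  define Q where "Q k \<longleftrightarrow> (\<exists>u ev. Pr k u ev)" for k
  have Q0: "Q 0" by (auto simp: Q_def Pr_def orthonormal_def)
  have bd: "\<forall>k. Q k \<longrightarrow> k \<le> d" by (auto simp: Q_def Pr_def intro: orthonormal_le_dim)
  define k where "k = (GREATEST k. Q k)"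
  have "Q k" unfolding k_def by (rule GreatestI_nat[of Q 0 d]) (use Q0 bd in auto)
  then obtain u ev where P: "Pr k u ev" by (auto simp: Q_def)
  have maxk: "\<not> Q (Suc k)"
  proof
    assume "Q (Suc k)"
    from Greatest_le_nat[of Q, OF this, of d] bd have "Suc k \<le> k" by (simp add: k_def)
    thus False by simp
  qed
  have on: "orthonormal d k u" and nz: "\<And>i. i < k \<Longrightarrow> ev i \<noteq> 0"
    and evc: "\<And>i r. i < k \<Longrightarrow> r < d \<Longrightarrow> app d M (u i) r = of_real (ev i) * u i r"
    using P by (auto simp: Pr_def)
  define N where "N = (\<lambda>r c. \<Sum>i<k. of_real (ev i) * u i r * cnj (u i c))"
  define M' where "M' = (\<lambda>r c. M r c - N r c)"
  have hM': "herm d M'"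
    unfolding herm_def
  proof (intro allI impI)
    fix i j assume "i < d" "j < d"
    hence "M j i = cnj (M i j)" using h unfolding herm_def by blast
    moreover have "N j i = cnj (N i j)" by (simp add: N_def mult_ac)
    ultimately show "M' j i = cnj (M' i j)" by (simp add: M'_def)
  qed
  have aN: "app d N v = (\<lambda>r. \<Sum>i<k. (of_real (ev i) * ip d v (u i)) * u i r)" for v
    unfolding N_def by (rule app_outer)
  have M'u: "app d M' (u j) r = 0" if "j < k" "r < d" for j r
  proof -
    have "(\<Sum>i<k. (of_real (ev i) * ip d (u j) (u i)) * u i r) = (\<Sum>i<k. if i = j then of_real (ev i) * u i r else 0)"
      using on that by (intro sum.cong) (auto simp: orthonormal_def)
    thus ?thesis using that evc by (simp add: M'_def app_diff aN)
  qed
  have "\<forall>r<d. \<forall>c<d. M' r c = 0"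
  proof (rule ccontr)
    assume "\<not> ?thesis"
    then obtain \<mu> v where \<mu>: "\<mu> \<noteq> 0" and v0: "nrm d v \<noteq> 0" and e: "\<forall>i<d. app d M' v i = \<mu> * v i"
      using herm_nonzero_eigenvalue[OF hM'] by blast
    have \<mu>r: "\<mu> = of_real (Re \<mu>)" by (rule herm_eigenvalue_real[OF hM' v0 e])
    \<comment> \<open>The deflated matrix annihilates every \<open>u j\<close>, so its eigenvector
      for a nonzero eigenvalue is orthogonal to all of them. On such a vector it agrees with
      \<open>M\<close>, and the family can be extended.\<close>
    have vu: "ip d v (u j) = 0" if "j < k" for j
    proof -
      have "\<mu> * ip d v (u j) = ip d (app d M' v) (u j)"
        unfolding ip_scale_left[symmetric] using e by (intro ip_cong) auto
      also have "\<dots> = ip d v (app d M' (u j))" by (rule ip_app_herm[OF hM'])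
      also have "\<dots> = 0" using M'u that by (simp add: ip_def)
      finally show ?thesis using \<mu> by simp
    qed
    define w where "w = (\<lambda>r. complex_of_real (1 / nrm d v) * v r)"
    have wu: "ip d w (u j) = 0" if "j < k" for j
      unfolding w_def ip_scale_left using vu[OF that] by simp
    have "nrm d w = 1"
      unfolding w_def nrm_scale using v0 by (simp add: norm_divide)
    hence ww: "ip d w w = 1" by (simp add: ip_self)
    have uw: "ip d (u j) w = 0" if "j < k" for j
      using wu[OF that] ip_cnj[of d w "u j"] by simp
    have "app d M w r = of_real (Re \<mu>) * w r" if "r < d" for r
    proof -
      have "app d M w r = app d M' w r + app d N w r"
        by (simp add: M'_def app_diff)
      also have "app d N w r = 0" unfolding aN using wu by simp
      also have "app d M' w r = \<mu> * w r"
        unfolding w_def app_scale using e that by simp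
      finally show ?thesis using \<mu>r by simp
    qed
    moreover have "Re \<mu> \<noteq> 0" using \<mu> \<mu>r by (metis of_real_0)
    moreover have "orthonormal d (Suc k) (u(k := w))"
      using on wu uw ww unfolding orthonormal_def by (auto simp: less_Suc_eq)
    ultimately have "Pr (Suc k) (u(k := w)) (ev(k := Re \<mu>))"
      using nz evc unfolding Pr_def by (auto simp: less_Suc_eq)
    thus False using maxk by (auto simp: Q_def)
  qed
  hence "\<And>r c. r < d \<Longrightarrow> c < d \<Longrightarrow> M r c = N r c" by (simp add: M'_def)
  from that[OF on nz evc this[unfolded N_def]] show ?thesis .
qed

section \<open>Matrices as functions, and uniqueness of positive roots\<close>

definition ent :: "complex mat \<Rightarrow> nat \<Rightarrow> nat \<Rightarrow> complex" where
  "ent A r c = A $$ (r, c)"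

lemma mat_adjoint_carrier: "A \<in> carrier_mat n m \<Longrightarrow> mat_adjoint (A :: complex mat) \<in> carrier_mat m n"
  by (auto simp: mat_adjoint_def)

lemma mat_adjoint_index:
  "A \<in> carrier_mat n m \<Longrightarrow> i < m \<Longrightarrow> j < n \<Longrightarrow> mat_adjoint (A :: complex mat) $$ (i, j) = cnj (A $$ (j, i))"
  by (auto simp: mat_adjoint_def mat_of_rows_def)

lemma hermitian_iff:
  assumes "A \<in> carrier_mat d d"
  shows "mat_adjoint A = A \<longleftrightarrow> herm d (ent A)"
proof
  assume a: "mat_adjoint A = A"
  show "herm d (ent A)"
    unfolding herm_def ent_def
  proof (intro allI impI)
    fix i j assume "i < d" "j < d"
    thus "A $$ (j, i) = cnj (A $$ (i, j))"
      using mat_adjoint_index[OF assms, of j i] a by simp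
  qed
next
  assume h: "herm d (ent A)"
  show "mat_adjoint A = A"
  proof (rule eq_matI)
    fix i j assume "i < dim_row A" "j < dim_col A"
    hence "i < d" "j < d" using assms by auto
    thus "mat_adjoint A $$ (i, j) = A $$ (i, j)"
      using mat_adjoint_index[OF assms, of i j] hermD[OF h, of i j] by (simp add: ent_def)
  qed (use mat_adjoint_carrier[OF assms] assms in auto)
qed

lemma ip_app_vec:
  assumes "A \<in> carrier_mat d d" "v \<in> carrier_vec d"
  shows "(A *\<^sub>v v) \<bullet>c v = ip d (app d (ent A) (\<lambda>i. v $ i)) (\<lambda>i. v $ i)"
  using assms
  by (auto simp: ip_def app_def ent_def scalar_prod_def lessThan_atLeast0 intro!: sum.cong)

lemma app_cong: "(\<And>j. j < d \<Longrightarrow> v j = w j) \<Longrightarrow> app d M v = app d M w"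
  by (simp add: app_def)

lemma psd_iff:
  "psd d A \<longleftrightarrow> A \<in> carrier_mat d d \<and> herm d (ent A) \<and> (\<forall>v. 0 \<le> Re (ip d (app d (ent A) v) v))"
proof (cases "A \<in> carrier_mat d d")
  case True
  have "(\<forall>v\<in>carrier_vec d. 0 \<le> Re ((A *\<^sub>v v) \<bullet>c v)) \<longleftrightarrow> (\<forall>v. 0 \<le> Re (ip d (app d (ent A) v) v))"
  proof safe
    fix v assume *: "\<forall>v\<in>carrier_vec d. 0 \<le> Re ((A *\<^sub>v v) \<bullet>c v)"
    have "ip d (app d (ent A) (\<lambda>i. vec d v $ i)) (\<lambda>i. vec d v $ i) = ip d (app d (ent A) v) v"
      by (subst app_cong[of d _ v]) (auto intro!: ip_cong)
    thus "0 \<le> Re (ip d (app d (ent A) v) v)"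
      using *[rule_format, of "vec d v"] ip_app_vec[OF True, of "vec d v"] by simp
  next
    fix v :: "complex vec" assume "\<forall>v. 0 \<le> Re (ip d (app d (ent A) v) v)" "v \<in> carrier_vec d"
    thus "0 \<le> Re ((A *\<^sub>v v) \<bullet>c v)"
      using ip_app_vec[OF True, of v] by simp
  qed
  thus ?thesis using True by (simp add: psd_def hermitian_iff)
qed (simp add: psd_def)

lemma app_mult:
  assumes "A \<in> carrier_mat d d" "B \<in> carrier_mat d d" "i < d"
  shows "app d (ent (A * B)) v i = app d (ent A) (app d (ent B) v) i"
proof -
  have "app d (ent (A * B)) v i = (\<Sum>j<d. \<Sum>l<d. A $$ (i, l) * B $$ (l, j) * v j)"
    using assms by (auto simp: app_def ent_def scalar_prod_def lessThan_atLeast0 sum_distrib_right intro!: sum.cong)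
  also have "\<dots> = (\<Sum>l<d. \<Sum>j<d. A $$ (i, l) * B $$ (l, j) * v j)"
    by (rule sum.swap)
  also have "\<dots> = app d (ent A) (app d (ent B) v) i"
    by (simp add: app_def ent_def sum_distrib_left mult.assoc)
  finally show ?thesis .
qed

text \<open>If \<open>v\<close> is an eigenvector of \<open>B - C\<close> with eigenvalue \<open>\<mu> \<noteq> 0\<close>, then \<open>\<bar>Bv\<bar> = \<bar>Cv\<bar>\<close> gives
  \<open>\<langle>Bv,v\<rangle> + \<langle>Cv,v\<rangle> = 0\<close>, so both terms vanish, and with them \<open>\<mu>\<bar>v\<bar>\<^sup>2\<close>.\<close>

lemma psd_root_unique:
  assumes "psd d B" "psd d C" "B * B = C * C"
  shows "B = C"
proof (rule ccontr)
  assume ne: "B \<noteq> C"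
  have B: "B \<in> carrier_mat d d" and hB: "herm d (ent B)" and pB: "\<And>v. 0 \<le> Re (ip d (app d (ent B) v) v)"
    and C: "C \<in> carrier_mat d d" and hC: "herm d (ent C)" and pC: "\<And>v. 0 \<le> Re (ip d (app d (ent C) v) v)"
    using assms by (auto simp: psd_iff)
  define D where "D = (\<lambda>r c. ent B r c - ent C r c)"
  have hD: "herm d D"
    unfolding herm_def D_def using hermD[OF hB] hermD[OF hC] by simp
  have "\<exists>i<d. \<exists>j<d. D i j \<noteq> 0"
    using ne B C by (auto simp: mat_eq_iff D_def ent_def)
  from herm_nonzero_eigenvalue[OF hD this]
  obtain \<mu> v where \<mu>: "\<mu> \<noteq> 0" and v: "nrm d v \<noteq> 0" and e: "\<forall>i<d. app d D v i = \<mu> * v i" by blast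
  define t where "t = Re \<mu>"
  have \<mu>t: "\<mu> = of_real t" unfolding t_def by (rule herm_eigenvalue_real[OF hD v e])
  define b c where "b = app d (ent B) v" and "c = app d (ent C) v"
  have bc: "b i = c i + \<mu> * v i" if "i < d" for i
    using e that unfolding D_def app_diff b_def c_def by (simp add: algebra_simps)
  have sq: "ip d b b = ip d c c"
  proof -
    have "ip d b b = ip d (app d (ent B) b) v"
      using ip_app_herm[OF hB, of b v] by (simp add: b_def)
    also have "\<dots> = ip d (app d (ent (B * B)) v) v"
      by (rule ip_cong) (simp_all add: app_mult[OF B B] b_def)
    also have "\<dots> = ip d (app d (ent (C * C)) v) v" by (simp add: assms(3))
    also have "\<dots> = ip d (app d (ent C) c) v"
      by (rule ip_cong) (simp_all add: app_mult[OF C C] c_def)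
    also have "\<dots> = ip d c c"
      using ip_app_herm[OF hC, of c v] by (simp add: c_def)
    finally show ?thesis .
  qed
  have sw: "ip d v b = ip d b v" "ip d v c = ip d c v"
    using ip_app_herm[OF hB, of v v] ip_app_herm[OF hC, of v v] by (simp_all add: b_def c_def)
  have "ip d b v = ip d (\<lambda>i. c i + \<mu> * v i) v" by (rule ip_cong) (simp_all add: bc)
  also have "\<dots> = ip d c v + \<mu> * ip d v v" by (simp add: ip_add_left ip_scale_left)
  finally have bv: "ip d b v = ip d c v + \<mu> * ip d v v" .
  have "ip d b b = ip d (\<lambda>i. c i + \<mu> * v i) b" by (rule ip_cong) (simp_all add: bc)
  also have "\<dots> = ip d c b + \<mu> * ip d b v" by (simp add: ip_add_left ip_scale_left sw)
  finally have bb: "ip d b b = ip d c b + \<mu> * ip d b v" .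
  have "ip d b c = ip d (\<lambda>i. c i + \<mu> * v i) c" by (rule ip_cong) (simp_all add: bc)
  also have "\<dots> = ip d c c + \<mu> * ip d c v" by (simp add: ip_add_left ip_scale_left sw)
  finally have bc': "ip d b c = ip d c c + \<mu> * ip d c v" .
  \<comment> \<open>The right-hand side of \<open>bc'\<close> is its own conjugate: \<mu> is real,
    and \<open>ip d c v\<close> is real because \<open>C\<close> is Hermitian.\<close>
  have cb: "ip d c b = ip d c c + \<mu> * ip d c v"
  proof -
    have "cnj (ip d c v) = ip d c v" by (simp add: ip_cnj sw)
    hence "cnj (ip d b c) = ip d c c + \<mu> * ip d c v"
      unfolding bc' by (simp add: ip_cnj \<mu>t)
    thus ?thesis by (simp add: ip_cnj)
  qed
  from bb cb sq have "\<mu> * (ip d c v + ip d b v) = 0" by (simp add: algebra_simps)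
  hence 0: "ip d c v + ip d b v = 0" using \<mu> by simp
  have "Re (ip d c v) = 0 \<and> Re (ip d b v) = 0"
    using pB[of v] pC[of v] arg_cong[OF 0, of Re] by (simp add: b_def c_def)
  hence "Re (\<mu> * ip d v v) = 0" using arg_cong[OF bv, of Re] by simp
  hence "t * (nrm d v)\<^sup>2 = 0" unfolding \<mu>t ip_self by simp
  thus False using v \<mu> \<mu>t by auto
qed

section \<open>Spectral sums and the trace norm as a maximum over tests\<close>

definition outer_sum :: "nat \<Rightarrow> (nat \<Rightarrow> complex) \<Rightarrow> (nat \<Rightarrow> nat \<Rightarrow> complex) \<Rightarrow> nat \<Rightarrow> nat \<Rightarrow> complex" where
  "outer_sum k a u = (\<lambda>r c. \<Sum>i<k. a i * u i r * cnj (u i c))"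

lemma app_outer_sum: "app d (outer_sum k a u) v = (\<lambda>r. \<Sum>i<k. (a i * ip d v (u i)) * u i r)"
  unfolding outer_sum_def by (rule app_outer)

lemma ip_outer_sum:
  "ip d (app d (outer_sum k a u) v) w = (\<Sum>i<k. a i * ip d v (u i) * ip d (u i) w)"
  by (simp add: app_outer_sum ip_sum_left)

text \<open>Orthonormality kills the mixed terms, so functions of a Hermitian matrix may be computed
  on the coefficients.\<close>

lemma outer_sum_mult:
  assumes "orthonormal d k u"
  shows "(\<Sum>j<d. outer_sum k a u r j * outer_sum k b u j c) = outer_sum k (\<lambda>i. a i * b i) u r c"
proof -
  define v where "v = (\<lambda>j. \<Sum>i<k. (b i * cnj (u i c)) * u i j)"
  have "outer_sum k b u j c = v j" for j
    by (simp add: outer_sum_def v_def mult_ac)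
  hence "(\<Sum>j<d. outer_sum k a u r j * outer_sum k b u j c) = app d (outer_sum k a u) v r"
    by (simp add: app_def)
  also have "\<dots> = (\<Sum>i<k. (a i * ip d v (u i)) * u i r)"
    by (simp add: app_outer_sum)
  also have "\<dots> = (\<Sum>i<k. a i * b i * u i r * cnj (u i c))"
  proof (intro sum.cong refl)
    fix i assume i: "i \<in> {..<k}"
    have "ip d v (u i) = (\<Sum>i'<k. (b i' * cnj (u i' c)) * ip d (u i') (u i))"
      unfolding v_def by (rule ip_sum_left)
    also have "\<dots> = (\<Sum>i'<k. if i' = i then b i' * cnj (u i' c) else 0)"
      using assms i by (intro sum.cong) (auto simp: orthonormal_def)
    also have "\<dots> = b i * cnj (u i c)" using i by simp
    finally show "(a i * ip d v (u i)) * u i r = a i * b i * u i r * cnj (u i c)"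
      by (simp add: mult_ac)
  qed
  finally show ?thesis by (simp add: outer_sum_def)
qed

lemma fn_trace_outer_sum: "fn_trace d V (outer_sum k a u) = (\<Sum>i<k. a i * ip d (app d V (u i)) (u i))"
proof -
  have "fn_trace d V (outer_sum k a u) = (\<Sum>r<d. \<Sum>c<d. \<Sum>i<k. a i * (V c r * u i r * cnj (u i c)))"
    by (simp add: fn_trace_def outer_sum_def sum_distrib_left mult_ac)
  also have "\<dots> = (\<Sum>r<d. \<Sum>i<k. \<Sum>c<d. a i * (V c r * u i r * cnj (u i c)))"
    by (rule sum.cong[OF refl], rule sum.swap)
  also have "\<dots> = (\<Sum>i<k. \<Sum>r<d. \<Sum>c<d. a i * (V c r * u i r * cnj (u i c)))"
    by (rule sum.swap)
  also have "\<dots> = (\<Sum>i<k. \<Sum>c<d. \<Sum>r<d. a i * (V c r * u i r * cnj (u i c)))"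
    by (rule sum.cong[OF refl], rule sum.swap)
  also have "\<dots> = (\<Sum>i<k. a i * ip d (app d V (u i)) (u i))"
    by (simp add: ip_def app_def sum_distrib_left sum_distrib_right mult_ac)
  finally show ?thesis .
qed

lemma orthonormal_nrm:
  assumes "orthonormal d k u" "i < k"
  shows "nrm d (u i) = 1"
proof -
  have "complex_of_real ((nrm d (u i))\<^sup>2) = of_real 1"
    using assms unfolding ip_self[symmetric] by (simp add: orthonormal_def)
  hence "(nrm d (u i))\<^sup>2 = 1" by (simp only: of_real_eq_iff)
  thus ?thesis using nrm_nonneg[of d "u i"] by (metis power2_eq_1_iff le_minus_one_simps(3))
qed

text \<open>Cauchy-Schwarz for the coefficients of the two vectors in the family, then Bessel for
  each of them.\<close>

lemma contraction_outer_sum: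
  assumes on: "orthonormal d k u" and a: "\<And>i. i < k \<Longrightarrow> cmod (a i) \<le> 1"
  shows "contraction d (outer_sum k a u)"
  unfolding contraction_def
proof (intro allI)
  fix x y
  have "cmod (ip d (app d (outer_sum k a u) x) y) \<le> (\<Sum>i<k. \<bar>cmod (ip d x (u i))\<bar> * \<bar>cmod (ip d y (u i))\<bar>)"
    unfolding ip_outer_sum
  proof (rule sum_norm_le)
    fix i assume "i \<in> {..<k}"
    hence "cmod (a i) \<le> 1" using a by simp
    moreover have "cmod (ip d (u i) y) = cmod (ip d y (u i))"
      by (metis complex_mod_cnj ip_cnj)
    ultimately show "cmod (a i * ip d x (u i) * ip d (u i) y) \<le> \<bar>cmod (ip d x (u i))\<bar> * \<bar>cmod (ip d y (u i))\<bar>"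
      unfolding norm_mult by (simp add: mult_left_le_one_le mult.assoc)
  qed
  also have "\<dots> \<le> L2_set (\<lambda>i. cmod (ip d x (u i))) {..<k} * L2_set (\<lambda>i. cmod (ip d y (u i))) {..<k}"
    by (rule L2_set_mult_ineq)
  also have "\<dots> \<le> nrm d x * nrm d y"
    using real_sqrt_le_mono[OF bessel[OF on, of x]] real_sqrt_le_mono[OF bessel[OF on, of y]]
    by (intro mult_mono) (simp_all add: L2_set_def sum_nonneg)
  finally show "cmod (ip d (app d (outer_sum k a u) x) y) \<le> nrm d x * nrm d y" .
qed

lemma psd_outer_sum:
  assumes "\<And>i. i < k \<Longrightarrow> 0 \<le> (a i :: real)"
  shows "psd d (mat d d (\<lambda>(r, c). outer_sum k (\<lambda>i. of_real (a i)) u r c))" (is "psd d ?R")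
  unfolding psd_iff
proof (intro conjI allI)
  show "herm d (ent ?R)"
    by (simp add: herm_def ent_def outer_sum_def mult_ac)
  fix v
  have "ip d (app d (ent ?R) v) v = ip d (app d (outer_sum k (\<lambda>i. of_real (a i)) u) v) v"
    by (intro ip_cong) (simp_all add: app_def ent_def)
  also have "\<dots> = (\<Sum>i<k. of_real (a i * (cmod (ip d v (u i)))\<^sup>2))"
    unfolding ip_outer_sum of_real_mult complex_norm_square ip_cnj by (simp only: mult.assoc)
  finally have "Re (ip d (app d (ent ?R) v) v) = (\<Sum>i<k. a i * (cmod (ip d v (u i)))\<^sup>2)"
    by (simp only: of_real_sum[symmetric] Re_complex_of_real)
  also have "\<dots> \<ge> 0" using assms by (intro sum_nonneg) auto
  finally show "0 \<le> Re (ip d (app d (ent ?R) v) v)" .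
qed simp

text \<open>The root of T^* T has coefficients |a i|. As \<open>psd_sqrt\<close> is a definite
  description, this has to be combined with \<open>psd_root_unique\<close>. The 2 on the left undoes
  the one half in \<open>tr_norm\<close>.\<close>

lemma tr_norm_spectral:
  assumes T: "T \<in> carrier_mat d d" and on: "orthonormal d k u"
    and eq: "\<And>r c. r < d \<Longrightarrow> c < d \<Longrightarrow> ent T r c = outer_sum k (\<lambda>i. of_real (a i)) u r c"
  shows "2 * tr_norm T = (\<Sum>i<k. \<bar>a i\<bar>)"
proof -
  let ?R = "mat d d (\<lambda>(r, c). outer_sum k (\<lambda>i. of_real \<bar>a i\<bar>) u r c)"
  have TT: "mat_adjoint T * T \<in> carrier_mat d d" "dim_col T = d"
    using T mat_adjoint_carrier[OF T] by auto
  have R: "psd d ?R" by (rule psd_outer_sum) simp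
  have RR: "?R * ?R = mat_adjoint T * T"
  proof (rule eq_matI)
    fix r c assume "r < dim_row (mat_adjoint T * T)" "c < dim_col (mat_adjoint T * T)"
    hence r: "r < d" and c: "c < d" using TT by auto
    have "(?R * ?R) $$ (r, c) = outer_sum k (\<lambda>i. of_real \<bar>a i\<bar> * of_real \<bar>a i\<bar>) u r c"
      using r c by (simp add: scalar_prod_def atLeast0LessThan outer_sum_mult[OF on])
    also have "\<dots> = outer_sum k (\<lambda>i. of_real (a i) * of_real (a i)) u r c"
      by (simp add: outer_sum_def flip: of_real_mult)
    also have "\<dots> = (\<Sum>j<d. outer_sum k (\<lambda>i. of_real (a i)) u r j * outer_sum k (\<lambda>i. of_real (a i)) u j c)"
      by (simp add: outer_sum_mult[OF on])
    also have "\<dots> = (\<Sum>j<d. cnj (ent T j r) * ent T j c)"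
    proof (intro sum.cong refl)
      fix j assume "j \<in> {..<d}"
      moreover have "cnj (outer_sum k (\<lambda>i. of_real (a i)) u j r) = outer_sum k (\<lambda>i. of_real (a i)) u r j"
        by (simp add: outer_sum_def mult_ac)
      ultimately show "outer_sum k (\<lambda>i. of_real (a i)) u r j * outer_sum k (\<lambda>i. of_real (a i)) u j c
          = cnj (ent T j r) * ent T j c"
        using r c by (simp add: eq)
    qed
    also have "\<dots> = (mat_adjoint T * T) $$ (r, c)"
      using T mat_adjoint_carrier[OF T] r c
      by (auto simp: scalar_prod_def atLeast0LessThan mat_adjoint_index[OF T] ent_def intro!: sum.cong)
    finally show "(?R * ?R) $$ (r, c) = (mat_adjoint T * T) $$ (r, c)" .
  qed (use TT in auto)
  have "psd_sqrt d (mat_adjoint T * T) = ?R"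
    unfolding psd_sqrt_def
  proof (rule the_equality)
    show "psd d ?R \<and> ?R * ?R = mat_adjoint T * T" using R RR by simp
    show "B = ?R" if "psd d B \<and> B * B = mat_adjoint T * T" for B
      using psd_root_unique[of d B ?R] that R RR by simp
  qed
  hence "2 * tr_norm T = Re (mat_trace ?R)"
    using TT by (simp add: tr_norm_def)
  also have "mat_trace ?R = (\<Sum>r<d. \<Sum>i<k. of_real \<bar>a i\<bar> * (u i r * cnj (u i r)))"
    by (simp add: mat_trace_def outer_sum_def mult.assoc)
  also have "\<dots> = (\<Sum>i<k. \<Sum>r<d. of_real \<bar>a i\<bar> * (u i r * cnj (u i r)))"
    by (rule sum.swap)
  also have "\<dots> = (\<Sum>i<k. of_real \<bar>a i\<bar> * ip d (u i) (u i))"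
    by (simp only: ip_def sum_distrib_left)
  also have "\<dots> = (\<Sum>i<k. of_real \<bar>a i\<bar>)"
    using on by (intro sum.cong) (auto simp: orthonormal_def)
  finally show ?thesis by simp
qed

lemma tr_norm_ge:
  assumes T: "T \<in> carrier_mat d d" and h: "herm d (ent T)" and V: "contraction d V"
  shows "cmod (fn_trace d V (ent T)) \<le> 2 * tr_norm T"
proof -
  obtain k u a where on: "orthonormal d k u"
    and eq: "\<And>r c. r < d \<Longrightarrow> c < d \<Longrightarrow> ent T r c = (\<Sum>i<k. of_real (a i) * u i r * cnj (u i c))"
    using spectral[OF h] by metis
  have "fn_trace d V (ent T) = fn_trace d V (outer_sum k (\<lambda>i. of_real (a i)) u)"
    using eq by (simp add: fn_trace_def outer_sum_def)
  also have "\<dots> = (\<Sum>i<k. of_real (a i) * ip d (app d V (u i)) (u i))"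
    by (rule fn_trace_outer_sum)
  also have "cmod \<dots> \<le> (\<Sum>i<k. \<bar>a i\<bar>)"
  proof (rule sum_norm_le)
    fix i assume i: "i \<in> {..<k}"
    have "cmod (ip d (app d V (u i)) (u i)) \<le> nrm d (u i) * nrm d (u i)"
      using V by (simp add: contraction_def)
    also have "\<dots> = 1" using orthonormal_nrm[OF on, of i] i by simp
    finally show "cmod (of_real (a i) * ip d (app d V (u i)) (u i)) \<le> \<bar>a i\<bar>"
      unfolding norm_mult by (simp add: mult_right_le_one_le)
  qed
  also have "\<dots> = 2 * tr_norm T"
    using tr_norm_spectral[OF T on, of a] eq by (simp add: outer_sum_def)
  finally show ?thesis .
qed

lemma tr_norm_attained:
  assumes T: "T \<in> carrier_mat d d" and h: "herm d (ent T)"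
  obtains V where "contraction d V" "fn_trace d V (ent T) = of_real (2 * tr_norm T)"
proof -
  obtain k u a where on: "orthonormal d k u"
    and eq: "\<And>r c. r < d \<Longrightarrow> c < d \<Longrightarrow> ent T r c = (\<Sum>i<k. of_real (a i) * u i r * cnj (u i c))"
    using spectral[OF h] by metis
  \<comment> \<open>The maximiser is the sign of \<open>T\<close> on its spectral family: on
    \<open>u i\<close> it contributes \<open>sgn (a i)\<close> against the eigenvalue
    \<open>a i\<close>, hence \<open>\<bar>a i\<bar>\<close>.\<close>
  define V where "V = outer_sum k (\<lambda>i. of_real (sgn (a i))) u"
  have "contraction d V"
    unfolding V_def by (rule contraction_outer_sum[OF on]) (simp add: sgn_if)
  moreover have "fn_trace d V (ent T) = of_real (2 * tr_norm T)"
  proof -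
    have "fn_trace d V (ent T) = fn_trace d V (outer_sum k (\<lambda>i. of_real (a i)) u)"
      using eq by (simp add: fn_trace_def outer_sum_def)
    also have "\<dots> = (\<Sum>i<k. of_real (a i) * ip d (app d V (u i)) (u i))"
      by (rule fn_trace_outer_sum)
    also have "\<dots> = (\<Sum>i<k. of_real \<bar>a i\<bar>)"
    proof (intro sum.cong refl)
      fix i assume i: "i \<in> {..<k}"
      have "ip d (app d V (u i)) (u i) = (\<Sum>j<k. if j = i then of_real (sgn (a j)) else 0)"
        unfolding V_def ip_outer_sum using on i by (intro sum.cong) (auto simp: orthonormal_def)
      also have "\<dots> = of_real (sgn (a i))" using i by simp
      finally show "of_real (a i) * ip d (app d V (u i)) (u i) = of_real \<bar>a i\<bar>"
        by (simp add: mult_sgn_abs abs_sgn flip: of_real_mult)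
    qed
    also have "\<dots> = of_real (2 * tr_norm T)"
      using tr_norm_spectral[OF T on, of a] eq by (simp add: outer_sum_def)
    finally show ?thesis .
  qed
  ultimately show ?thesis by (rule that)
qed

section \<open>Block-diagonal matrices\<close>

definition slice :: "nat \<Rightarrow> nat \<Rightarrow> (nat \<Rightarrow> complex) \<Rightarrow> nat \<Rightarrow> complex" where
  "slice D h u = (\<lambda>r. u (h * D + r))"

lemma sum_lessThan_mult:
  "(\<Sum>I<N * D. f I) = (\<Sum>h<N. \<Sum>r<D. f (h * D + r))" for N D :: nat
proof -
  have "sum f {h * D..<h * D + D} = (\<Sum>r<D. f (h * D + r))" for h
    using sum.shift_bounds_nat_ivl[of f 0 "h * D" D] by (simp add: lessThan_atLeast0 add.commute)
  thus ?thesis by (simp add: sum.nat_group[symmetric])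
qed

lemma ip_slices: "ip (N * D) u v = (\<Sum>h<N. ip D (slice D h u) (slice D h v))"
  by (simp add: ip_def sum_lessThan_mult slice_def)

lemma nrm_sq_slices: "(nrm (N * D) u)\<^sup>2 = (\<Sum>h<N. (nrm D (slice D h u))\<^sup>2)"
  by (simp add: nrm_sq sum_lessThan_mult slice_def)

lemma nrm_slices: "nrm (N * D) u = L2_set (\<lambda>h. nrm D (slice D h u)) {..<N}"
  unfolding L2_set_def nrm_sq_slices[symmetric] by simp

lemma fn_trace_cong:
  "(\<And>r c. r < d \<Longrightarrow> c < d \<Longrightarrow> A r c = B r c) \<Longrightarrow> fn_trace d V A = fn_trace d V B"
  by (simp add: fn_trace_def)

text \<open>An index is h * D + r with the classical value h as its leading digit and the storage
  index r, which is the order used by \<open>tensor_mat\<close> for the classical register times the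
  storage.\<close>

definition blocks :: "nat \<Rightarrow> (nat \<Rightarrow> nat \<Rightarrow> nat \<Rightarrow> complex) \<Rightarrow> nat \<Rightarrow> nat \<Rightarrow> complex" where
  "blocks D G I J = (if I div D = J div D then G (I div D) (I mod D) (J mod D) else 0)"

lemma blocks_index:
  "r < D \<Longrightarrow> c < D \<Longrightarrow> blocks D G (h * D + r) (h' * D + c) = (if h = h' then G h r c else 0)"
  by (simp add: blocks_def)

lemma herm_cong:
  assumes "\<And>r c. r < d \<Longrightarrow> c < d \<Longrightarrow> A r c = B r c" "herm d B"
  shows "herm d A"
  unfolding herm_def
proof (intro allI impI)
  fix i j assume "i < d" "j < d"
  thus "A j i = cnj (A i j)"
    using hermD[OF assms(2), of j i] assms(1)[of i j] assms(1)[of j i] by simp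
qed

lemma herm_blocks:
  assumes "\<And>h. h < N \<Longrightarrow> herm D (G h)"
  shows "herm (N * D) (blocks D G)"
  unfolding herm_def
proof (intro allI impI)
  fix I J assume I: "I < N * D" "J < N * D"
  hence D: "0 < D" by (cases D) auto
  have "I div D < N" using I by (simp add: less_mult_imp_div_less)
  from hermD[OF assms[OF this], of "I mod D" "J mod D"] D
  show "blocks D G J I = cnj (blocks D G I J)"
    by (auto simp: blocks_def dest: sym)
qed

lemma fn_trace_blocks:
  "fn_trace (N * D) W (blocks D G) = (\<Sum>h<N. fn_trace D (\<lambda>r c. W (h * D + r) (h * D + c)) (G h))"
proof -
  have "fn_trace (N * D) W (blocks D G) =
     (\<Sum>h<N. \<Sum>r<D. \<Sum>h'<N. \<Sum>c<D. W (h' * D + c) (h * D + r) * (if h = h' then G h r c else 0))"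
    unfolding fn_trace_def sum_lessThan_mult
    by (intro sum.cong refl) (simp add: blocks_index)
  also have "\<dots> = (\<Sum>h<N. \<Sum>r<D. \<Sum>h'<N. if h' = h then \<Sum>c<D. W (h' * D + c) (h * D + r) * G h r c else 0)"
    by (intro sum.cong refl) auto
  also have "\<dots> = (\<Sum>h<N. fn_trace D (\<lambda>r c. W (h * D + r) (h * D + c)) (G h))"
    by (simp add: fn_trace_def)
  finally show ?thesis .
qed

text \<open>Padding a vector by zeros outside block \<open>h\<close> is an isometry, and the form of
  \<open>W\<close> on padded vectors is the form of its diagonal block.\<close>

lemma contraction_block:
  assumes W: "contraction (N * D) W" and h: "h < N"
  shows "contraction D (\<lambda>r c. W (h * D + r) (h * D + c))"
  unfolding contraction_def
proof (intro allI)
  fix u v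
  define e where "e w I = (if I div D = h then w (I mod D) else 0)" for w :: "nat \<Rightarrow> complex" and I
  have sl: "slice D h' (e w) r = (if h' = h then w r else 0)" if "r < D" for h' w r
    using that by (simp add: slice_def e_def)
  have n: "nrm (N * D) (e w) = nrm D w" for w
  proof -
    have "(nrm D (slice D h' (e w)))\<^sup>2 = (if h' = h then (nrm D w)\<^sup>2 else 0)" for h'
      by (simp add: nrm_sq sl)
    hence "(nrm (N * D) (e w))\<^sup>2 = (nrm D w)\<^sup>2"
      unfolding nrm_sq_slices using h by simp
    thus ?thesis by (rule power2_eq_imp_eq) simp_all
  qed
  have ap: "slice D h (app (N * D) W (e u)) r = app D (\<lambda>r c. W (h * D + r) (h * D + c)) u r" if "r < D" for r
  proof -
    have "slice D h (app (N * D) W (e u)) r = (\<Sum>h'<N. \<Sum>c<D. W (h * D + r) (h' * D + c) * slice D h' (e u) c)"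
      by (simp add: slice_def app_def sum_lessThan_mult)
    also have "\<dots> = (\<Sum>h'<N. if h' = h then \<Sum>c<D. W (h * D + r) (h' * D + c) * u c else 0)"
      by (intro sum.cong refl) (simp add: sl)
    also have "\<dots> = app D (\<lambda>r c. W (h * D + r) (h * D + c)) u r"
      using h by (simp add: app_def)
    finally show ?thesis .
  qed
  have "ip (N * D) (app (N * D) W (e u)) (e v) =
      (\<Sum>h'<N. if h' = h then ip D (slice D h (app (N * D) W (e u))) v else 0)"
    unfolding ip_slices by (intro sum.cong refl) (auto simp: ip_def sl)
  also have "\<dots> = ip D (slice D h (app (N * D) W (e u))) v" using h by simp
  also have "\<dots> = ip D (app D (\<lambda>r c. W (h * D + r) (h * D + c)) u) v"
    by (rule ip_cong) (simp_all add: ap)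
  finally have "ip D (app D (\<lambda>r c. W (h * D + r) (h * D + c)) u) v = ip (N * D) (app (N * D) W (e u)) (e v)" ..
  also have "cmod \<dots> \<le> nrm D u * nrm D v"
    using W unfolding contraction_def by (metis n)
  finally show "cmod (ip D (app D (\<lambda>r c. W (h * D + r) (h * D + c)) u) v) \<le> nrm D u * nrm D v" .
qed

lemma app_blocks:
  assumes "h < N" "r < D"
  shows "slice D h (app (N * D) (blocks D V) u) r = app D (V h) (slice D h u) r"
proof -
  have "slice D h (app (N * D) (blocks D V) u) r =
      (\<Sum>h'<N. \<Sum>c<D. (if h = h' then V h r c else 0) * u (h' * D + c))"
    unfolding slice_def app_def sum_lessThan_mult using assms
    by (intro sum.cong refl) (simp add: blocks_index)
  also have "\<dots> = (\<Sum>h'<N. if h' = h then \<Sum>c<D. V h r c * u (h' * D + c) else 0)"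
    by (intro sum.cong refl) auto
  also have "\<dots> = app D (V h) (slice D h u) r"
    using assms by (simp add: app_def slice_def)
  finally show ?thesis .
qed

text \<open>The form splits into a sum over the blocks; Cauchy-Schwarz over the block index
  reassembles the norms of the slices.\<close>

lemma contraction_blocks:
  assumes "\<And>h. h < N \<Longrightarrow> contraction D (V h)"
  shows "contraction (N * D) (blocks D V)"
  unfolding contraction_def
proof (intro allI)
  fix u v
  have eq: "ip (N * D) (app (N * D) (blocks D V) u) v = (\<Sum>h<N. ip D (app D (V h) (slice D h u)) (slice D h v))"
    unfolding ip_slices
  proof (rule sum.cong[OF refl])
    fix h assume "h \<in> {..<N}"
    hence h: "h < N" by simp
    show "ip D (slice D h (app (N * D) (blocks D V) u)) (slice D h v) = ip D (app D (V h) (slice D h u)) (slice D h v)"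
      by (rule ip_cong) (rule app_blocks[OF h], assumption, rule refl)
  qed
  have "cmod (ip (N * D) (app (N * D) (blocks D V) u) v) \<le> (\<Sum>h<N. \<bar>nrm D (slice D h u)\<bar> * \<bar>nrm D (slice D h v)\<bar>)"
    unfolding eq
  proof (rule sum_norm_le)
    fix h assume "h \<in> {..<N}"
    hence "contraction D (V h)" using assms by simp
    thus "cmod (ip D (app D (V h) (slice D h u)) (slice D h v)) \<le> \<bar>nrm D (slice D h u)\<bar> * \<bar>nrm D (slice D h v)\<bar>"
      by (simp add: contraction_def)
  qed
  also have "\<dots> \<le> nrm (N * D) u * nrm (N * D) v"
    unfolding nrm_slices by (rule L2_set_mult_ineq)
  finally show "cmod (ip (N * D) (app (N * D) (blocks D V) u) v) \<le> nrm (N * D) u * nrm (N * D) v" .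
qed

text \<open>The off-diagonal blocks of a maximising test meet only zeros of \<open>T\<close>, so its
  diagonal blocks, one test for each classical value, already attain the norm.\<close>

lemma tr_norm_blocks_attained:
  assumes T: "T \<in> carrier_mat (N * D) (N * D)"
    and eq: "\<And>I J. I < N * D \<Longrightarrow> J < N * D \<Longrightarrow> T $$ (I, J) = blocks D G I J"
    and h: "\<And>h. h < N \<Longrightarrow> herm D (G h)"
  obtains V where "\<And>h. h < N \<Longrightarrow> contraction D (V h)"
    "(\<Sum>h<N. fn_trace D (V h) (G h)) = of_real (2 * tr_norm T)"
proof -
  have "herm (N * D) (ent T)"
    by (rule herm_cong[OF _ herm_blocks[OF h]]) (simp_all add: eq ent_def)
  from tr_norm_attained[OF T this]
  obtain W where W: "contraction (N * D) W" "fn_trace (N * D) W (ent T) = of_real (2 * tr_norm T)" .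
  have "fn_trace (N * D) W (ent T) = fn_trace (N * D) W (blocks D G)"
    by (rule fn_trace_cong) (simp add: eq ent_def)
  with W show ?thesis
    using that[of "\<lambda>h r c. W (h * D + r) (h * D + c)"] contraction_block[OF W(1)]
    by (simp add: fn_trace_blocks)
qed

lemma tr_norm_blocks_ge:
  assumes T: "T \<in> carrier_mat (N * D) (N * D)"
    and eq: "\<And>I J. I < N * D \<Longrightarrow> J < N * D \<Longrightarrow> T $$ (I, J) = blocks D G I J"
    and h: "\<And>h. h < N \<Longrightarrow> herm D (G h)"
    and V: "\<And>h. h < N \<Longrightarrow> contraction D (V h)"
  shows "cmod (\<Sum>h<N. fn_trace D (V h) (G h)) \<le> 2 * tr_norm T"
proof -
  have hT: "herm (N * D) (ent T)"
    by (rule herm_cong[OF _ herm_blocks[OF h]]) (simp_all add: eq ent_def)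
  have "fn_trace (N * D) (blocks D V) (ent T) = fn_trace (N * D) (blocks D V) (blocks D G)"
    by (rule fn_trace_cong) (simp add: eq ent_def)
  also have "\<dots> = (\<Sum>h<N. fn_trace D (V h) (G h))"
    unfolding fn_trace_blocks
    by (intro sum.cong refl) (simp add: fn_trace_def blocks_def)
  finally show ?thesis
    using tr_norm_ge[OF T hT contraction_blocks[of N D V, OF V]] by simp
qed

text \<open>Averaging tests is how surplus seed bits, and later the other source, are absorbed into
  a single test.\<close>

lemma contraction_convex:
  assumes V: "\<And>i. i \<in> I \<Longrightarrow> contraction d (V i)" and w: "\<And>i. i \<in> I \<Longrightarrow> 0 \<le> w i" "sum w I \<le> 1"
  shows "contraction d (\<lambda>r c. \<Sum>i\<in>I. of_real (w i) * V i r c)"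
  unfolding contraction_def
proof (intro allI)
  fix u v
  have "app d (\<lambda>r c. \<Sum>i\<in>I. of_real (w i) * V i r c) u = (\<lambda>r. \<Sum>i\<in>I. of_real (w i) * app d (V i) u r)"
    unfolding app_def sum_distrib_left sum_distrib_right mult.assoc
    by (subst sum.swap) (rule refl)
  hence "ip d (app d (\<lambda>r c. \<Sum>i\<in>I. of_real (w i) * V i r c) u) v = (\<Sum>i\<in>I. of_real (w i) * ip d (app d (V i) u) v)"
    by (simp add: ip_sum_left)
  also have "cmod \<dots> \<le> (\<Sum>i\<in>I. w i * (nrm d u * nrm d v))"
  proof (rule sum_norm_le)
    fix i assume i: "i \<in> I"
    show "cmod (of_real (w i) * ip d (app d (V i) u) v) \<le> w i * (nrm d u * nrm d v)"
      unfolding norm_mult using V[OF i] w(1)[OF i] by (simp add: contraction_def mult_left_mono)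
  qed
  also have "\<dots> = sum w I * (nrm d u * nrm d v)" by (simp add: sum_distrib_right)
  also have "\<dots> \<le> nrm d u * nrm d v"
    using w(2) sum_nonneg[of I w] w(1) by (simp add: mult_left_le_one_le)
  finally show "cmod (ip d (app d (\<lambda>r c. \<Sum>i\<in>I. of_real (w i) * V i r c) u) v) \<le> nrm d u * nrm d v" .
qed

lemma fn_trace_sum_left:
  "fn_trace d (\<lambda>r c. \<Sum>i\<in>I. w i * V i r c) A = (\<Sum>i\<in>I. w i * fn_trace d (V i) A)"
proof -
  have "fn_trace d (\<lambda>r c. \<Sum>i\<in>I. w i * V i r c) A = (\<Sum>r<d. \<Sum>c<d. \<Sum>i\<in>I. w i * (V i c r * A r c))"
    by (simp add: fn_trace_def sum_distrib_right mult.assoc)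
  also have "\<dots> = (\<Sum>r<d. \<Sum>i\<in>I. \<Sum>c<d. w i * (V i c r * A r c))"
    by (rule sum.cong[OF refl], rule sum.swap)
  also have "\<dots> = (\<Sum>i\<in>I. \<Sum>r<d. \<Sum>c<d. w i * (V i c r * A r c))"
    by (rule sum.swap)
  finally show ?thesis by (simp add: fn_trace_def sum_distrib_left)
qed

lemma fn_trace_sum_right:
  "fn_trace d V (\<lambda>r c. \<Sum>i\<in>I. w i * A i r c) = (\<Sum>i\<in>I. w i * fn_trace d V (A i))"
proof -
  have "fn_trace d V (\<lambda>r c. \<Sum>i\<in>I. w i * A i r c) = (\<Sum>r<d. \<Sum>c<d. \<Sum>i\<in>I. w i * (V c r * A i r c))"
    by (simp add: fn_trace_def sum_distrib_left mult.left_commute)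
  also have "\<dots> = (\<Sum>r<d. \<Sum>i\<in>I. \<Sum>c<d. w i * (V c r * A i r c))"
    by (rule sum.cong[OF refl], rule sum.swap)
  also have "\<dots> = (\<Sum>i\<in>I. \<Sum>r<d. \<Sum>c<d. w i * (V c r * A i r c))"
    by (rule sum.swap)
  finally show ?thesis by (simp add: fn_trace_def sum_distrib_left)
qed

section \<open>The Hilbert-Schmidt norm of tests and densities\<close>

definition hs_norm :: "nat \<Rightarrow> (nat \<Rightarrow> nat \<Rightarrow> complex) \<Rightarrow> real" where
  "hs_norm d A = L2_set (\<lambda>(r, c). cmod (A r c)) ({..<d} \<times> {..<d})"

lemma hs_norm_sq: "(hs_norm d A)\<^sup>2 = (\<Sum>r<d. \<Sum>c<d. (cmod (A r c))\<^sup>2)"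
  by (simp add: hs_norm_def L2_set_def sum_nonneg sum.cartesian_product case_prod_beta)

text \<open>Applying \<open>V\<close> to its own conjugated row gives the squared row norm s as
  coordinate \<open>i\<close>, so the contraction property reads s \<le> sqrt s.\<close>

lemma contraction_row:
  assumes V: "contraction d V" and i: "i < d"
  shows "(\<Sum>j<d. (cmod (V i j))\<^sup>2) \<le> 1"
proof -
  define s where "s = (\<Sum>j<d. (cmod (V i j))\<^sup>2)"
  let ?e = "\<lambda>k. of_bool (k = i) :: complex" and ?u = "\<lambda>j. cnj (V i j)"
  have s0: "0 \<le> s" by (simp add: s_def sum_nonneg)
  have e: "nrm d ?e = 1"
  proof -
    have "(nrm d ?e)\<^sup>2 = (\<Sum>j<d. if j = i then 1 else 0)"
      unfolding nrm_sq by (intro sum.cong) auto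
    hence "(nrm d ?e)\<^sup>2 = 1\<^sup>2" using i by simp
    thus ?thesis by (rule power2_eq_imp_eq) simp_all
  qed
  have u: "(nrm d ?u)\<^sup>2 = s" by (simp add: nrm_sq s_def)
  have "ip d (app d V ?u) ?e = (\<Sum>k<d. if k = i then app d V ?u k else 0)"
    unfolding ip_def by (intro sum.cong) auto
  also have "\<dots> = of_real s"
    using i unfolding s_def app_def of_real_sum complex_norm_square by simp
  finally have "cmod (ip d (app d V ?u) ?e) = s" using s0 by simp
  moreover have "cmod (ip d (app d V ?u) ?e) \<le> nrm d ?u * nrm d ?e"
    using V by (simp add: contraction_def)
  ultimately have "s \<le> nrm d ?u" by (simp add: e)
  hence "s\<^sup>2 \<le> s" using s0 u power_mono[of s "nrm d ?u" 2] by simp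
  hence "s * s \<le> s * 1" by (simp add: power2_eq_square)
  hence "s \<le> 1" using s0 by (cases "s = 0") (auto simp: mult_le_cancel_left)
  thus ?thesis by (simp add: s_def)
qed

lemma hs_norm_nonneg [simp]: "0 \<le> hs_norm d A"
  by (simp add: hs_norm_def)

text \<open>Cauchy-Schwarz over the entries; the \<open>d\<close> rows of a contraction have norm at
  most one each. With d = 2^b this is the whole price paid for quantum storage in the hash
  bound.\<close>

lemma fn_trace_contraction_le:
  assumes "contraction d V"
  shows "cmod (fn_trace d V A) \<le> sqrt d * hs_norm d A"
proof -
  let ?P = "{..<d} \<times> {..<d}"
  have "fn_trace d V A = (\<Sum>(r, c)\<in>?P. V c r * A r c)"
    by (simp add: fn_trace_def sum.cartesian_product)
  also have "cmod \<dots> \<le> (\<Sum>p\<in>?P. \<bar>cmod (V (snd p) (fst p))\<bar> * \<bar>case p of (r, c) \<Rightarrow> cmod (A r c)\<bar>)"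
    by (intro sum_norm_le) (auto simp: norm_mult)
  also have "\<dots> \<le> L2_set (\<lambda>p. cmod (V (snd p) (fst p))) ?P * hs_norm d A"
    unfolding hs_norm_def by (rule L2_set_mult_ineq)
  also have "L2_set (\<lambda>p. cmod (V (snd p) (fst p))) ?P \<le> sqrt d"
  proof -
    have "(\<Sum>p\<in>?P. (cmod (V (snd p) (fst p)))\<^sup>2) = (\<Sum>r<d. \<Sum>c<d. (cmod (V c r))\<^sup>2)"
      by (simp add: sum.cartesian_product case_prod_beta)
    also have "\<dots> = (\<Sum>c<d. \<Sum>r<d. (cmod (V c r))\<^sup>2)" by (rule sum.swap)
    also have "\<dots> \<le> (\<Sum>c<d. 1)" using contraction_row[OF assms] by (intro sum_mono) auto
    finally show ?thesis unfolding L2_set_def by simp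
  qed
  finally show ?thesis by (simp add: mult_right_mono)
qed

lemma density_spectral:
  assumes "density b \<rho>"
  obtains k a u where "orthonormal (2 ^ b) k u" "\<And>i. i < k \<Longrightarrow> 0 \<le> (a i :: real)" "(\<Sum>i<k. a i) = 1"
    "\<And>r c. r < 2 ^ b \<Longrightarrow> c < 2 ^ b \<Longrightarrow> ent \<rho> r c = outer_sum k (\<lambda>i. of_real (a i)) u r c"
proof -
  let ?d = "2 ^ b :: nat"
  have \<rho>: "\<rho> \<in> carrier_mat ?d ?d" and h: "herm ?d (ent \<rho>)"
    and p: "\<And>v. 0 \<le> Re (ip ?d (app ?d (ent \<rho>) v) v)" and t: "mat_trace \<rho> = 1"
    using assms by (auto simp: density_def psd_iff)
  obtain k u a where on: "orthonormal ?d k u" and "\<And>i. i < k \<Longrightarrow> a i \<noteq> 0"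
    and ev: "\<And>i r. i < k \<Longrightarrow> r < ?d \<Longrightarrow> app ?d (ent \<rho>) (u i) r = of_real (a i) * u i r"
    and eq: "\<And>r c. r < ?d \<Longrightarrow> c < ?d \<Longrightarrow> ent \<rho> r c = (\<Sum>i<k. of_real (a i) * u i r * cnj (u i c))"
    by (rule spectral[OF h]) (rule that; simp)
  have a0: "0 \<le> a i" if "i < k" for i
  proof -
    have "ip ?d (app ?d (ent \<rho>) (u i)) (u i) = ip ?d (\<lambda>r. of_real (a i) * u i r) (u i)"
      by (rule ip_cong) (simp_all add: ev[OF that])
    also have "\<dots> = of_real (a i)"
      unfolding ip_scale_left using on that by (simp add: orthonormal_def)
    finally show ?thesis using p[of "u i"] by simp
  qed
  have "mat_trace \<rho> = (\<Sum>r<?d. ent \<rho> r r)"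
    using \<rho> by (simp add: mat_trace_def ent_def)
  also have "\<dots> = (\<Sum>r<?d. \<Sum>i<k. of_real (a i) * (u i r * cnj (u i r)))"
    by (intro sum.cong refl) (simp add: eq mult.assoc)
  also have "\<dots> = (\<Sum>i<k. \<Sum>r<?d. of_real (a i) * (u i r * cnj (u i r)))"
    by (rule sum.swap)
  also have "\<dots> = (\<Sum>i<k. of_real (a i) * ip ?d (u i) (u i))"
    by (simp only: ip_def sum_distrib_left)
  also have "\<dots> = of_real (\<Sum>i<k. a i)"
    unfolding of_real_sum using on by (intro sum.cong) (auto simp: orthonormal_def)
  finally have a1: "(\<Sum>i<k. a i) = 1" using t by (metis of_real_eq_1_iff)
  show ?thesis by (rule that[OF on a0 a1]) (simp_all add: eq outer_sum_def)
qed

text \<open>The squared norm is the sum of the squared eigenvalues, and these lie in [0, 1] and add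
  up to one.\<close>

lemma density_hs_norm_le:
  assumes "density b \<rho>"
  shows "hs_norm (2 ^ b) (ent \<rho>) \<le> 1"
proof -
  let ?d = "2 ^ b :: nat"
  obtain k a u where on: "orthonormal ?d k u" and a: "\<And>i. i < k \<Longrightarrow> 0 \<le> (a i :: real)" "(\<Sum>i<k. a i) = 1"
    and eq: "\<And>r c. r < ?d \<Longrightarrow> c < ?d \<Longrightarrow> ent \<rho> r c = outer_sum k (\<lambda>i. of_real (a i)) u r c"
    by (rule density_spectral[OF assms]) (rule that; simp)
  let ?R = "outer_sum k (\<lambda>i. of_real (a i)) u"
  have cn: "cnj (?R r c) = ?R c r" for r c by (simp add: outer_sum_def mult_ac)
  have "complex_of_real ((hs_norm ?d (ent \<rho>))\<^sup>2) = (\<Sum>r<?d. \<Sum>c<?d. ?R r c * ?R c r)"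
    unfolding hs_norm_sq of_real_sum complex_norm_square by (simp add: eq cn)
  also have "\<dots> = (\<Sum>r<?d. outer_sum k (\<lambda>i. of_real (a i) * of_real (a i)) u r r)"
    by (simp add: outer_sum_mult[OF on])
  also have "\<dots> = (\<Sum>i<k. \<Sum>r<?d. of_real (a i * a i) * (u i r * cnj (u i r)))"
    unfolding outer_sum_def by (subst sum.swap) (simp add: mult_ac)
  also have "\<dots> = (\<Sum>i<k. of_real (a i * a i) * ip ?d (u i) (u i))"
    by (simp only: ip_def sum_distrib_left)
  also have "\<dots> = of_real (\<Sum>i<k. a i * a i)"
    unfolding of_real_sum using on by (intro sum.cong) (auto simp: orthonormal_def)
  finally have "(hs_norm ?d (ent \<rho>))\<^sup>2 = (\<Sum>i<k. a i * a i)" by (simp only: of_real_eq_iff)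
  also have "\<dots> \<le> (\<Sum>i<k. a i)"
  proof (rule sum_mono)
    fix i assume i: "i \<in> {..<k}"
    have "a i \<le> (\<Sum>i<k. a i)" using i a(1) by (intro member_le_sum) auto
    thus "a i * a i \<le> a i" using a i by (simp add: mult_left_le_one_le)
  qed
  finally have "(hs_norm ?d (ent \<rho>))\<^sup>2 \<le> 1\<^sup>2" using a(2) by simp
  thus ?thesis by (rule power2_le_imp_le) simp
qed

section \<open>Partial traces of a test against a density\<close>

definition tens :: "nat \<Rightarrow> (nat \<Rightarrow> complex) \<Rightarrow> (nat \<Rightarrow> complex) \<Rightarrow> nat \<Rightarrow> complex" where
  "tens d u x I = u (I div d) * x (I mod d)"

lemma nrm_tens: "nrm (d1 * d2) (tens d2 u x) = nrm d1 u * nrm d2 x"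
proof -
  have "(nrm (d1 * d2) (tens d2 u x))\<^sup>2 = (nrm d1 u * nrm d2 x)\<^sup>2"
    unfolding power_mult_distrib nrm_sq sum_lessThan_mult sum_product
    by (simp add: tens_def norm_mult power_mult_distrib)
  thus ?thesis by (rule power2_eq_imp_eq) simp_all
qed

lemma ip_app_tens:
  "ip (d1 * d2) (app (d1 * d2) V (tens d2 u x)) (tens d2 u' x') =
   (\<Sum>i<d1. \<Sum>r<d2. \<Sum>j<d1. \<Sum>c<d2. V (i * d2 + r) (j * d2 + c) * (u j * cnj (u' i)) * (x c * cnj (x' r)))"
  unfolding ip_def app_def sum_lessThan_mult sum_distrib_right
  by (intro sum.cong refl) (simp add: tens_def mult_ac)

text \<open>Tr_1 (V (R \<otimes> 1)), an operator on the second factor; \<open>ptrace_right\<close>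
  is Tr_2 (V (1 \<otimes> S)) on the first.\<close>

definition ptrace_left :: "nat \<Rightarrow> nat \<Rightarrow> (nat \<Rightarrow> nat \<Rightarrow> complex) \<Rightarrow> (nat \<Rightarrow> nat \<Rightarrow> complex) \<Rightarrow> nat \<Rightarrow> nat \<Rightarrow> complex" where
  "ptrace_left d1 d2 V R = (\<lambda>r c. \<Sum>i<d1. \<Sum>j<d1. V (i * d2 + r) (j * d2 + c) * R j i)"

definition ptrace_right :: "nat \<Rightarrow> nat \<Rightarrow> (nat \<Rightarrow> nat \<Rightarrow> complex) \<Rightarrow> (nat \<Rightarrow> nat \<Rightarrow> complex) \<Rightarrow> nat \<Rightarrow> nat \<Rightarrow> complex" where
  "ptrace_right d1 d2 V S = (\<lambda>i j. \<Sum>r<d2. \<Sum>c<d2. V (i * d2 + r) (j * d2 + c) * S c r)"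

text \<open>Diagonalising the density with eigenvalues a_l and eigenvectors u_l turns the form at x,
  y into the average, with weights a_l, of the form of \<open>V\<close> at u_l \<otimes> x and u_l
  \<otimes> y. Tensoring with a unit vector keeps the norm.\<close>

lemma contraction_ptrace_left:
  assumes V: "contraction (2 ^ b * d2) V" and \<rho>: "density b \<rho>"
  shows "contraction d2 (ptrace_left (2 ^ b) d2 V (ent \<rho>))"
  unfolding contraction_def
proof (intro allI)
  fix x y
  let ?d = "2 ^ b :: nat"
  obtain k a u where on: "orthonormal ?d k u" and a: "\<And>i. i < k \<Longrightarrow> 0 \<le> (a i :: real)" "(\<Sum>i<k. a i) = 1"
    and eq: "\<And>r c. r < ?d \<Longrightarrow> c < ?d \<Longrightarrow> ent \<rho> r c = outer_sum k (\<lambda>i. of_real (a i)) u r c"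
    by (rule density_spectral[OF \<rho>]) (rule that; simp)
  let ?s = "\<lambda>i r j c. V (i * d2 + r) (j * d2 + c) * ent \<rho> j i * (x c * cnj (y r))"
  let ?t = "\<lambda>l i r j c. of_real (a l) * (V (i * d2 + r) (j * d2 + c) * (u l j * cnj (u l i)) * (x c * cnj (y r)))"
  have "ip d2 (app d2 (ptrace_left ?d d2 V (ent \<rho>)) x) y =
    (\<Sum>r<d2. \<Sum>c<d2. \<Sum>i<?d. \<Sum>j<?d. ?s i r j c)"
    unfolding ip_def app_def ptrace_left_def sum_distrib_right mult.assoc ..
  also have "\<dots> = (\<Sum>r<d2. \<Sum>i<?d. \<Sum>c<d2. \<Sum>j<?d. ?s i r j c)"
    by (rule sum.cong[OF refl], rule sum.swap)
  also have "\<dots> = (\<Sum>i<?d. \<Sum>r<d2. \<Sum>c<d2. \<Sum>j<?d. ?s i r j c)"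
    by (rule sum.swap)
  also have "\<dots> = (\<Sum>i<?d. \<Sum>r<d2. \<Sum>j<?d. \<Sum>c<d2. ?s i r j c)"
    by (rule sum.cong[OF refl], rule sum.cong[OF refl], rule sum.swap)
  also have "\<dots> = (\<Sum>i<?d. \<Sum>r<d2. \<Sum>j<?d. \<Sum>c<d2. \<Sum>l<k. ?t l i r j c)"
  proof (intro sum.cong refl)
    fix i r j c assume "i \<in> {..<?d}" "j \<in> {..<?d}"
    hence "ent \<rho> j i = (\<Sum>l<k. of_real (a l) * (u l j * cnj (u l i)))"
      by (simp add: eq outer_sum_def mult.assoc)
    thus "?s i r j c =
        (\<Sum>l<k. of_real (a l) * (V (i * d2 + r) (j * d2 + c) * (u l j * cnj (u l i)) * (x c * cnj (y r))))"
      by (simp only: sum_distrib_left sum_distrib_right mult_ac)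
  qed
  also have "\<dots> = (\<Sum>i<?d. \<Sum>r<d2. \<Sum>j<?d. \<Sum>l<k. \<Sum>c<d2. ?t l i r j c)"
    by (rule sum.cong[OF refl], rule sum.cong[OF refl], rule sum.cong[OF refl], rule sum.swap)
  also have "\<dots> = (\<Sum>i<?d. \<Sum>r<d2. \<Sum>l<k. \<Sum>j<?d. \<Sum>c<d2. ?t l i r j c)"
    by (rule sum.cong[OF refl], rule sum.cong[OF refl], rule sum.swap)
  also have "\<dots> = (\<Sum>i<?d. \<Sum>l<k. \<Sum>r<d2. \<Sum>j<?d. \<Sum>c<d2. ?t l i r j c)"
    by (rule sum.cong[OF refl], rule sum.swap)
  also have "\<dots> = (\<Sum>l<k. \<Sum>i<?d. \<Sum>r<d2. \<Sum>j<?d. \<Sum>c<d2. ?t l i r j c)"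
    by (rule sum.swap)
  also have "\<dots> = (\<Sum>l<k. of_real (a l) * ip (?d * d2) (app (?d * d2) V (tens d2 (u l) x)) (tens d2 (u l) y))"
    by (simp only: ip_app_tens sum_distrib_left)
  finally have eq': "ip d2 (app d2 (ptrace_left ?d d2 V (ent \<rho>)) x) y =
    (\<Sum>l<k. of_real (a l) * ip (?d * d2) (app (?d * d2) V (tens d2 (u l) x)) (tens d2 (u l) y))" .
  have "cmod (ip d2 (app d2 (ptrace_left ?d d2 V (ent \<rho>)) x) y) \<le> (\<Sum>l<k. a l * (nrm d2 x * nrm d2 y))"
    unfolding eq'
  proof (rule sum_norm_le)
    fix l assume l: "l \<in> {..<k}"
    have "cmod (ip (?d * d2) (app (?d * d2) V (tens d2 (u l) x)) (tens d2 (u l) y)) \<le>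
        nrm (?d * d2) (tens d2 (u l) x) * nrm (?d * d2) (tens d2 (u l) y)"
      using V by (simp add: contraction_def)
    also have "\<dots> = nrm d2 x * nrm d2 y"
      using orthonormal_nrm[OF on, of l] l by (simp add: nrm_tens)
    finally show "cmod (of_real (a l) * ip (?d * d2) (app (?d * d2) V (tens d2 (u l) x)) (tens d2 (u l) y))
        \<le> a l * (nrm d2 x * nrm d2 y)"
      unfolding norm_mult using a(1)[of l] l by (simp add: mult_left_mono)
  qed
  also have "\<dots> = nrm d2 x * nrm d2 y" by (simp add: a(2) flip: sum_distrib_right)
  finally show "cmod (ip d2 (app d2 (ptrace_left ?d d2 V (ent \<rho>)) x) y) \<le> nrm d2 x * nrm d2 y" .
qed


lemma contraction_ptrace_right:
  assumes V: "contraction (d1 * 2 ^ b) V" and \<rho>: "density b \<rho>"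
  shows "contraction d1 (ptrace_right d1 (2 ^ b) V (ent \<rho>))"
  unfolding contraction_def
proof (intro allI)
  fix x y
  let ?d = "2 ^ b :: nat"
  obtain k a u where on: "orthonormal ?d k u" and a: "\<And>i. i < k \<Longrightarrow> 0 \<le> (a i :: real)" "(\<Sum>i<k. a i) = 1"
    and eq: "\<And>r c. r < ?d \<Longrightarrow> c < ?d \<Longrightarrow> ent \<rho> r c = outer_sum k (\<lambda>i. of_real (a i)) u r c"
    by (rule density_spectral[OF \<rho>]) (rule that; simp)
  let ?s = "\<lambda>i r j c. V (i * ?d + r) (j * ?d + c) * (ent \<rho> c r * (x j * cnj (y i)))"
  let ?t = "\<lambda>l i r j c. of_real (a l) * (V (i * ?d + r) (j * ?d + c) * (x j * cnj (y i)) * (u l c * cnj (u l r)))"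
  have "ip d1 (app d1 (ptrace_right d1 ?d V (ent \<rho>)) x) y =
    (\<Sum>i<d1. \<Sum>j<d1. \<Sum>r<?d. \<Sum>c<?d. ?s i r j c)"
    unfolding ip_def app_def ptrace_right_def sum_distrib_right mult.assoc ..
  also have "\<dots> = (\<Sum>i<d1. \<Sum>r<?d. \<Sum>j<d1. \<Sum>c<?d. ?s i r j c)"
    by (rule sum.cong[OF refl], rule sum.swap)
  also have "\<dots> = (\<Sum>i<d1. \<Sum>r<?d. \<Sum>j<d1. \<Sum>c<?d. \<Sum>l<k. ?t l i r j c)"
  proof (intro sum.cong refl)
    fix i r j c assume "r \<in> {..<?d}" "c \<in> {..<?d}"
    hence "ent \<rho> c r = (\<Sum>l<k. of_real (a l) * (u l c * cnj (u l r)))"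
      by (simp add: eq outer_sum_def mult.assoc)
    thus "?s i r j c =
        (\<Sum>l<k. of_real (a l) * (V (i * ?d + r) (j * ?d + c) * (x j * cnj (y i)) * (u l c * cnj (u l r))))"
      by (simp only: sum_distrib_left sum_distrib_right mult_ac)
  qed
  also have "\<dots> = (\<Sum>i<d1. \<Sum>r<?d. \<Sum>j<d1. \<Sum>l<k. \<Sum>c<?d. ?t l i r j c)"
    by (rule sum.cong[OF refl], rule sum.cong[OF refl], rule sum.cong[OF refl], rule sum.swap)
  also have "\<dots> = (\<Sum>i<d1. \<Sum>r<?d. \<Sum>l<k. \<Sum>j<d1. \<Sum>c<?d. ?t l i r j c)"
    by (rule sum.cong[OF refl], rule sum.cong[OF refl], rule sum.swap)
  also have "\<dots> = (\<Sum>i<d1. \<Sum>l<k. \<Sum>r<?d. \<Sum>j<d1. \<Sum>c<?d. ?t l i r j c)"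
    by (rule sum.cong[OF refl], rule sum.swap)
  also have "\<dots> = (\<Sum>l<k. \<Sum>i<d1. \<Sum>r<?d. \<Sum>j<d1. \<Sum>c<?d. ?t l i r j c)"
    by (rule sum.swap)
  also have "\<dots> = (\<Sum>l<k. of_real (a l) * ip (d1 * ?d) (app (d1 * ?d) V (tens ?d x (u l))) (tens ?d y (u l)))"
    by (simp only: ip_app_tens sum_distrib_left)
  finally have eq': "ip d1 (app d1 (ptrace_right d1 ?d V (ent \<rho>)) x) y =
    (\<Sum>l<k. of_real (a l) * ip (d1 * ?d) (app (d1 * ?d) V (tens ?d x (u l))) (tens ?d y (u l)))" .
  have "cmod (ip d1 (app d1 (ptrace_right d1 ?d V (ent \<rho>)) x) y) \<le> (\<Sum>l<k. a l * (nrm d1 x * nrm d1 y))"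
    unfolding eq'
  proof (rule sum_norm_le)
    fix l assume l: "l \<in> {..<k}"
    have "cmod (ip (d1 * ?d) (app (d1 * ?d) V (tens ?d x (u l))) (tens ?d y (u l))) \<le>
        nrm (d1 * ?d) (tens ?d x (u l)) * nrm (d1 * ?d) (tens ?d y (u l))"
      using V by (simp add: contraction_def)
    also have "\<dots> = nrm d1 x * nrm d1 y"
      using orthonormal_nrm[OF on, of l] l by (simp add: nrm_tens)
    finally show "cmod (of_real (a l) * ip (d1 * ?d) (app (d1 * ?d) V (tens ?d x (u l))) (tens ?d y (u l)))
        \<le> a l * (nrm d1 x * nrm d1 y)"
      unfolding norm_mult using a(1)[of l] l by (simp add: mult_left_mono)
  qed
  also have "\<dots> = nrm d1 x * nrm d1 y" by (simp add: a(2) flip: sum_distrib_right)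
  finally show "cmod (ip d1 (app d1 (ptrace_right d1 ?d V (ent \<rho>)) x) y) \<le> nrm d1 x * nrm d1 y" .
qed

definition kron :: "nat \<Rightarrow> (nat \<Rightarrow> nat \<Rightarrow> complex) \<Rightarrow> (nat \<Rightarrow> nat \<Rightarrow> complex) \<Rightarrow> nat \<Rightarrow> nat \<Rightarrow> complex" where
  "kron d R S I J = R (I div d) (J div d) * S (I mod d) (J mod d)"

lemma fn_trace_kron:
  "fn_trace (d1 * d2) V (kron d2 R S) =
    (\<Sum>i<d1. \<Sum>r<d2. \<Sum>j<d1. \<Sum>c<d2. V (j * d2 + c) (i * d2 + r) * (R i j * S r c))"
  unfolding fn_trace_def sum_lessThan_mult
  by (intro sum.cong refl) (simp add: kron_def)

text \<open>With \<open>fn_trace_ptrace_left\<close> this reads one number, Tr (V (R \<otimes> S)),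
  as the value of a test on either factor alone; \<open>composition_bound\<close> switches between
  the two readings.\<close>

lemma fn_trace_ptrace_right:
  "fn_trace d1 (ptrace_right d1 d2 V S) R = fn_trace (d1 * d2) V (kron d2 R S)"
proof -
  let ?t = "\<lambda>i r j c. V (j * d2 + c) (i * d2 + r) * (R i j * S r c)"
  have "fn_trace (d1 * d2) V (kron d2 R S) =
    (\<Sum>i<d1. \<Sum>j<d1. \<Sum>r<d2. \<Sum>c<d2. ?t i r j c)"
    unfolding fn_trace_kron by (rule sum.cong[OF refl], rule sum.swap)
  also have "\<dots> = (\<Sum>i<d1. \<Sum>j<d1. \<Sum>c<d2. \<Sum>r<d2. ?t i r j c)"
    by (rule sum.cong[OF refl], rule sum.cong[OF refl], rule sum.swap)
  also have "\<dots> = fn_trace d1 (ptrace_right d1 d2 V S) R"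
    unfolding fn_trace_def ptrace_right_def sum_distrib_right by (simp only: mult_ac)
  finally show ?thesis ..
qed

lemma fn_trace_ptrace_left:
  "fn_trace d2 (ptrace_left d1 d2 V R) S = fn_trace (d1 * d2) V (kron d2 R S)"
proof -
  let ?t = "\<lambda>i r j c. V (j * d2 + c) (i * d2 + r) * (R i j * S r c)"
  have "fn_trace (d1 * d2) V (kron d2 R S) =
    (\<Sum>r<d2. \<Sum>i<d1. \<Sum>j<d1. \<Sum>c<d2. ?t i r j c)"
    unfolding fn_trace_kron by (rule sum.swap)
  also have "\<dots> = (\<Sum>r<d2. \<Sum>i<d1. \<Sum>c<d2. \<Sum>j<d1. ?t i r j c)"
    by (rule sum.cong[OF refl], rule sum.cong[OF refl], rule sum.swap)
  also have "\<dots> = (\<Sum>r<d2. \<Sum>c<d2. \<Sum>i<d1. \<Sum>j<d1. ?t i r j c)"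
    by (rule sum.cong[OF refl], rule sum.swap)
  also have "\<dots> = (\<Sum>r<d2. \<Sum>c<d2. \<Sum>j<d1. \<Sum>i<d1. ?t i r j c)"
    by (rule sum.cong[OF refl], rule sum.cong[OF refl], rule sum.swap)
  also have "\<dots> = fn_trace d2 (ptrace_left d1 d2 V R) S"
    unfolding fn_trace_def ptrace_left_def sum_distrib_right by (simp only: mult_ac)
  finally show ?thesis ..
qed

section \<open>Bit strings as basis states, and classical-quantum differences\<close>

lemma finite_bits [simp]: "finite (bits n)"
  and card_bits [simp]: "card (bits n) = 2 ^ n"
proof -
  have "x \<in> {0, 1}" for x :: bit by (cases x) auto
  hence U: "(UNIV :: bit set) = {0, 1}" by blast
  have "bits n = {xs. set xs \<subseteq> (UNIV :: bit set) \<and> length xs = n}" by (simp add: bits_def)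
  moreover have "finite (UNIV :: bit set)" "card (UNIV :: bit set) = 2" unfolding U by simp_all
  ultimately show "finite (bits n)" "card (bits n) = 2 ^ n"
    using finite_lists_length_eq[of "UNIV :: bit set" n] card_lists_length_eq[of "UNIV :: bit set" n] by simp_all
qed

lemma basis_index_Cons: "basis_index (a # z) = of_bool (a = 1) + 2 * basis_index z"
  by (simp add: basis_index_def)

lemma basis_index_less: "basis_index z < 2 ^ length z"
  by (induction z) (auto simp: basis_index_Cons basis_index_def)

lemma basis_index_inj: "length z = length w \<Longrightarrow> basis_index z = basis_index w \<Longrightarrow> z = w"
proof (induction z w rule: list_induct2)
  case (Cons a z b w)
  have "basis_index z = basis_index w \<and> (a = 1) = (b = 1)"
    using Cons.prems by (cases "a = 1"; cases "b = 1") (auto simp: basis_index_Cons; presburger)+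
  moreover have "a = b" if "(a = 1) = (b = 1)" using that by (cases a; cases b) auto
  ultimately show ?case using Cons.IH by blast
qed simp

lemma bij_basis_index: "bij_betw basis_index (bits m) {..<2 ^ m}"
proof -
  have inj: "inj_on basis_index (bits m)"
    by (intro inj_onI basis_index_inj) (auto simp: bits_def)
  have "basis_index ` bits m \<subseteq> {..<2 ^ m}"
    using basis_index_less by (force simp: bits_def)
  hence "basis_index ` bits m = {..<2 ^ m}"
    by (intro card_subset_eq) (simp_all add: card_image[OF inj])
  thus ?thesis using inj by (simp add: bij_betw_def)
qed

text \<open>The diagonal block of \<open>cq_diff\<close> at the classical value \<open>h\<close>;
  the uniform part has been moved into the coefficients.\<close>

definition cq_part :: "nat \<Rightarrow> ('i \<Rightarrow> real) \<Rightarrow> ('i \<Rightarrow> bit list) \<Rightarrow> ('i \<Rightarrow> complex mat) \<Rightarrow> 'i set \<Rightarrow> nat \<Rightarrow> nat \<Rightarrow> nat \<Rightarrow> complex" where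
  "cq_part m p z \<tau> I h r c =
     (\<Sum>i\<in>I. of_real (p i * (of_bool (basis_index (z i) = h) - 1 / 2 ^ m)) * ent (\<tau> i) r c)"

text \<open>Both extractor definitions are instances, with index pairs (x, u) and (x, y). The
  averaged state \<open>S\<close> is kept as a separate matrix because the seeded definition sums it
  over \<open>x\<close> only.\<close>

definition cq_diff :: "nat \<Rightarrow> nat \<Rightarrow> ('i \<Rightarrow> real) \<Rightarrow> ('i \<Rightarrow> bit list) \<Rightarrow> ('i \<Rightarrow> complex mat) \<Rightarrow> 'i set \<Rightarrow> complex mat \<Rightarrow> complex mat" where
  "cq_diff m D p z \<tau> I S =
     mat_sum (2 ^ m * D) (\<lambda>i. of_real (p i) \<cdot>\<^sub>m (ket_bra (z i) \<otimes>\<^sub>M \<tau> i)) I - max_mixed m \<otimes>\<^sub>M S"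

context
  fixes m D :: nat and p :: "'i \<Rightarrow> real" and z \<tau> and I :: "'i set" and S
  assumes z: "\<And>i. i \<in> I \<Longrightarrow> z i \<in> bits m"
    and \<tau>: "\<And>i. i \<in> I \<Longrightarrow> \<tau> i \<in> carrier_mat D D" "\<And>i. i \<in> I \<Longrightarrow> herm D (ent (\<tau> i))"
    and S: "S \<in> carrier_mat D D"
      "\<And>r c. r < D \<Longrightarrow> c < D \<Longrightarrow> S $$ (r, c) = (\<Sum>i\<in>I. of_real (p i) * ent (\<tau> i) r c)"
begin

lemma cq_diff_carrier: "cq_diff m D p z \<tau> I S \<in> carrier_mat (2 ^ m * D) (2 ^ m * D)"
  using S by (auto simp: cq_diff_def max_mixed_def tensor_mat_def)

lemma cq_diff_index:
  assumes "i < 2 ^ m * D" "j < 2 ^ m * D"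
  shows "cq_diff m D p z \<tau> I S $$ (i, j) = blocks D (cq_part m p z \<tau> I) i j"
proof -
  have D: "0 < D" using assms by (cases D) auto
  have lt: "i div D < 2 ^ m" "j div D < 2 ^ m" "i mod D < D" "j mod D < D"
    using assms D by (auto simp: less_mult_imp_div_less)
  have e: "(of_real (p l) \<cdot>\<^sub>m (ket_bra (z l) \<otimes>\<^sub>M \<tau> l)) $$ (i, j) =
      of_real (p l) * (of_bool (i div D = basis_index (z l) \<and> j div D = basis_index (z l)) * ent (\<tau> l) (i mod D) (j mod D))"
    if "l \<in> I" for l
    using \<tau>(1)[OF that] z[OF that] assms lt
    by (auto simp: tensor_mat_def ket_bra_def bits_def ent_def)
  have "cq_diff m D p z \<tau> I S $$ (i, j) =
     (\<Sum>l\<in>I. of_real (p l) * (of_bool (i div D = basis_index (z l) \<and> j div D = basis_index (z l)) * ent (\<tau> l) (i mod D) (j mod D)))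
     - (1 / 2 ^ m * of_bool (i div D = j div D)) * (\<Sum>l\<in>I. of_real (p l) * ent (\<tau> l) (i mod D) (j mod D))"
    using assms S lt e
    by (simp add: cq_diff_def max_mixed_def tensor_mat_def mat_sum_def)
  also have "\<dots> = blocks D (cq_part m p z \<tau> I) i j"
  proof (cases "i div D = j div D")
    case True
    thus ?thesis
      unfolding blocks_def cq_part_def sum_distrib_left sum_subtractf[symmetric]
      by (auto intro!: sum.cong simp: algebra_simps)
  next
    case False
    hence "of_real (p l) * (of_bool (i div D = basis_index (z l) \<and> j div D = basis_index (z l)) * ent (\<tau> l) (i mod D) (j mod D)) = 0" for l
      by auto
    thus ?thesis using False by (simp add: blocks_def)
  qed
  finally show ?thesis .
qed

lemma herm_cq_part: "herm D (cq_part m p z \<tau> I h)"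
  unfolding herm_def cq_part_def
proof (intro allI impI)
  fix r c assume "r < D" "c < D"
  thus "(\<Sum>i\<in>I. of_real (p i * (of_bool (basis_index (z i) = h) - 1 / 2 ^ m)) * ent (\<tau> i) c r) =
      cnj (\<Sum>i\<in>I. of_real (p i * (of_bool (basis_index (z i) = h) - 1 / 2 ^ m)) * ent (\<tau> i) r c)"
    using hermD[OF \<tau>(2)] by (simp del: of_real_mult of_real_diff)
qed

lemma sum_fn_trace_cq_part:
  "(\<Sum>h<2 ^ m. fn_trace D (V h) (cq_part m p z \<tau> I h)) =
     (\<Sum>i\<in>I. of_real (p i) * (fn_trace D (V (basis_index (z i))) (ent (\<tau> i))
        - (\<Sum>w\<in>bits m. fn_trace D (V (basis_index w)) (ent (\<tau> i))) / 2 ^ m))"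
proof -
  have "(\<Sum>h<2 ^ m. fn_trace D (V h) (cq_part m p z \<tau> I h)) =
     (\<Sum>h<2 ^ m. \<Sum>i\<in>I. of_real (p i * (of_bool (basis_index (z i) = h) - 1 / 2 ^ m)) * fn_trace D (V h) (ent (\<tau> i)))"
    unfolding cq_part_def fn_trace_sum_right ..
  also have "\<dots> = (\<Sum>i\<in>I. \<Sum>h<2 ^ m. of_real (p i * (of_bool (basis_index (z i) = h) - 1 / 2 ^ m)) * fn_trace D (V h) (ent (\<tau> i)))"
    by (rule sum.swap)
  also have "\<dots> = (\<Sum>i\<in>I. of_real (p i) * (fn_trace D (V (basis_index (z i))) (ent (\<tau> i))
        - (\<Sum>w\<in>bits m. fn_trace D (V (basis_index w)) (ent (\<tau> i))) / 2 ^ m))"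
  proof (rule sum.cong[OF refl])
    fix i assume i: "i \<in> I"
    let ?t = "\<lambda>h. fn_trace D (V h) (ent (\<tau> i))"
    have zi: "basis_index (z i) < 2 ^ m"
      using basis_index_less[of "z i"] z[OF i] by (simp add: bits_def)
    have "(\<Sum>h<2 ^ m. of_real (p i * (of_bool (basis_index (z i) = h) - 1 / 2 ^ m)) * ?t h) =
       (\<Sum>h<2 ^ m. of_real (p i) * ((if h = basis_index (z i) then ?t h else 0) - ?t h / 2 ^ m))"
      by (intro sum.cong refl) (auto simp: algebra_simps)
    also have "\<dots> = of_real (p i) * (?t (basis_index (z i)) - (\<Sum>h<2 ^ m. ?t h) / 2 ^ m)"
      unfolding sum_distrib_left[symmetric] sum_subtractf sum_divide_distrib[symmetric] using zi by simp
    also have "(\<Sum>h<2 ^ m. ?t h) = (\<Sum>w\<in>bits m. ?t (basis_index w))"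
      by (rule sum.reindex_bij_betw[OF bij_basis_index, symmetric])
    finally show "(\<Sum>h<2 ^ m. of_real (p i * (of_bool (basis_index (z i) = h) - 1 / 2 ^ m)) * ?t h) =
       of_real (p i) * (?t (basis_index (z i)) - (\<Sum>w\<in>bits m. ?t (basis_index w)) / 2 ^ m)" .
  qed
  finally show ?thesis .
qed

text \<open>This direction extracts tests from the two-source distance; \<open>cq_diff_ge\<close> is
  the converse, through which tests are fed into the seeded extractor.\<close>

lemma cq_diff_attained:
  obtains V where "\<And>w. w \<in> bits m \<Longrightarrow> contraction D (V w)"
    "(\<Sum>i\<in>I. of_real (p i) * (fn_trace D (V (z i)) (ent (\<tau> i))
        - (\<Sum>w\<in>bits m. fn_trace D (V w) (ent (\<tau> i))) / 2 ^ m)) = of_real (2 * tr_norm (cq_diff m D p z \<tau> I S))"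
proof -
  obtain V where V: "\<And>h. h < 2 ^ m \<Longrightarrow> contraction D (V h)"
    "(\<Sum>h<2 ^ m. fn_trace D (V h) (cq_part m p z \<tau> I h)) = of_real (2 * tr_norm (cq_diff m D p z \<tau> I S))"
    by (rule tr_norm_blocks_attained[OF cq_diff_carrier cq_diff_index herm_cq_part]) (assumption | rule that; simp)+
  have "contraction D (V (basis_index w))" if "w \<in> bits m" for w
    using V(1)[of "basis_index w"] basis_index_less[of w] that by (simp add: bits_def)
  from that[OF this V(2)[unfolded sum_fn_trace_cq_part]] show ?thesis .
qed

lemma cq_diff_ge:
  assumes V: "\<And>w. w \<in> bits m \<Longrightarrow> contraction D (V w)"
  shows "cmod (\<Sum>i\<in>I. of_real (p i) * (fn_trace D (V (z i)) (ent (\<tau> i))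
        - (\<Sum>w\<in>bits m. fn_trace D (V w) (ent (\<tau> i))) / 2 ^ m)) \<le> 2 * tr_norm (cq_diff m D p z \<tau> I S)"
proof -
  \<comment> \<open>Tests are indexed by strings, blocks by numbers; \<open>g\<close> decodes the
    latter.\<close>
  define g where "g = inv_into (bits m) basis_index"
  have g: "g (basis_index w) = w" if "w \<in> bits m" for w
    unfolding g_def using that bij_basis_index by (simp add: bij_betw_def)
  have gm: "g h \<in> bits m" if "h < 2 ^ m" for h
    unfolding g_def using that bij_basis_index[of m] by (intro inv_into_into) (simp add: bij_betw_def)
  have "cmod (\<Sum>h<2 ^ m. fn_trace D (V (g h)) (cq_part m p z \<tau> I h)) \<le> 2 * tr_norm (cq_diff m D p z \<tau> I S)"
    by (rule tr_norm_blocks_ge[OF cq_diff_carrier cq_diff_index herm_cq_part V[OF gm]])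
  thus ?thesis
    unfolding sum_fn_trace_cq_part using z by (simp add: g cong: sum.cong)
qed

end

section \<open>Collisions of the hash\<close>

declare add_bit_eq_xor [simp del] mult_bit_eq_and [simp del] bit_not_zero_iff [simp del]

section \<open>Characters and linear systems over GF(2)\<close>

definition chi :: "bit \<Rightarrow> real" where
  "chi b = (if b = 1 then -1 else 1)"

lemma chi_add: "chi (a + b) = chi a * chi b"
  by (cases a; cases b) (auto simp: chi_def add_bit_eq_xor)

lemma chi_sum: "chi (sum f S) = (\<Prod>i\<in>S. chi (f i))"
  by (induction S rule: infinite_finite_induct) (auto simp: chi_add, auto simp: chi_def)

text \<open>Flipping coordinate \<open>j\<close> permutes the strings and negates every term, so the
  sum equals its own negative.\<close>

lemma sum_chi_linear:
  assumes j: "j < n" "v j \<noteq> 0"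
  shows "(\<Sum>x\<in>bits n. chi (\<Sum>i<n. v i * x ! i)) = 0"
proof -
  let ?f = "\<lambda>x. x[j := x ! j + 1]"
  have "?f (?f x) = x" if "x \<in> bits n" for x
    using that j(1) by (simp add: bits_def add.assoc)
  hence bij: "bij_betw ?f (bits n) (bits n)"
    by (intro bij_betw_byWitness[of _ ?f]) (auto simp: bits_def)
  have v: "v j = 1" using j(2) by (simp add: bit_not_zero_iff)
  have flip: "chi (\<Sum>i<n. v i * ?f x ! i) = - chi (\<Sum>i<n. v i * x ! i)" if "x \<in> bits n" for x
  proof -
    have "(\<Sum>i<n. v i * ?f x ! i) = (\<Sum>i<n. v i * x ! i + (if i = j then 1 else 0))"
      using that j v by (intro sum.cong refl) (auto simp: bits_def nth_list_update distrib_left)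
    also have "\<dots> = (\<Sum>i<n. v i * x ! i) + 1"
      using j by (simp add: sum.distrib)
    finally show ?thesis by (simp add: chi_add) (simp add: chi_def)
  qed
  have "(\<Sum>x\<in>bits n. chi (\<Sum>i<n. v i * x ! i)) = (\<Sum>x\<in>bits n. chi (\<Sum>i<n. v i * ?f x ! i))"
    by (rule sum.reindex_bij_betw[OF bij, symmetric])
  also have "\<dots> = - (\<Sum>x\<in>bits n. chi (\<Sum>i<n. v i * x ! i))"
    unfolding sum_negf[symmetric] by (rule sum.cong[OF refl]) (rule flip)
  finally show ?thesis by simp
qed

text \<open>The hypothesis is linear independence of the rows \<open>u i\<close>. The product of the
  1 + chi (t i x) is 2^l at a solution and 0 elsewhere; expanded over subsets, every nonempty subset
  gives a nontrivial character, which sums to zero, and the empty one gives 2^n.\<close>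

lemma card_linear_system:
  assumes u: "\<And>S. S \<subseteq> {..<l} \<Longrightarrow> S \<noteq> {} \<Longrightarrow> \<exists>j<n. (\<Sum>i\<in>S. u i j) \<noteq> (0 :: bit)"
  shows "card {x \<in> bits n. \<forall>i<l. (\<Sum>j<n. u i j * x ! j) = 0} * 2 ^ l = 2 ^ n"
proof -
  define t where "t i x = (\<Sum>j<n. u i j * x ! j)" for i x
  let ?K = "{x \<in> bits n. \<forall>i<l. t i x = 0}"
  have pr: "(\<Prod>i<l. chi (t i x) + 1) = (if \<forall>i<l. t i x = 0 then 2 ^ l else 0)" for x
  proof (cases "\<forall>i<l. t i x = 0")
    case True
    thus ?thesis by (simp add: chi_def)
  next
    case False
    then obtain i where "i < l" "t i x = 1" by (metis bit_not_zero_iff)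
    hence "\<exists>i\<in>{..<l}. chi (t i x) + 1 = 0" by (auto simp: chi_def intro!: bexI[of _ i])
    thus ?thesis using False by (simp add: prod_zero)
  qed
  have "(\<Sum>x\<in>bits n. \<Prod>i<l. chi (t i x) + 1) = (\<Sum>x\<in>bits n. if x \<in> ?K then 2 ^ l else 0)"
    unfolding pr by (intro sum.cong refl) auto
  also have "\<dots> = (\<Sum>x\<in>?K. 2 ^ l)"
    by (intro sum.mono_neutral_cong_right) auto
  finally have 1: "(\<Sum>x\<in>bits n. \<Prod>i<l. chi (t i x) + 1) = real (card ?K) * 2 ^ l" by simp
  have "(\<Sum>x\<in>bits n. \<Prod>i<l. chi (t i x) + 1) = (\<Sum>x\<in>bits n. \<Sum>S\<in>Pow {..<l}. chi (\<Sum>i\<in>S. t i x))"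
    by (simp add: prod_add chi_sum)
  also have "\<dots> = (\<Sum>S\<in>Pow {..<l}. \<Sum>x\<in>bits n. chi (\<Sum>i\<in>S. t i x))"
    by (rule sum.swap)
  also have "\<dots> = (\<Sum>S\<in>Pow {..<l}. if S = {} then 2 ^ n else 0)"
  proof (rule sum.cong[OF refl])
    fix S assume S: "S \<in> Pow {..<l}"
    show "(\<Sum>x\<in>bits n. chi (\<Sum>i\<in>S. t i x)) = (if S = {} then 2 ^ n else 0)"
    proof (cases "S = {}")
      case False
      then obtain j where j: "j < n" "(\<Sum>i\<in>S. u i j) \<noteq> 0" using u S by blast
      have "(\<Sum>i\<in>S. t i x) = (\<Sum>j<n. (\<Sum>i\<in>S. u i j) * x ! j)" for x
        unfolding t_def sum_distrib_right by (rule sum.swap)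
      thus ?thesis using sum_chi_linear[where v = "\<lambda>j. \<Sum>i\<in>S. u i j", OF j] False by simp
    qed (simp add: chi_def)
  qed
  also have "\<dots> = 2 ^ n" by simp
  finally have "real (card ?K * 2 ^ l) = real (2 ^ n)" using 1 by simp
  thus ?thesis unfolding t_def by (simp only: of_nat_eq_iff)
qed

section \<open>Exact collision counts for either argument of the hash\<close>

lemma E_D_bits [simp]: "E_D A n l x y \<in> bits l"
  by (simp add: E_D_def bits_def)

lemma E_D_nth:
  assumes "i < l" "A n i \<in> carrier_mat n n" "x \<in> bits n" "y \<in> bits n"
  shows "E_D A n l x y ! i = (\<Sum>r<n. (\<Sum>j<n. A n i $$ (r, j) * x ! j) * y ! r)"
  using assms by (auto simp: E_D_def scalar_prod_def bits_def vec_of_list_index lessThan_atLeast0 intro!: sum.cong)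

lemma bit_eq_iff_add: "(a = b) = (a + b = (0 :: bit))"
  by (cases a; cases b) (auto simp: add_bit_eq_xor)

lemma E_D_eq_iff:
  assumes "\<And>i. i < l \<Longrightarrow> A n i \<in> carrier_mat n n"
    and "x \<in> bits n" "x' \<in> bits n" "y \<in> bits n" "y' \<in> bits n"
  shows "E_D A n l x y = E_D A n l x' y' \<longleftrightarrow>
    (\<forall>i<l. (\<Sum>r<n. (\<Sum>j<n. A n i $$ (r, j) * x ! j) * y ! r) = (\<Sum>r<n. (\<Sum>j<n. A n i $$ (r, j) * x' ! j) * y' ! r))"
  using assms E_D_bits[of A n l x y] E_D_bits[of A n l x' y']
  by (auto simp: list_eq_iff_nth_eq E_D_nth bits_def)

context
  fixes A :: "nat \<Rightarrow> nat \<Rightarrow> bit mat" and n l :: nat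
  assumes A: "deor_matrices A" and n: "1 \<le> n" and l: "l \<le> n"
begin

lemma deor_carrier: "i < l \<Longrightarrow> A n i \<in> carrier_mat n n"
  using A n l by (auto simp: deor_matrices_def)

text \<open>Full rank makes both the sum of the matrices and its transpose injective. The matrix
  itself handles differences of \<open>x\<close>, the transpose differences of \<open>y\<close>;
  both are wanted because either source may be fed to the seeded extractor.\<close>

lemma deor_sum_injective:
  assumes S: "S \<subseteq> {..<l}" "S \<noteq> {}" and w: "\<exists>j<n. w j \<noteq> 0"
  shows "\<exists>r<n. (\<Sum>i\<in>S. \<Sum>j<n. A n i $$ (r, j) * w j) \<noteq> 0"
    and "\<exists>j<n. (\<Sum>i\<in>S. \<Sum>r<n. A n i $$ (r, j) * w r) \<noteq> 0"
proof -
  let ?B = "mat_sum n (A n) S"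
  have B: "?B \<in> carrier_mat n n" by (simp add: mat_sum_def)
  have "S \<subseteq> {..<n}" using S l by auto
  hence "vec_space.rank n ?B = n" using A n S(2) by (auto simp: deor_matrices_def)
  hence det: "det ?B \<noteq> 0" using vec_space.det_rank_iff[OF B] by simp
  hence detT: "det ?B\<^sup>T \<noteq> 0" by (simp add: det_transpose[OF B])
  have wv: "vec n w \<noteq> 0\<^sub>v n" using w by (auto simp: vec_eq_iff)
  have wc: "vec n w \<in> carrier_vec n" by simp
  have "(?B *\<^sub>v vec n w) $ r = (\<Sum>j<n. (\<Sum>i\<in>S. A n i $$ (r, j)) * w j)" if "r < n" for r
    using that by (simp add: mat_sum_def scalar_prod_def lessThan_atLeast0)
  hence e: "(?B *\<^sub>v vec n w) $ r = (\<Sum>i\<in>S. \<Sum>j<n. A n i $$ (r, j) * w j)" if "r < n" for r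
    unfolding sum_distrib_right using that by (subst sum.swap)
  have "?B *\<^sub>v vec n w \<noteq> 0\<^sub>v n"
    using det det_0_iff_vec_prod_zero[OF B] wv wc by blast
  then obtain r where "r < n" "(?B *\<^sub>v vec n w) $ r \<noteq> 0" using B by (auto simp: vec_eq_iff)
  thus "\<exists>r<n. (\<Sum>i\<in>S. \<Sum>j<n. A n i $$ (r, j) * w j) \<noteq> 0" using e[of r] by auto
  have "(?B\<^sup>T *\<^sub>v vec n w) $ r = (\<Sum>j<n. (\<Sum>i\<in>S. A n i $$ (j, r)) * w j)" if "r < n" for r
    using that by (simp add: mat_sum_def scalar_prod_def lessThan_atLeast0)
  hence e': "(?B\<^sup>T *\<^sub>v vec n w) $ r = (\<Sum>i\<in>S. \<Sum>j<n. A n i $$ (j, r) * w j)" if "r < n" for r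
    unfolding sum_distrib_right using that by (subst sum.swap)
  have "?B\<^sup>T *\<^sub>v vec n w \<noteq> 0\<^sub>v n"
    using detT det_0_iff_vec_prod_zero[of "?B\<^sup>T" n] B wv wc transpose_carrier_mat by blast
  then obtain r where "r < n" "(?B\<^sup>T *\<^sub>v vec n w) $ r \<noteq> 0" using B by (auto simp: vec_eq_iff)
  thus "\<exists>j<n. (\<Sum>i\<in>S. \<Sum>r<n. A n i $$ (r, j) * w r) \<noteq> 0" using e'[of r] by auto
qed

lemma bits_neq:
  assumes "y \<in> bits n" "y' \<in> bits n" "y \<noteq> y'"
  shows "\<exists>j<n. y ! j + y' ! j \<noteq> (0 :: bit)"
  using assms by (auto simp: list_eq_iff_nth_eq bits_def bit_eq_iff_add[symmetric])

text \<open>By bilinearity a collision is a homogeneous system in \<open>x\<close> whose rows are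
  the transposes of the \<open>A n i\<close> applied to \<open>y + y'\<close>. A nonempty sum of
  rows is the transpose of a full-rank matrix applied to a nonzero vector, so the rows are
  independent.\<close>

lemma card_E_D_collision_right:
  assumes y: "y \<in> bits n" "y' \<in> bits n" "y \<noteq> y'"
  shows "card {x \<in> bits n. E_D A n l x y = E_D A n l x y'} * 2 ^ l = 2 ^ n"
proof -
  define u where "u i j = (\<Sum>r<n. A n i $$ (r, j) * (y ! r + y' ! r))" for i j
  have "(E_D A n l x y = E_D A n l x y') = (\<forall>i<l. (\<Sum>j<n. u i j * x ! j) = 0)" if "x \<in> bits n" for x
  proof -
    let ?s = "\<lambda>i y. \<Sum>r<n. (\<Sum>j<n. A n i $$ (r, j) * x ! j) * y ! r"
    have s: "?s i y + ?s i y' = (\<Sum>j<n. u i j * x ! j)" for i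
    proof -
      have "?s i y + ?s i y' = (\<Sum>r<n. (\<Sum>j<n. A n i $$ (r, j) * x ! j) * (y ! r + y' ! r))"
        by (simp only: distrib_left sum.distrib)
      also have "\<dots> = (\<Sum>j<n. \<Sum>r<n. A n i $$ (r, j) * x ! j * (y ! r + y' ! r))"
        unfolding sum_distrib_right by (rule sum.swap)
      also have "\<dots> = (\<Sum>j<n. u i j * x ! j)"
        unfolding u_def sum_distrib_right by (intro sum.cong refl) (simp only: mult_ac)
      finally show ?thesis .
    qed
    have "(?s i y = ?s i y') = ((\<Sum>j<n. u i j * x ! j) = 0)" for i
      unfolding s[symmetric] by (rule bit_eq_iff_add)
    moreover have "(E_D A n l x y = E_D A n l x y') = (\<forall>i<l. ?s i y = ?s i y')"
      by (rule E_D_eq_iff) (use deor_carrier that y in auto)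
    ultimately show ?thesis by (simp only:)
  qed
  hence "{x \<in> bits n. E_D A n l x y = E_D A n l x y'} = {x \<in> bits n. \<forall>i<l. (\<Sum>j<n. u i j * x ! j) = 0}"
    by blast
  moreover have "card {x \<in> bits n. \<forall>i<l. (\<Sum>j<n. u i j * x ! j) = 0} * 2 ^ l = 2 ^ n"
  proof (rule card_linear_system)
    fix S assume "S \<subseteq> {..<l}" "S \<noteq> {}"
    from deor_sum_injective(2)[OF this bits_neq[OF y]]
    show "\<exists>j<n. (\<Sum>i\<in>S. u i j) \<noteq> 0" by (simp only: u_def)
  qed
  ultimately show ?thesis by simp
qed

lemma card_E_D_collision_left:
  assumes x: "x \<in> bits n" "x' \<in> bits n" "x \<noteq> x'"
  shows "card {y \<in> bits n. E_D A n l x y = E_D A n l x' y} * 2 ^ l = 2 ^ n"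
proof -
  define u where "u i r = (\<Sum>j<n. A n i $$ (r, j) * (x ! j + x' ! j))" for i r
  have "(E_D A n l x y = E_D A n l x' y) = (\<forall>i<l. (\<Sum>r<n. u i r * y ! r) = 0)" if "y \<in> bits n" for y
  proof -
    let ?s = "\<lambda>i x. \<Sum>r<n. (\<Sum>j<n. A n i $$ (r, j) * x ! j) * y ! r"
    have s: "?s i x + ?s i x' = (\<Sum>r<n. u i r * y ! r)" for i
      by (simp only: u_def distrib_left distrib_right sum.distrib)
    have "(?s i x = ?s i x') = ((\<Sum>r<n. u i r * y ! r) = 0)" for i
      unfolding s[symmetric] by (rule bit_eq_iff_add)
    moreover have "(E_D A n l x y = E_D A n l x' y) = (\<forall>i<l. ?s i x = ?s i x')"
      by (rule E_D_eq_iff) (use deor_carrier that x in auto)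
    ultimately show ?thesis by (simp only:)
  qed
  hence "{y \<in> bits n. E_D A n l x y = E_D A n l x' y} = {y \<in> bits n. \<forall>i<l. (\<Sum>r<n. u i r * y ! r) = 0}"
    by blast
  moreover have "card {y \<in> bits n. \<forall>i<l. (\<Sum>r<n. u i r * y ! r) = 0} * 2 ^ l = 2 ^ n"
  proof (rule card_linear_system)
    fix S assume "S \<subseteq> {..<l}" "S \<noteq> {}"
    from deor_sum_injective(1)[OF this bits_neq[OF x]]
    show "\<exists>j<n. (\<Sum>i\<in>S. u i j) \<noteq> 0" by (simp only: u_def)
  qed
  ultimately show ?thesis by simp
qed

end

section \<open>Two-source extraction\<close>

lemma bits_append_bij: "bij_betw (\<lambda>(v, s). v @ s) (bits d \<times> bits s) (bits (d + s))"
  by (rule bij_betw_byWitness[where f' = "\<lambda>u. (take d u, drop d u)"]) (auto simp: bits_def)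

lemma sum_bits_append: "(\<Sum>u\<in>bits (d + s). f u) = (\<Sum>v\<in>bits d. \<Sum>w\<in>bits s. f (v @ w))"
  unfolding sum.reindex_bij_betw[OF bits_append_bij, symmetric] sum.cartesian_product
  by (simp add: case_prod_beta)

lemma sum_bits_take:
  assumes "m \<le> M"
  shows "(\<Sum>t\<in>bits M. f (take m t)) = 2 ^ (M - m) * (\<Sum>z\<in>bits m. f z :: complex)"
proof -
  have "(\<Sum>t\<in>bits (m + (M - m)). f (take m t)) = (\<Sum>z\<in>bits m. \<Sum>w\<in>bits (M - m). f z)"
    unfolding sum_bits_append by (intro sum.cong refl) (simp add: bits_def)
  thus ?thesis using assms by (simp add: sum_distrib_left)
qed

lemma sum_pmf_bits: "source n k X \<Longrightarrow> (\<Sum>x\<in>bits n. pmf X x) = 1"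
  by (rule sum_pmf_eq_1) (auto simp: source_def)

lemma source_le: "source n k X \<Longrightarrow> k' \<le> k \<Longrightarrow> source n k' X"
  unfolding source_def by (meson order_trans powr_mono neg_le_iff_le one_le_numeral)

lemma storage_density: "storage n b \<rho> \<Longrightarrow> x \<in> bits n \<Longrightarrow> density b (\<rho> x)"
  by (simp add: storage_def)

lemma density_carrier: "density b \<rho> \<Longrightarrow> \<rho> \<in> carrier_mat (2 ^ b) (2 ^ b)"
  and density_herm: "density b \<rho> \<Longrightarrow> herm (2 ^ b) (ent \<rho>)"
  by (auto simp: density_def psd_iff)

text \<open>The indicator of the hash value minus its uniform mean. The pair (x, u) is one index
  because the variance is summed over both.\<close>

definition centred :: "nat \<Rightarrow> (bit list \<Rightarrow> bit list \<Rightarrow> bit list) \<Rightarrow> bit list \<times> bit list \<Rightarrow> bit list \<Rightarrow> real" where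
  "centred l H = (\<lambda>(x, u) y. of_bool (H x y = u) - 1 / 2 ^ l)"

text \<open>The sum over \<open>u\<close> leaves the collision indicator minus 2^-l; summed over
  \<open>x\<close>, the exact count makes this zero for distinct arguments.\<close>

lemma sum_centred_mult:
  assumes H: "\<And>x y. x \<in> bits n \<Longrightarrow> y \<in> bits n \<Longrightarrow> H x y \<in> bits l"
    and coll: "\<And>y y'. y \<in> bits n \<Longrightarrow> y' \<in> bits n \<Longrightarrow> y \<noteq> y' \<Longrightarrow>
      card {x \<in> bits n. H x y = H x y'} * 2 ^ l = 2 ^ n"
    and y: "y \<in> bits n" "y' \<in> bits n"
  shows "(\<Sum>j\<in>bits n \<times> bits l. centred l H j y * centred l H j y') = (if y = y' then 2 ^ n - 2 ^ n / 2 ^ l else 0)"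
proof -
  have u: "(\<Sum>u\<in>bits l. centred l H (x, u) y * centred l H (x, u) y') = of_bool (H x y = H x y') - 1 / 2 ^ l"
    if x: "x \<in> bits n" for x
  proof -
    have "(\<Sum>u\<in>bits l. centred l H (x, u) y * centred l H (x, u) y') =
      (\<Sum>u\<in>bits l. (if u = H x y then of_bool (H x y = H x y') else 0) - (if u = H x y then 1 / 2 ^ l else 0)
         - (if u = H x y' then 1 / 2 ^ l else 0) + 1 / 2 ^ l * (1 / 2 ^ l))"
      by (intro sum.cong refl) (auto simp: centred_def algebra_simps)
    also have "\<dots> = of_bool (H x y = H x y') - 1 / 2 ^ l"
      unfolding sum.distrib sum_subtractf using H[OF x y(1)] H[OF x y(2)] by simp
    finally show ?thesis .
  qed
  have "(\<Sum>j\<in>bits n \<times> bits l. centred l H j y * centred l H j y') =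
      (\<Sum>x\<in>bits n. \<Sum>u\<in>bits l. centred l H (x, u) y * centred l H (x, u) y')"
    by (simp add: sum.cartesian_product case_prod_beta)
  also have "\<dots> = (\<Sum>x\<in>bits n. of_bool (H x y = H x y') - 1 / 2 ^ l)"
    by (intro sum.cong refl) (rule u)
  also have "\<dots> = real (card {x \<in> bits n. H x y = H x y'}) - 2 ^ n / 2 ^ l"
    by (simp add: sum_subtractf Int_def)
  also have "\<dots> = (if y = y' then 2 ^ n - 2 ^ n / 2 ^ l else 0)"
  proof (cases "y = y'")
    case False
    have "real (card {x \<in> bits n. H x y = H x y'} * 2 ^ l) = real (2 ^ n)"
      using coll[OF y False] by simp
    thus ?thesis using False by (simp add: field_simps)
  qed simp
  finally show ?thesis .
qed

text \<open>Pairwise collision probabilities of exactly \<open>2\<^sup>-\<^sup>l\<close> make the cross terms cancel.\<close>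

lemma centred_variance:
  assumes H: "\<And>x y. x \<in> bits n \<Longrightarrow> y \<in> bits n \<Longrightarrow> H x y \<in> bits l"
    and coll: "\<And>y y'. y \<in> bits n \<Longrightarrow> y' \<in> bits n \<Longrightarrow> y \<noteq> y' \<Longrightarrow>
      card {x \<in> bits n. H x y = H x y'} * 2 ^ l = 2 ^ n"
  shows "(\<Sum>j\<in>bits n \<times> bits l. (cmod (\<Sum>y\<in>bits n. of_real (centred l H j y) * a y))\<^sup>2)
    \<le> 2 ^ n * (\<Sum>y\<in>bits n. (cmod (a y))\<^sup>2)"
proof -
  let ?J = "bits n \<times> bits l" and ?e = "centred l H"
  have "of_real (\<Sum>j\<in>?J. (cmod (\<Sum>y\<in>bits n. of_real (?e j y) * a y))\<^sup>2) =
     (\<Sum>j\<in>?J. (\<Sum>y\<in>bits n. of_real (?e j y) * a y) * (\<Sum>y'\<in>bits n. of_real (?e j y') * cnj (a y')))"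
    unfolding of_real_sum complex_norm_square by simp
  also have "\<dots> = (\<Sum>j\<in>?J. \<Sum>y\<in>bits n. \<Sum>y'\<in>bits n. of_real (?e j y * ?e j y') * (a y * cnj (a y')))"
    unfolding sum_product by (intro sum.cong refl) (simp add: mult_ac)
  also have "\<dots> = (\<Sum>y\<in>bits n. \<Sum>j\<in>?J. \<Sum>y'\<in>bits n. of_real (?e j y * ?e j y') * (a y * cnj (a y')))"
    by (rule sum.swap)
  also have "\<dots> = (\<Sum>y\<in>bits n. \<Sum>y'\<in>bits n. \<Sum>j\<in>?J. of_real (?e j y * ?e j y') * (a y * cnj (a y')))"
    by (rule sum.cong[OF refl], rule sum.swap)
  also have "\<dots> = (\<Sum>y\<in>bits n. \<Sum>y'\<in>bits n. of_real (\<Sum>j\<in>?J. ?e j y * ?e j y') * (a y * cnj (a y')))"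
    by (simp only: of_real_sum sum_distrib_right)
  also have "\<dots> = (\<Sum>y\<in>bits n. \<Sum>y'\<in>bits n. if y' = y then of_real (2 ^ n - 2 ^ n / 2 ^ l) * (a y * cnj (a y)) else 0)"
    by (intro sum.cong refl) (use sum_centred_mult[of n H l, OF H coll] in auto)
  also have "\<dots> = of_real ((2 ^ n - 2 ^ n / 2 ^ l) * (\<Sum>y\<in>bits n. (cmod (a y))\<^sup>2))"
    unfolding of_real_mult of_real_sum complex_norm_square sum_distrib_left by simp
  finally have "(\<Sum>j\<in>?J. (cmod (\<Sum>y\<in>bits n. of_real (?e j y) * a y))\<^sup>2)
      = (2 ^ n - 2 ^ n / 2 ^ l) * (\<Sum>y\<in>bits n. (cmod (a y))\<^sup>2)"
    by (simp only: of_real_eq_iff)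
  also have "\<dots> \<le> 2 ^ n * (\<Sum>y\<in>bits n. (cmod (a y))\<^sup>2)"
    by (intro mult_right_mono sum_nonneg) auto
  finally show ?thesis .
qed

text \<open>The exponent collects three square roots: 2^b from the tests, 2^l from the number of
  hash values, and 2^(n - k1 - k2) from the variance under the two min-entropies.\<close>

lemma hash_bound:
  assumes X: "source n k1 X" and Y: "source n k2 Y" and \<sigma>: "storage n b \<sigma>"
    and H: "\<And>x y. x \<in> bits n \<Longrightarrow> y \<in> bits n \<Longrightarrow> H x y \<in> bits l"
    and coll: "\<And>y y'. y \<in> bits n \<Longrightarrow> y' \<in> bits n \<Longrightarrow> y \<noteq> y' \<Longrightarrow>
      card {x \<in> bits n. H x y = H x y'} * 2 ^ l = 2 ^ n"
    and P: "\<And>x u. x \<in> bits n \<Longrightarrow> u \<in> bits l \<Longrightarrow> contraction (2 ^ b) (P x u)"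
  shows "cmod (\<Sum>x\<in>bits n. \<Sum>y\<in>bits n. of_real (pmf X x * pmf Y y) *
     (fn_trace (2 ^ b) (P x (H x y)) (ent (\<sigma> y)) - (\<Sum>u\<in>bits l. fn_trace (2 ^ b) (P x u) (ent (\<sigma> y))) / 2 ^ l))
   \<le> 2 powr ((real b + real l + real n - k1 - k2) / 2)" (is "cmod ?L \<le> _")
proof -
  let ?d = "2 ^ b :: nat" and ?J = "bits n \<times> bits l" and ?e = "centred l H"
  define D where "D j r c = (\<Sum>y\<in>bits n. of_real (?e j y) * (of_real (pmf Y y) * ent (\<sigma> y) r c))" for j r c
  have inner: "(\<Sum>y\<in>bits n. of_real (pmf Y y) *
     (fn_trace ?d (P x (H x y)) (ent (\<sigma> y)) - (\<Sum>u\<in>bits l. fn_trace ?d (P x u) (ent (\<sigma> y))) / 2 ^ l))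
     = (\<Sum>u\<in>bits l. fn_trace ?d (P x u) (D (x, u)))" if x: "x \<in> bits n" for x
  proof -
    have "(\<Sum>u\<in>bits l. fn_trace ?d (P x u) (D (x, u))) =
      (\<Sum>u\<in>bits l. \<Sum>y\<in>bits n. of_real (?e (x, u) y * pmf Y y) * fn_trace ?d (P x u) (ent (\<sigma> y)))"
      unfolding D_def fn_trace_sum_right[symmetric] by (simp only: of_real_mult mult.assoc)
    also have "\<dots> = (\<Sum>y\<in>bits n. \<Sum>u\<in>bits l. of_real (?e (x, u) y * pmf Y y) * fn_trace ?d (P x u) (ent (\<sigma> y)))"
      by (rule sum.swap)
    also have "\<dots> = (\<Sum>y\<in>bits n. of_real (pmf Y y) *
     (fn_trace ?d (P x (H x y)) (ent (\<sigma> y)) - (\<Sum>u\<in>bits l. fn_trace ?d (P x u) (ent (\<sigma> y))) / 2 ^ l))"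
    proof (rule sum.cong[OF refl])
      fix y assume y: "y \<in> bits n"
      let ?t = "\<lambda>u. fn_trace ?d (P x u) (ent (\<sigma> y))"
      have "(\<Sum>u\<in>bits l. of_real (?e (x, u) y * pmf Y y) * ?t u) =
        (\<Sum>u\<in>bits l. of_real (pmf Y y) * ((if u = H x y then ?t u else 0) - ?t u / 2 ^ l))"
        by (intro sum.cong refl) (auto simp: centred_def algebra_simps)
      also have "\<dots> = of_real (pmf Y y) * (?t (H x y) - (\<Sum>u\<in>bits l. ?t u) / 2 ^ l)"
        unfolding sum_distrib_left[symmetric] sum_subtractf sum_divide_distrib[symmetric]
        using H[OF x y] by simp
      finally show "(\<Sum>u\<in>bits l. of_real (?e (x, u) y * pmf Y y) * ?t u) =
        of_real (pmf Y y) * (?t (H x y) - (\<Sum>u\<in>bits l. ?t u) / 2 ^ l)" .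
    qed
    finally show ?thesis ..
  qed
  have "?L = (\<Sum>x\<in>bits n. of_real (pmf X x) * (\<Sum>u\<in>bits l. fn_trace ?d (P x u) (D (x, u))))"
    by (intro sum.cong refl) (simp add: inner[symmetric] sum_distrib_left mult.assoc)
  also have "\<dots> = (\<Sum>j\<in>?J. of_real (pmf X (fst j)) * fn_trace ?d (P (fst j) (snd j)) (D j))"
    by (simp add: sum_distrib_left sum.cartesian_product case_prod_beta)
  finally have L: "?L = (\<Sum>j\<in>?J. of_real (pmf X (fst j)) * fn_trace ?d (P (fst j) (snd j)) (D j))" .
  \<comment> \<open>\<open>centred_variance\<close> is applied to every matrix entry separately.
    What remains is the sum of the squared probabilities of \<open>Y\<close>, since densities have
    Hilbert-Schmidt norm at most one.\<close>
  have hs: "(\<Sum>j\<in>?J. (hs_norm ?d (D j))\<^sup>2) \<le> 2 ^ n * 2 powr (- k2)"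
  proof -
    have "(\<Sum>j\<in>?J. (hs_norm ?d (D j))\<^sup>2) = (\<Sum>r<?d. \<Sum>j\<in>?J. \<Sum>c<?d. (cmod (D j r c))\<^sup>2)"
      unfolding hs_norm_sq by (rule sum.swap)
    also have "\<dots> = (\<Sum>r<?d. \<Sum>c<?d. \<Sum>j\<in>?J. (cmod (D j r c))\<^sup>2)"
      by (rule sum.cong[OF refl], rule sum.swap)
    also have "\<dots> \<le> (\<Sum>r<?d. \<Sum>c<?d. 2 ^ n * (\<Sum>y\<in>bits n. (cmod (of_real (pmf Y y) * ent (\<sigma> y) r c))\<^sup>2))"
      unfolding D_def by (intro sum_mono centred_variance[OF H coll]) auto
    also have "\<dots> = 2 ^ n * (\<Sum>r<?d. \<Sum>c<?d. \<Sum>y\<in>bits n. (pmf Y y)\<^sup>2 * (cmod (ent (\<sigma> y) r c))\<^sup>2)"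
      by (simp add: sum_distrib_left norm_mult power_mult_distrib)
    also have "(\<Sum>r<?d. \<Sum>c<?d. \<Sum>y\<in>bits n. (pmf Y y)\<^sup>2 * (cmod (ent (\<sigma> y) r c))\<^sup>2)
      = (\<Sum>r<?d. \<Sum>y\<in>bits n. \<Sum>c<?d. (pmf Y y)\<^sup>2 * (cmod (ent (\<sigma> y) r c))\<^sup>2)"
      by (rule sum.cong[OF refl], rule sum.swap)
    also have "\<dots> = (\<Sum>y\<in>bits n. \<Sum>r<?d. \<Sum>c<?d. (pmf Y y)\<^sup>2 * (cmod (ent (\<sigma> y) r c))\<^sup>2)"
      by (rule sum.swap)
    also have "\<dots> = (\<Sum>y\<in>bits n. (pmf Y y)\<^sup>2 * (hs_norm ?d (ent (\<sigma> y)))\<^sup>2)"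
      by (simp only: hs_norm_sq sum_distrib_left)
    also have "\<dots> \<le> (\<Sum>y\<in>bits n. pmf Y y * 2 powr (- k2))"
    proof (rule sum_mono)
      fix y assume y: "y \<in> bits n"
      have "hs_norm ?d (ent (\<sigma> y)) \<le> 1" by (rule density_hs_norm_le[OF storage_density[OF \<sigma> y]])
      hence "(hs_norm ?d (ent (\<sigma> y)))\<^sup>2 \<le> 1" by (simp add: power_le_one)
      hence "(pmf Y y)\<^sup>2 * (hs_norm ?d (ent (\<sigma> y)))\<^sup>2 \<le> (pmf Y y)\<^sup>2" by (simp add: mult_left_le)
      also have "\<dots> \<le> pmf Y y * 2 powr (- k2)"
        unfolding power2_eq_square using Y by (intro mult_left_mono) (auto simp: source_def)
      finally show "(pmf Y y)\<^sup>2 * (hs_norm ?d (ent (\<sigma> y)))\<^sup>2 \<le> pmf Y y * 2 powr (- k2)" .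
    qed
    also have "\<dots> = 2 powr (- k2)"
      unfolding sum_distrib_right[symmetric] sum_pmf_bits[OF Y] by simp
    finally show ?thesis by (simp add: mult_left_mono)
  qed
  have "cmod ?L \<le> (\<Sum>j\<in>?J. pmf X (fst j) * (sqrt ?d * hs_norm ?d (D j)))"
    unfolding L
  proof (rule sum_norm_le)
    fix j assume "j \<in> ?J"
    hence "contraction ?d (P (fst j) (snd j))" using P by auto
    from fn_trace_contraction_le[OF this, of "D j"]
    show "cmod (of_real (pmf X (fst j)) * fn_trace ?d (P (fst j) (snd j)) (D j)) \<le> pmf X (fst j) * (sqrt ?d * hs_norm ?d (D j))"
      unfolding norm_mult by (simp add: mult_left_mono)
  qed
  \<comment> \<open>The weight \<open>pmf X\<close> is split into two roots. One sums to the total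
    mass; the other is bounded through the min-entropy, which passes from \<open>X\<close> to the
    uniform count over all \<open>x\<close> for which the variance is known.\<close>
  also have "\<dots> = sqrt ?d * (\<Sum>j\<in>?J. \<bar>sqrt (pmf X (fst j))\<bar> * \<bar>sqrt (pmf X (fst j)) * hs_norm ?d (D j)\<bar>)"
    unfolding sum_distrib_left by (intro sum.cong refl) (simp add: abs_mult)
  also have "\<dots> \<le> sqrt ?d * (L2_set (\<lambda>j. sqrt (pmf X (fst j))) ?J * L2_set (\<lambda>j. sqrt (pmf X (fst j)) * hs_norm ?d (D j)) ?J)"
    by (intro mult_left_mono L2_set_mult_ineq) simp
  also have "L2_set (\<lambda>j. sqrt (pmf X (fst j))) ?J = sqrt (2 ^ l)"
  proof -
    have "(\<Sum>j\<in>?J. pmf X (fst j)) = (\<Sum>x\<in>bits n. \<Sum>u\<in>bits l. pmf X x)"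
      by (simp only: sum.cartesian_product case_prod_unfold)
    also have "\<dots> = 2 ^ l" by (simp add: sum_distrib_left[symmetric] sum_pmf_bits[OF X])
    finally show ?thesis by (simp add: L2_set_def)
  qed
  also have "L2_set (\<lambda>j. sqrt (pmf X (fst j)) * hs_norm ?d (D j)) ?J \<le> sqrt (2 powr (- k1) * (2 ^ n * 2 powr (- k2)))"
    unfolding L2_set_def
  proof (rule real_sqrt_le_mono)
    have "(\<Sum>j\<in>?J. (sqrt (pmf X (fst j)) * hs_norm ?d (D j))\<^sup>2) \<le> (\<Sum>j\<in>?J. 2 powr (- k1) * (hs_norm ?d (D j))\<^sup>2)"
      using X by (intro sum_mono) (auto simp: power_mult_distrib source_def intro!: mult_right_mono)
    also have "\<dots> \<le> 2 powr (- k1) * (2 ^ n * 2 powr (- k2))"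
      unfolding sum_distrib_left[symmetric] using hs by (intro mult_left_mono) auto
    finally show "(\<Sum>j\<in>?J. (sqrt (pmf X (fst j)) * hs_norm ?d (D j))\<^sup>2) \<le> 2 powr (- k1) * (2 ^ n * 2 powr (- k2))" .
  qed
  also have "sqrt ?d * (sqrt (2 ^ l) * sqrt (2 powr (- k1) * (2 ^ n * 2 powr (- k2)))) =
     2 powr ((real b + real l + real n - k1 - k2) / 2)"
  proof -
    have "sqrt ?d * (sqrt (2 ^ l) * sqrt (2 powr (- k1) * (2 ^ n * 2 powr (- k2)))) =
      sqrt (2 powr b * (2 powr l * (2 powr (- k1) * (2 powr n * 2 powr (- k2)))))"
      by (simp add: real_sqrt_mult powr_realpow)
    also have "2 powr b * (2 powr l * (2 powr (- k1) * (2 powr n * 2 powr (- k2)))) = 2 powr (real b + real l + real n - k1 - k2)"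
      by (simp flip: powr_add add: algebra_simps)
    also have "sqrt \<dots> = 2 powr ((real b + real l + real n - k1 - k2) / 2)"
      by (simp add: powr_half_sqrt[symmetric] powr_powr)
    finally show ?thesis .
  qed
  finally show ?thesis by (simp add: mult_left_mono)
qed

section \<open>The seeded extractor under tests\<close>

lemma seeded_bound:
  assumes F: "seeded_extractor n d m k \<epsilon> b F" and X: "source n k X" and \<rho>: "storage n b \<rho>"
    and W: "\<And>w. w \<in> bits m \<Longrightarrow> contraction (2 ^ b) (W w)"
  shows "cmod (\<Sum>x\<in>bits n. of_real (pmf X x) *
    ((\<Sum>v\<in>bits d. fn_trace (2 ^ b) (W (F x v)) (ent (\<rho> x))) / 2 ^ d
      - (\<Sum>w\<in>bits m. fn_trace (2 ^ b) (W w) (ent (\<rho> x))) / 2 ^ m)) \<le> 2 * \<epsilon>" (is "cmod ?L \<le> _")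
proof -
  let ?I = "bits n \<times> bits d" and ?D = "2 ^ b :: nat"
  define p where "p = (\<lambda>(x :: bit list, u :: bit list). pmf X x / 2 ^ d)"
  define z where "z = (\<lambda>(x, u). F x u)"
  define \<tau> where "\<tau> = (\<lambda>(x :: bit list, u :: bit list). \<rho> x)"
  define S where "S = mat_sum ?D (\<lambda>x. complex_of_real (pmf X x) \<cdot>\<^sub>m \<rho> x) (bits n)"
  note dens = storage_density[OF \<rho>]
  have z: "z i \<in> bits m" if "i \<in> ?I" for i
    using F that by (auto simp: z_def seeded_extractor_def)
  have t1: "\<tau> i \<in> carrier_mat ?D ?D" and t2: "herm ?D (ent (\<tau> i))" if "i \<in> ?I" for i
    using that density_carrier[OF dens] density_herm[OF dens] by (auto simp: \<tau>_def)
  have S1: "S \<in> carrier_mat ?D ?D" by (simp add: S_def mat_sum_def)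
  have S2: "S $$ (r, c) = (\<Sum>i\<in>?I. of_real (p i) * ent (\<tau> i) r c)" if "r < ?D" "c < ?D" for r c
  proof -
    have "(\<Sum>i\<in>?I. of_real (p i) * ent (\<tau> i) r c) = (\<Sum>x\<in>bits n. \<Sum>u\<in>bits d. of_real (pmf X x / 2 ^ d) * ent (\<rho> x) r c)"
      by (simp only: sum.cartesian_product case_prod_unfold p_def \<tau>_def)
    also have "\<dots> = (\<Sum>x\<in>bits n. of_real (pmf X x) * ent (\<rho> x) r c)" by simp
    also have "\<dots> = S $$ (r, c)"
      unfolding S_def mat_sum_def using that carrier_matD[OF density_carrier[OF dens]]
      by (auto simp: ent_def intro!: sum.cong)
    finally show ?thesis ..
  qed
  have "tr_norm (cq_diff m ?D p z \<tau> ?I S) \<le> \<epsilon>"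
  proof -
    have "(\<lambda>i. complex_of_real (p i) \<cdot>\<^sub>m (ket_bra (z i) \<otimes>\<^sub>M \<tau> i)) =
      (\<lambda>(x, u). complex_of_real (pmf X x / 2 ^ d) \<cdot>\<^sub>m (ket_bra (F x u) \<otimes>\<^sub>M \<rho> x))"
      by (simp add: fun_eq_iff p_def z_def \<tau>_def)
    thus ?thesis using F X \<rho> by (simp add: cq_diff_def seeded_extractor_def S_def)
  qed
  moreover have "cmod (\<Sum>i\<in>?I. of_real (p i) * (fn_trace ?D (W (z i)) (ent (\<tau> i))
        - (\<Sum>w\<in>bits m. fn_trace ?D (W w) (ent (\<tau> i))) / 2 ^ m)) \<le> 2 * tr_norm (cq_diff m ?D p z \<tau> ?I S)"
    by (rule cq_diff_ge[OF z t1 t2 S1 S2 W])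
  moreover have "(\<Sum>i\<in>?I. of_real (p i) * (fn_trace ?D (W (z i)) (ent (\<tau> i))
        - (\<Sum>w\<in>bits m. fn_trace ?D (W w) (ent (\<tau> i))) / 2 ^ m)) = ?L"
  proof -
    have "(\<Sum>i\<in>?I. of_real (p i) * (fn_trace ?D (W (z i)) (ent (\<tau> i))
        - (\<Sum>w\<in>bits m. fn_trace ?D (W w) (ent (\<tau> i))) / 2 ^ m)) =
      (\<Sum>x\<in>bits n. \<Sum>v\<in>bits d. of_real (pmf X x / 2 ^ d) * (fn_trace ?D (W (F x v)) (ent (\<rho> x))
        - (\<Sum>w\<in>bits m. fn_trace ?D (W w) (ent (\<rho> x))) / 2 ^ m))"
      by (simp add: sum.cartesian_product case_prod_beta p_def \<tau>_def z_def)
    also have "\<dots> = ?L"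
      unfolding sum_distrib_left[symmetric] sum_subtractf by (intro sum.cong refl) (simp add: field_simps)
    finally show ?thesis .
  qed
  ultimately show ?thesis by simp
qed

text \<open>Surplus seed bits and truncation both move into the test: \<open>W\<close> averages
  \<open>Q\<close> over the surplus. If the extractor output is uniform, so is its concatenation
  with the surplus, and so is every prefix, hence the ideal terms agree as well.\<close>

lemma surplus_bound:
  assumes F: "seeded_extractor n d m' k \<epsilon> b F" and X: "source n k X" and \<rho>: "storage n b \<rho>"
    and dl: "d \<le> l" and m: "m \<le> m' + (l - d)"
    and Q: "\<And>z. z \<in> bits m \<Longrightarrow> contraction (2 ^ b) (Q z)"
  shows "cmod (\<Sum>x\<in>bits n. of_real (pmf X x) *
    ((\<Sum>u\<in>bits l. fn_trace (2 ^ b) (Q (take m (copy_surplus d F x u))) (ent (\<rho> x))) / 2 ^ l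
      - (\<Sum>z\<in>bits m. fn_trace (2 ^ b) (Q z) (ent (\<rho> x))) / 2 ^ m)) \<le> 2 * \<epsilon>"
proof -
  define W where "W w = (\<lambda>r c. \<Sum>s\<in>bits (l - d). of_real (1 / 2 ^ (l - d)) * Q (take m (w @ s)) r c)" for w
  have W: "contraction (2 ^ b) (W w)" if "w \<in> bits m'" for w
    unfolding W_def
  proof (rule contraction_convex)
    show "contraction (2 ^ b) (Q (take m (w @ s)))" if "s \<in> bits (l - d)" for s
      using that \<open>w \<in> bits m'\<close> m by (intro Q) (simp add: bits_def)
  qed simp_all
  have W1: "(\<Sum>u\<in>bits l. fn_trace (2 ^ b) (Q (take m (copy_surplus d F x u))) A) / 2 ^ l
      = (\<Sum>v\<in>bits d. fn_trace (2 ^ b) (W (F x v)) A) / 2 ^ d" for x A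
  proof -
    have "(\<Sum>u\<in>bits (d + (l - d)). fn_trace (2 ^ b) (Q (take m (copy_surplus d F x u))) A) =
      (\<Sum>v\<in>bits d. \<Sum>s\<in>bits (l - d). fn_trace (2 ^ b) (Q (take m (F x v @ s))) A)"
      unfolding sum_bits_append by (intro sum.cong refl) (simp add: copy_surplus_def bits_def)
    also have "\<dots> = 2 ^ (l - d) * (\<Sum>v\<in>bits d. fn_trace (2 ^ b) (W (F x v)) A)"
      unfolding W_def fn_trace_sum_left sum_distrib_left by (simp add: field_simps)
    finally show ?thesis using dl by (simp add: field_simps power_add[symmetric])
  qed
  have W2: "(\<Sum>z\<in>bits m. fn_trace (2 ^ b) (Q z) A) / 2 ^ m = (\<Sum>w\<in>bits m'. fn_trace (2 ^ b) (W w) A) / 2 ^ m'" for A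
  proof -
    have "(\<Sum>w\<in>bits m'. fn_trace (2 ^ b) (W w) A) * 2 ^ (l - d) =
        (\<Sum>w\<in>bits m'. \<Sum>s\<in>bits (l - d). fn_trace (2 ^ b) (Q (take m (w @ s))) A)"
      unfolding W_def fn_trace_sum_left sum_distrib_right by (simp add: field_simps)
    also have "\<dots> = (\<Sum>t\<in>bits (m' + (l - d)). fn_trace (2 ^ b) (Q (take m t)) A)"
      by (rule sum_bits_append[symmetric])
    also have "\<dots> = 2 ^ (m' + (l - d) - m) * (\<Sum>z\<in>bits m. fn_trace (2 ^ b) (Q z) A)"
      by (rule sum_bits_take[OF m])
    finally have e: "(\<Sum>w\<in>bits m'. fn_trace (2 ^ b) (W w) A) * 2 ^ (l - d) =
      2 ^ (m' + (l - d) - m) * (\<Sum>z\<in>bits m. fn_trace (2 ^ b) (Q z) A)" .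
    \<comment> \<open>Each string of \<open>m\<close> bits is the prefix of 2^(m' + (l - d) - m)
      untruncated ones; the premise on \<open>m\<close> makes this natural subtraction
      exact.\<close>
    have "(2 :: complex) ^ m' * 2 ^ (l - d) = 2 ^ (m' + (l - d) - m) * 2 ^ m"
      using m by (simp add: power_add[symmetric])
    note p = this
    let ?s = "\<Sum>w\<in>bits m'. fn_trace (2 ^ b) (W w) A" and ?p = "2 ^ (m' + (l - d) - m) :: complex"
    have "?p * (?s * 2 ^ m) = ?s * (?p * 2 ^ m)" by (simp only: mult_ac)
    also have "\<dots> = ?s * (2 ^ m' * 2 ^ (l - d))" by (simp only: p)
    also have "\<dots> = (?s * 2 ^ (l - d)) * 2 ^ m'" by (simp only: mult_ac)
    also have "\<dots> = ?p * ((\<Sum>z\<in>bits m. fn_trace (2 ^ b) (Q z) A) * 2 ^ m')"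
      by (simp only: e mult.assoc)
    finally have "?p * (?s * 2 ^ m) = ?p * ((\<Sum>z\<in>bits m. fn_trace (2 ^ b) (Q z) A) * 2 ^ m')" .
    hence "(\<Sum>w\<in>bits m'. fn_trace (2 ^ b) (W w) A) * 2 ^ m = (\<Sum>z\<in>bits m. fn_trace (2 ^ b) (Q z) A) * 2 ^ m'"
      by (simp only: mult_cancel_left) simp
    thus ?thesis by (simp add: frac_eq_eq)
  qed
  show ?thesis
    unfolding W1 W2 by (rule seeded_bound[OF F X \<rho> W])
qed

text \<open>The storage of \<open>x\<close> and \<open>y\<close> can be traced out one at a time: replacing the hash by a uniform
  seed is tested on \<open>\<sigma> y\<close> for fixed \<open>x\<close>, and replacing the output by a uniform one on \<open>\<rho> x\<close>,
  averaged over \<open>y\<close>.\<close>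

lemma composition_bound:
  assumes X: "source n k1 X" and Y: "source n k2 Y" and \<rho>: "storage n b1 \<rho>" and \<sigma>: "storage n b2 \<sigma>"
    and F: "seeded_extractor n d m' k \<epsilon> b1 F" and k: "k \<le> k1"
    and dl: "d \<le> l" and m: "m \<le> m' + (l - d)"
    and H: "\<And>x y. x \<in> bits n \<Longrightarrow> y \<in> bits n \<Longrightarrow> H x y \<in> bits l"
    and coll: "\<And>y y'. y \<in> bits n \<Longrightarrow> y' \<in> bits n \<Longrightarrow> y \<noteq> y' \<Longrightarrow>
      card {x \<in> bits n. H x y = H x y'} * 2 ^ l = 2 ^ n"
    and P: "\<And>x z. x \<in> bits n \<Longrightarrow> z \<in> bits m \<Longrightarrow> contraction (2 ^ b2) (P x z)"
    and Q: "\<And>y z. y \<in> bits n \<Longrightarrow> z \<in> bits m \<Longrightarrow> contraction (2 ^ b1) (Q y z)"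
    and fP: "\<And>x y z. x \<in> bits n \<Longrightarrow> y \<in> bits n \<Longrightarrow> z \<in> bits m \<Longrightarrow> f x y z = fn_trace (2 ^ b2) (P x z) (ent (\<sigma> y))"
    and fQ: "\<And>x y z. x \<in> bits n \<Longrightarrow> y \<in> bits n \<Longrightarrow> z \<in> bits m \<Longrightarrow> f x y z = fn_trace (2 ^ b1) (Q y z) (ent (\<rho> x))"
  shows "cmod (\<Sum>x\<in>bits n. \<Sum>y\<in>bits n. of_real (pmf X x * pmf Y y) *
      (f x y (take m (copy_surplus d F x (H x y))) - (\<Sum>z\<in>bits m. f x y z) / 2 ^ m))
    \<le> 2 powr ((real b2 + real l + real n - k1 - k2) / 2) + 2 * \<epsilon>" (is "cmod ?L \<le> _")
proof -
  define G where "G x u = take m (copy_surplus d F x u)" for x u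
  have G: "G x u \<in> bits m" if "x \<in> bits n" "u \<in> bits l" for x u
    using F that dl m by (auto simp: G_def copy_surplus_def bits_def seeded_extractor_def)
  define A where "A = (\<Sum>x\<in>bits n. \<Sum>y\<in>bits n. of_real (pmf X x * pmf Y y) *
     (fn_trace (2 ^ b2) (P x (G x (H x y))) (ent (\<sigma> y)) - (\<Sum>u\<in>bits l. fn_trace (2 ^ b2) (P x (G x u)) (ent (\<sigma> y))) / 2 ^ l))"
  define R where "R z = (\<lambda>r c. \<Sum>y\<in>bits n. of_real (pmf Y y) * Q y z r c)" for z
  define B where "B = (\<Sum>x\<in>bits n. of_real (pmf X x) *
    ((\<Sum>u\<in>bits l. fn_trace (2 ^ b1) (R (G x u)) (ent (\<rho> x))) / 2 ^ l
      - (\<Sum>z\<in>bits m. fn_trace (2 ^ b1) (R z) (ent (\<rho> x))) / 2 ^ m))"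
  have A: "cmod A \<le> 2 powr ((real b2 + real l + real n - k1 - k2) / 2)"
    unfolding A_def by (rule hash_bound[OF X Y \<sigma> H coll]) (use P G in auto)
  have "cmod B \<le> 2 * \<epsilon>"
    unfolding B_def G_def
  proof (rule surplus_bound[OF F source_le[OF X k] \<rho> dl m])
    show "contraction (2 ^ b1) (R z)" if "z \<in> bits m" for z
      unfolding R_def by (rule contraction_convex) (use Q that sum_pmf_bits[OF Y] in auto)
  qed
  \<comment> \<open>The hybrid with a uniform seed, the mean of \<open>f x y (G x u)\<close> over
    \<open>u\<close>, occurs in both parts with opposite signs. \<open>A\<close> writes it with
    \<open>P\<close>, \<open>B\<close> with \<open>Q\<close>.\<close>
  moreover have "?L = A + B"
  proof -
    have "B = (\<Sum>x\<in>bits n. \<Sum>y\<in>bits n. of_real (pmf X x * pmf Y y) *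
       ((\<Sum>u\<in>bits l. f x y (G x u)) / 2 ^ l - (\<Sum>z\<in>bits m. f x y z) / 2 ^ m))"
    proof -
      have R: "fn_trace (2 ^ b1) (R z) (ent (\<rho> x)) = (\<Sum>y\<in>bits n. of_real (pmf Y y) * f x y z)"
        if "x \<in> bits n" "z \<in> bits m" for x z
        unfolding R_def fn_trace_sum_left using fQ that by simp
      have "(\<Sum>u\<in>bits l. fn_trace (2 ^ b1) (R (G x u)) (ent (\<rho> x))) / 2 ^ l
          - (\<Sum>z\<in>bits m. fn_trace (2 ^ b1) (R z) (ent (\<rho> x))) / 2 ^ m =
        (\<Sum>y\<in>bits n. of_real (pmf Y y) * ((\<Sum>u\<in>bits l. f x y (G x u)) / 2 ^ l - (\<Sum>z\<in>bits m. f x y z) / 2 ^ m))"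
        if x: "x \<in> bits n" for x
      proof -
        have s1: "(\<Sum>u\<in>bits l. fn_trace (2 ^ b1) (R (G x u)) (ent (\<rho> x))) =
          (\<Sum>y\<in>bits n. of_real (pmf Y y) * (\<Sum>u\<in>bits l. f x y (G x u)))"
        proof -
          have "(\<Sum>u\<in>bits l. fn_trace (2 ^ b1) (R (G x u)) (ent (\<rho> x))) =
            (\<Sum>u\<in>bits l. \<Sum>y\<in>bits n. of_real (pmf Y y) * f x y (G x u))"
            by (intro sum.cong refl R x G)
          also have "\<dots> = (\<Sum>y\<in>bits n. \<Sum>u\<in>bits l. of_real (pmf Y y) * f x y (G x u))" by (rule sum.swap)
          finally show ?thesis by (simp only: sum_distrib_left)
        qed
        have s2: "(\<Sum>z\<in>bits m. fn_trace (2 ^ b1) (R z) (ent (\<rho> x))) =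
          (\<Sum>y\<in>bits n. of_real (pmf Y y) * (\<Sum>z\<in>bits m. f x y z))"
        proof -
          have "(\<Sum>z\<in>bits m. fn_trace (2 ^ b1) (R z) (ent (\<rho> x))) =
            (\<Sum>z\<in>bits m. \<Sum>y\<in>bits n. of_real (pmf Y y) * f x y z)"
            by (intro sum.cong refl R x)
          also have "\<dots> = (\<Sum>y\<in>bits n. \<Sum>z\<in>bits m. of_real (pmf Y y) * f x y z)" by (rule sum.swap)
          finally show ?thesis by (simp only: sum_distrib_left)
        qed
        show ?thesis
          unfolding s1 s2 right_diff_distrib sum_subtractf
          by (simp only: times_divide_eq_right sum_divide_distrib[symmetric])
      qed
      thus ?thesis
        unfolding B_def by (intro sum.cong refl) (simp add: sum_distrib_left mult.assoc)
    qed
    moreover have "A = (\<Sum>x\<in>bits n. \<Sum>y\<in>bits n. of_real (pmf X x * pmf Y y) *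
        (f x y (G x (H x y)) - (\<Sum>u\<in>bits l. f x y (G x u)) / 2 ^ l))"
      unfolding A_def using fP G H by (intro sum.cong refl) simp
    ultimately show ?thesis
      unfolding G_def[symmetric] by (simp add: sum.distrib[symmetric] distrib_left[symmetric])
  qed
  ultimately show ?thesis using A norm_triangle_ineq[of A B] by simp
qed

section \<open>From scalar test bounds to the two-source distance\<close>

lemma tensor_carrier:
  "A \<in> carrier_mat r1 c1 \<Longrightarrow> B \<in> carrier_mat r2 c2 \<Longrightarrow> A \<otimes>\<^sub>M B \<in> carrier_mat (r1 * r2) (c1 * c2)"
  by (auto simp: tensor_mat_def)

lemma ent_tensor:
  assumes "A \<in> carrier_mat d1 d1" "B \<in> carrier_mat d2 d2" "I < d1 * d2" "J < d1 * d2"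
  shows "ent (A \<otimes>\<^sub>M B) I J = kron d2 (ent A) (ent B) I J"
  using assms by (auto simp: ent_def kron_def tensor_mat_def)

lemma herm_tensor:
  assumes A: "A \<in> carrier_mat d1 d1" "herm d1 (ent A)" and B: "B \<in> carrier_mat d2 d2" "herm d2 (ent B)"
  shows "herm (d1 * d2) (ent (A \<otimes>\<^sub>M B))"
proof (rule herm_cong[OF ent_tensor[OF A(1) B(1)]])
  show "herm (d1 * d2) (kron d2 (ent A) (ent B))"
    unfolding herm_def
  proof (intro allI impI)
    fix I J assume IJ: "I < d1 * d2" "J < d1 * d2"
    hence "0 < d2" by (cases d2) auto
    hence "I div d2 < d1" "J div d2 < d1" "I mod d2 < d2" "J mod d2 < d2"
      using IJ by (auto simp: less_mult_imp_div_less)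
    thus "kron d2 (ent A) (ent B) J I = cnj (kron d2 (ent A) (ent B) I J)"
      using hermD[OF A(2), of "J div d2" "I div d2"] hermD[OF B(2), of "J mod d2" "I mod d2"]
      by (simp add: kron_def)
  qed
qed

text \<open>The maximising tests depend on the sources and on the storage, so the scalar bound is
  demanded for every family of joint contractions. Naming the values \<open>f\<close> hides the
  matrices from \<open>composition_bound\<close>.\<close>

lemma two_source_extractorI:
  assumes E: "\<And>x y. x \<in> bits n \<Longrightarrow> y \<in> bits n \<Longrightarrow> E x y \<in> bits m"
    and bound: "\<And>X Y \<rho> \<sigma> V f. source n k1 X \<Longrightarrow> source n k2 Y \<Longrightarrow> storage n b1 \<rho> \<Longrightarrow> storage n b2 \<sigma> \<Longrightarrow>
      (\<And>z. z \<in> bits m \<Longrightarrow> contraction (2 ^ b1 * 2 ^ b2) (V z)) \<Longrightarrow>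
      f = (\<lambda>x y z. fn_trace (2 ^ b1 * 2 ^ b2) (V z) (kron (2 ^ b2) (ent (\<rho> x)) (ent (\<sigma> y)))) \<Longrightarrow>
      cmod (\<Sum>x\<in>bits n. \<Sum>y\<in>bits n. of_real (pmf X x * pmf Y y) *
        (f x y (E x y) - (\<Sum>z\<in>bits m. f x y z) / 2 ^ m)) \<le> 2 * \<epsilon>"
  shows "two_source_extractor n m k1 k2 \<epsilon> b1 b2 E"
  unfolding two_source_extractor_def
proof (intro conjI allI impI ballI E)
  fix X Y and \<rho> \<sigma> :: "bit list \<Rightarrow> complex mat"
  assume X: "source n k1 X" and Y: "source n k2 Y" and \<rho>: "storage n b1 \<rho>" and \<sigma>: "storage n b2 \<sigma>"
  let ?I = "bits n \<times> bits n" and ?D = "2 ^ b1 * 2 ^ b2 :: nat"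
  define p where "p = (\<lambda>(x, y). pmf X x * pmf Y y)"
  define z where "z = (\<lambda>(x, y). E x y)"
  define \<tau> where "\<tau> = (\<lambda>(x, y). \<rho> x \<otimes>\<^sub>M \<sigma> y)"
  define S where "S = mat_sum ?D (\<lambda>(x, y). complex_of_real (pmf X x * pmf Y y) \<cdot>\<^sub>m (\<rho> x \<otimes>\<^sub>M \<sigma> y)) ?I"
  note d1 = density_carrier[OF storage_density[OF \<rho>]] density_herm[OF storage_density[OF \<rho>]]
  note d2 = density_carrier[OF storage_density[OF \<sigma>]] density_herm[OF storage_density[OF \<sigma>]]
  have z: "z i \<in> bits m" if "i \<in> ?I" for i
    using E that by (auto simp: z_def)
  have t1: "\<tau> i \<in> carrier_mat ?D ?D" if "i \<in> ?I" for i
    using that by (auto simp: \<tau>_def intro!: tensor_carrier d1 d2)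
  have t2: "herm ?D (ent (\<tau> i))" if "i \<in> ?I" for i
    using that by (auto simp: \<tau>_def intro!: herm_tensor d1 d2)
  have S1: "S \<in> carrier_mat ?D ?D" by (simp add: S_def mat_sum_def)
  have S2: "S $$ (r, c) = (\<Sum>i\<in>?I. of_real (p i) * ent (\<tau> i) r c)" if "r < ?D" "c < ?D" for r c
  proof -
    have "(case i of (x, y) \<Rightarrow> complex_of_real (pmf X x * pmf Y y) \<cdot>\<^sub>m (\<rho> x \<otimes>\<^sub>M \<sigma> y)) $$ (r, c)
        = of_real (p i) * ent (\<tau> i) r c" if "i \<in> ?I" for i
      using t1[OF that] \<open>r < ?D\<close> \<open>c < ?D\<close> by (auto simp: p_def \<tau>_def ent_def split: prod.split)
    thus ?thesis unfolding S_def mat_sum_def using that by simp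
  qed
  obtain V where V: "\<And>w. w \<in> bits m \<Longrightarrow> contraction ?D (V w)"
    "(\<Sum>i\<in>?I. of_real (p i) * (fn_trace ?D (V (z i)) (ent (\<tau> i))
        - (\<Sum>w\<in>bits m. fn_trace ?D (V w) (ent (\<tau> i))) / 2 ^ m)) = of_real (2 * tr_norm (cq_diff m ?D p z \<tau> ?I S))"
    by (rule cq_diff_attained[where m = m and D = ?D and p = p and z = z and \<tau> = \<tau> and I = ?I and S = S, OF z t1 t2 S1 S2])
      (assumption | rule that; simp)+
  define f where "f = (\<lambda>x y z. fn_trace ?D (V z) (kron (2 ^ b2) (ent (\<rho> x)) (ent (\<sigma> y))))"
  have f: "fn_trace ?D (V w) (ent (\<rho> x \<otimes>\<^sub>M \<sigma> y)) = f x y w" if "x \<in> bits n" "y \<in> bits n" for x y w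
    unfolding f_def by (rule fn_trace_cong) (rule ent_tensor[OF d1(1)[OF that(1)] d2(1)[OF that(2)]])
  have "of_real (2 * tr_norm (cq_diff m ?D p z \<tau> ?I S)) =
     (\<Sum>x\<in>bits n. \<Sum>y\<in>bits n. complex_of_real (pmf X x * pmf Y y) *
       (fn_trace ?D (V (E x y)) (ent (\<rho> x \<otimes>\<^sub>M \<sigma> y)) - (\<Sum>w\<in>bits m. fn_trace ?D (V w) (ent (\<rho> x \<otimes>\<^sub>M \<sigma> y))) / 2 ^ m))"
    unfolding V(2)[symmetric] by (simp only: sum.cartesian_product case_prod_unfold p_def \<tau>_def z_def)
  also have "\<dots> = (\<Sum>x\<in>bits n. \<Sum>y\<in>bits n. complex_of_real (pmf X x * pmf Y y) *
       (f x y (E x y) - (\<Sum>z\<in>bits m. f x y z) / 2 ^ m))"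
    by (intro sum.cong refl) (simp add: f)
  finally have eq: "of_real (2 * tr_norm (cq_diff m ?D p z \<tau> ?I S)) =
    (\<Sum>x\<in>bits n. \<Sum>y\<in>bits n. complex_of_real (pmf X x * pmf Y y) * (f x y (E x y) - (\<Sum>z\<in>bits m. f x y z) / 2 ^ m))" .
  have "cmod (of_real (2 * tr_norm (cq_diff m ?D p z \<tau> ?I S))) \<le> 2 * \<epsilon>"
    unfolding eq by (rule bound[OF X Y \<rho> \<sigma> V(1) f_def])
  hence "tr_norm (cq_diff m ?D p z \<tau> ?I S) \<le> \<epsilon>" by (simp only: norm_of_real)
  moreover have "(\<lambda>i. complex_of_real (p i) \<cdot>\<^sub>m (ket_bra (z i) \<otimes>\<^sub>M \<tau> i)) =
      (\<lambda>(x, y). complex_of_real (pmf X x * pmf Y y) \<cdot>\<^sub>m (ket_bra (E x y) \<otimes>\<^sub>M \<rho> x \<otimes>\<^sub>M \<sigma> y))"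
    by (simp add: fun_eq_iff p_def z_def \<tau>_def)
  ultimately show "tr_norm
       (mat_sum (2 ^ m * (2 ^ b1 * 2 ^ b2))
         (\<lambda>(x, y). complex_of_real (pmf X x * pmf Y y) \<cdot>\<^sub>m (ket_bra (E x y) \<otimes>\<^sub>M \<rho> x \<otimes>\<^sub>M \<sigma> y)) ?I -
        max_mixed m \<otimes>\<^sub>M mat_sum (2 ^ b1 * 2 ^ b2)
          (\<lambda>(x, y). complex_of_real (pmf X x * pmf Y y) \<cdot>\<^sub>m (\<rho> x \<otimes>\<^sub>M \<sigma> y)) ?I) \<le> \<epsilon>"
    by (simp only: cq_diff_def S_def)
qed

text \<open>Here \<open>b\<close> is the storage of the source fed to the seeded extractor and
  \<open>b'\<close> that of the other; only the latter enters the hash bound.\<close>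

lemma deor_two_source_extractor:
  assumes A: "deor_matrices A" and n: "1 \<le> n" "l \<le> n"
    and F: "seeded_extractor n (d n k b e) m' (real k) \<epsilon>' b (E\<^sub>S n k b e)"
    and dl: "d n k b e \<le> l" and m: "m \<le> m' + (l - d n k b e)"
    and src: "if fst_src then b = b1 \<and> b' = b2 \<and> real k \<le> k1 else b = b2 \<and> b' = b1 \<and> real k \<le> k2"
    and \<epsilon>: "2 powr ((real b' + real l + real n - k1 - k2) / 2) + 2 * \<epsilon>' \<le> 2 * \<epsilon>"
  shows "two_source_extractor n m k1 k2 \<epsilon> b1 b2 (deor A d E\<^sub>S n fst_src l k b e m)"
proof (rule two_source_extractorI)
  fix x y :: "bit list" assume "x \<in> bits n" "y \<in> bits n"
  thus "deor A d E\<^sub>S n fst_src l k b e m x y \<in> bits m"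
    using F dl m E_D_bits[of A n l x y]
    by (auto simp: deor_def copy_surplus_def bits_def seeded_extractor_def)
next
  fix X Y and \<rho> \<sigma> :: "bit list \<Rightarrow> complex mat" and V f
  assume X: "source n k1 X" and Y: "source n k2 Y" and \<rho>: "storage n b1 \<rho>" and \<sigma>: "storage n b2 \<sigma>"
    and V: "\<And>z. z \<in> bits m \<Longrightarrow> contraction (2 ^ b1 * 2 ^ b2) (V z)"
    and f: "f = (\<lambda>x y z. fn_trace (2 ^ b1 * 2 ^ b2) (V z) (kron (2 ^ b2) (ent (\<rho> x)) (ent (\<sigma> y))))"
  define P where "P x z = ptrace_left (2 ^ b1) (2 ^ b2) (V z) (ent (\<rho> x))" for x z
  define Q where "Q y z = ptrace_right (2 ^ b1) (2 ^ b2) (V z) (ent (\<sigma> y))" for y z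
  have P: "contraction (2 ^ b2) (P x z)" if "x \<in> bits n" "z \<in> bits m" for x z
    unfolding P_def by (rule contraction_ptrace_left[OF V storage_density[OF \<rho>]]) (use that in auto)
  have Q: "contraction (2 ^ b1) (Q y z)" if "y \<in> bits n" "z \<in> bits m" for y z
    unfolding Q_def by (rule contraction_ptrace_right[OF V storage_density[OF \<sigma>]]) (use that in auto)
  have fP: "f x y z = fn_trace (2 ^ b2) (P x z) (ent (\<sigma> y))" for x y z
    unfolding f P_def fn_trace_ptrace_left ..
  have fQ: "f x y z = fn_trace (2 ^ b1) (Q y z) (ent (\<rho> x))" for x y z
    unfolding f Q_def fn_trace_ptrace_right ..
  let ?E = "deor A d E\<^sub>S n fst_src l k b e m"
  have "cmod (\<Sum>x\<in>bits n. \<Sum>y\<in>bits n. of_real (pmf X x * pmf Y y) *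
      (f x y (?E x y) - (\<Sum>z\<in>bits m. f x y z) / 2 ^ m))
    \<le> 2 powr ((real b' + real l + real n - k1 - k2) / 2) + 2 * \<epsilon>'"
  proof (cases fst_src)
    case True
    with src have s: "b = b1" "b' = b2" "real k \<le> k1" by auto
    have "cmod (\<Sum>x\<in>bits n. \<Sum>y\<in>bits n. of_real (pmf X x * pmf Y y) *
      (f x y (take m (copy_surplus (d n k b e) (E\<^sub>S n k b e) x (E_D A n l x y))) - (\<Sum>z\<in>bits m. f x y z) / 2 ^ m))
      \<le> 2 powr ((real b2 + real l + real n - k1 - k2) / 2) + 2 * \<epsilon>'"
      by (rule composition_bound[OF X Y \<rho> \<sigma> F[unfolded s(1)] s(3) dl[unfolded s(1)] m[unfolded s(1)] E_D_bits
            card_E_D_collision_right[OF A n] P Q fP fQ, folded s(1)])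
    thus ?thesis using True s by (simp add: deor_def)
  next
    case False
    with src have s: "b = b2" "b' = b1" "real k \<le> k2" by auto
    \<comment> \<open>The same bound with all roles exchanged: \<open>Y\<close> is the extractor
      input, the two partial traces swap, and collisions are counted over \<open>y\<close> for
      distinct \<open>x\<close>.\<close>
    have "cmod (\<Sum>y\<in>bits n. \<Sum>x\<in>bits n. of_real (pmf Y y * pmf X x) *
      (f x y (take m (copy_surplus (d n k b e) (E\<^sub>S n k b e) y (E_D A n l x y))) - (\<Sum>z\<in>bits m. f x y z) / 2 ^ m))
      \<le> 2 powr ((real b1 + real l + real n - k2 - k1) / 2) + 2 * \<epsilon>'"
      by (rule composition_bound[where f = "\<lambda>y x. f x y" and H = "\<lambda>y x. E_D A n l x y",
            OF Y X \<sigma> \<rho> F[unfolded s(1)] s(3) dl[unfolded s(1)] m[unfolded s(1)] E_D_bits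
            card_E_D_collision_left[OF A n] Q P fQ fP, folded s(1)])
    moreover have "(\<Sum>y\<in>bits n. \<Sum>x\<in>bits n. of_real (pmf Y y * pmf X x) *
      (f x y (take m (copy_surplus (d n k b e) (E\<^sub>S n k b e) y (E_D A n l x y))) - (\<Sum>z\<in>bits m. f x y z) / 2 ^ m)) =
      (\<Sum>x\<in>bits n. \<Sum>y\<in>bits n. of_real (pmf X x * pmf Y y) * (f x y (?E x y) - (\<Sum>z\<in>bits m. f x y z) / 2 ^ m))"
      by (subst sum.swap) (simp add: deor_def False mult.commute)
    ultimately show ?thesis using s by (simp add: algebra_simps)
  qed
  also note \<epsilon>
  finally show "cmod (\<Sum>x\<in>bits n. \<Sum>y\<in>bits n. of_real (pmf X x * pmf Y y) *
      (f x y (?E x y) - (\<Sum>z\<in>bits m. f x y z) / 2 ^ m)) \<le> 2 * \<epsilon>" .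
qed

section \<open>Choice of the parameters and of the constant\<close>

lemma deor_parameters:
  fixes K \<kappa> ks ko \<epsilon> :: real and n bs bo :: nat
  defines "C \<equiv> 27 * max K 0 + 2 * max \<kappa> 0 + 100"
  assumes n: "2 \<le> n" and ks: "0 \<le> ks" "ks \<le> n" and ko: "0 \<le> ko" "ko \<le> n" and \<epsilon>: "0 < \<epsilon>" "\<epsilon> < 1"
    and ent: "ks + ko - real (max bs bo) > real n + C * (log 2 (real n / \<epsilon>)) ^ 3"
  obtains l k e :: nat where "bs < k" "k \<le> n" "1 \<le> e" "e \<le> n" "real k \<le> ks" "l \<le> n"
    "\<And>d. real d \<le> K * (log 2 (real n / 2 powr (- real e))) ^ 3 \<Longrightarrow> d \<le> l"
    "2 powr ((real bo + real l + real n - ks - ko) / 2) + 2 * 2 powr (- real e) \<le> 2 * \<epsilon>"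
    "\<And>d m' m. d \<le> l \<Longrightarrow>
      real m' \<ge> real d + real k - real bs - 8 * log 2 (real k - real bs) - 8 * real e - \<kappa> \<Longrightarrow>
      m = \<lfloor>ks - bs + (ks + ko - bo - n) / 2 - 9 * log 2 (1 / \<epsilon>) - 1\<rfloor> \<Longrightarrow> nat m \<le> m' + (l - d)"
proof -
  define L where "L = log 2 (real n / \<epsilon>)"
  define r where "r = log 2 (1 / \<epsilon>)"
  define g where "g = log 2 (real n)"
  define T where "T = ks + ko - bo - n"
  have g1: "1 \<le> g" using n by (simp add: g_def le_log_iff)
  have r0: "0 < r" using \<epsilon> by (simp add: r_def)
  have L: "L = g + r" using n \<epsilon> by (simp add: L_def g_def r_def log_divide)
  have L1: "1 \<le> L" using L g1 r0 by simp
  have L3: "L \<le> L ^ 3" using L1 by (simp add: self_le_power)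
  have K0: "0 \<le> max K 0" "0 \<le> max \<kappa> 0" by simp_all
  have C: "100 \<le> C" unfolding C_def by simp
  have CL: "C * L \<le> C * L ^ 3" using C L3 by (intro mult_left_mono) auto
  have C100: "100 * L \<le> C * L" using C L1 by (intro mult_right_mono) auto
  \<comment> \<open>The maximum over both storages gives two bounds: taking \<open>bo\<close> yields
    \<open>T\<close>, while taking \<open>bs\<close> and using that \<open>ko\<close> is at most
    \<open>n\<close> leaves entropy for the seeded extractor.\<close>
  have T: "T > C * L ^ 3" and ksb: "ks - bs > C * L ^ 3"
    using ent ko by (auto simp: T_def L_def)
  have Tn: "T \<le> n" using ks ko by (simp add: T_def)
  define k where "k = nat \<lfloor>ks\<rfloor>"
  \<comment> \<open>Each error term is to be at most \<epsilon> = 2^-r. The extra 1 in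
    \<open>e\<close> pays for the factor 2 before the seeded error, and \<open>l\<close> at most T -
    2r makes the hash error 2^((l - T)/2) small enough.\<close>
  define e where "e = nat (\<lceil>r\<rceil> + 1)"
  define l where "l = nat \<lfloor>T - 2 * r\<rfloor>"
  have k: "real k \<le> ks" "real k > ks - 1" using ks by (auto simp: k_def)
  have e: "real e \<ge> r + 1" "real e \<le> r + 2" using r0 by (auto simp: e_def) linarith+
  have Tr: "T - 2 * r \<ge> 0" using T CL C100 L g1 r0 by linarith
  have l: "real l \<le> T - 2 * r" "real l > T - 2 * r - 1" using Tr by (auto simp: l_def)
  have bk: "real bs + 1 < k" using k ksb CL C100 L1 by linarith
  show ?thesis
  proof (rule that[of k e l])
    show "bs < k" using bk by linarith
    show "k \<le> n" using k ks by linarith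
    show "1 \<le> e" using e r0 by linarith
    have "real e \<le> n" using e ksb ks CL C100 L g1 r0 by linarith
    thus "e \<le> n" by simp
    show "real k \<le> ks" by fact
    have "real l \<le> n" using l Tn r0 by linarith
    thus "l \<le> n" by simp
    show "d \<le> l" if d: "real d \<le> K * (log 2 (real n / 2 powr (- real e))) ^ 3" for d
    proof -
      have le: "log 2 (real n / 2 powr (- real e)) = g + e"
        using n by (simp add: g_def log_divide)
      have "real d \<le> max K 0 * (g + e) ^ 3"
        using d g1 unfolding le by (elim order_trans) (intro mult_right_mono, auto)
      \<comment> \<open>Here g + e \<le> L + 2 \<le> 3L, whose cube is the origin of the 27 in
        \<open>C\<close>. The remaining 100 L^3 covers the 2r and the rounding lost in
        \<open>l\<close>.\<close>
      also have "\<dots> \<le> max K 0 * (3 * L) ^ 3"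
        using e L g1 r0 by (intro mult_left_mono power_mono) auto
      also have "\<dots> = 27 * max K 0 * L ^ 3" by (simp add: power_mult_distrib)
      also have "\<dots> \<le> (C - 100) * L ^ 3"
        using K0 L1 unfolding C_def by (intro mult_right_mono) auto
      also have "\<dots> = C * L ^ 3 - 100 * L ^ 3" by (simp add: left_diff_distrib)
      also have "\<dots> \<le> real l" using l T L3 L g1 r0 L1 by linarith
      finally show ?thesis by simp
    qed
    show "2 powr ((real bo + real l + real n - ks - ko) / 2) + 2 * 2 powr (- real e) \<le> 2 * \<epsilon>"
    proof -
      have er: "2 powr (- r) = \<epsilon>" using \<epsilon> by (simp add: r_def log_divide powr_minus_divide)
      have "2 powr ((real bo + real l + real n - ks - ko) / 2) \<le> 2 powr (- r)"
        using l by (intro powr_mono) (auto simp: T_def)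
      moreover have "2 * 2 powr (- real e) \<le> 2 * 2 powr (- r - 1)"
        using e by (intro mult_left_mono powr_mono) auto
      moreover have "2 * 2 powr (- r - 1) = 2 powr (- r)" by (simp add: powr_diff)
      ultimately show ?thesis using er by linarith
    qed
    fix d m' :: nat and m :: int
    assume dl: "d \<le> l" and m': "real m' \<ge> real d + real k - real bs - 8 * log 2 (real k - real bs) - 8 * real e - \<kappa>"
      and m: "m = \<lfloor>ks - bs + (ks + ko - bo - n) / 2 - 9 * log 2 (1 / \<epsilon>) - 1\<rfloor>"
    have "log 2 (real k - real bs) \<le> g"
      unfolding g_def using bk k ks by (intro log_mono) auto
    moreover have "real_of_int m \<le> ks - bs + T / 2 - 9 * r - 1"
      unfolding m T_def r_def by linarith
    \<comment> \<open>The output available is at least ks - bs + T - 10r - 8g - 18 - \<kappa>,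
      against at most ks - bs + T/2 - 9r - 1 demanded. So T/2 has to cover r + 8g + 17 + \<kappa>,
      which explains the coefficient 2 of \<kappa> in \<open>C\<close>; the rest fits into 50
      L.\<close>
    moreover have "T \<ge> 2 * max \<kappa> 0 * L + 100 * L"
    proof -
      have "(2 * max \<kappa> 0 + 100) * L \<le> C * L"
        using K0 L1 unfolding C_def by (intro mult_right_mono) auto
      thus ?thesis using T CL by (simp add: distrib_right)
    qed
    moreover have "max \<kappa> 0 * 1 \<le> max \<kappa> 0 * L" using K0 L1 by (intro mult_left_mono) auto
    moreover have "\<kappa> \<le> max \<kappa> 0" by simp
    ultimately have "real_of_int m \<le> real m' + real l - real d"
      using m' e k l L g1 r0 by linarith
    hence "m \<le> int m' + int (l - d)" using dl by linarith
    thus "nat m \<le> m' + (l - d)" by linarith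
  qed
qed

lemma deor_two_source_theorem:
  fixes K \<kappa> :: real
  defines "C \<equiv> 27 * max K 0 + 2 * max \<kappa> 0 + 100"
  assumes A: "deor_matrices A" and ES: "dpvr_extractor K \<kappa> d E\<^sub>S"
    and n: "2 \<le> n" and k1: "k1 \<in> {0..real n}" and k2: "k2 \<in> {0..real n}" and \<epsilon>: "\<epsilon> \<in> {0<..<1}"
    and ent: "k1 + k2 - real (max b1 b2) > real n + C * (log 2 (real n / \<epsilon>)) ^ 3"
    and m: "m = \<lfloor>max (k1 - real b1 / 2) (k2 - real b2 / 2) + 1 / 2 * (k1 - real b1 + k2 - real b2 - real n)
              - 9 * log 2 (1 / \<epsilon>) - 1\<rfloor>"
  shows "\<exists>fst_src l k b e. deor_params d n l k b e \<and>
    two_source_extractor n (nat m) k1 k2 \<epsilon> b1 b2 (deor A d E\<^sub>S n fst_src l k b e (nat m))"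
proof -
  \<comment> \<open>The source attaining the maximum in the output length is fed to the seeded
    extractor.\<close>
  define fst_src where "fst_src \<longleftrightarrow> k2 - real b2 / 2 \<le> k1 - real b1 / 2"
  define bs bo ks ko where "bs = (if fst_src then b1 else b2)" and "bo = (if fst_src then b2 else b1)"
    and "ks = (if fst_src then k1 else k2)" and "ko = (if fst_src then k2 else k1)"
  note defs = bs_def bo_def ks_def ko_def
  have *: "0 \<le> ks" "ks \<le> n" "0 \<le> ko" "ko \<le> n" using k1 k2 by (auto simp: defs)
  have "ks + ko - real (max bs bo) > real n + C * (log 2 (real n / \<epsilon>)) ^ 3"
    using ent by (auto simp: defs max.commute)
  note ent' = this[unfolded C_def]
  have \<epsilon>: "0 < \<epsilon>" "\<epsilon> < 1" using \<epsilon> by auto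
  obtain l k e :: nat where p: "bs < k" "k \<le> n" "1 \<le> e" "e \<le> n" "real k \<le> ks" "l \<le> n"
    and dl: "\<And>d. real d \<le> K * (log 2 (real n / 2 powr (- real e))) ^ 3 \<Longrightarrow> d \<le> l"
    and eps: "2 powr ((real bo + real l + real n - ks - ko) / 2) + 2 * 2 powr (- real e) \<le> 2 * \<epsilon>"
    and ml: "\<And>d m' m. d \<le> l \<Longrightarrow>
      real m' \<ge> real d + real k - real bs - 8 * log 2 (real k - real bs) - 8 * real e - \<kappa> \<Longrightarrow>
      m = \<lfloor>ks - bs + (ks + ko - bo - n) / 2 - 9 * log 2 (1 / \<epsilon>) - 1\<rfloor> \<Longrightarrow> nat m \<le> m' + (l - d)"
    by (rule deor_parameters[OF n * \<epsilon> ent']) (rule that; blast)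
  \<comment> \<open>The halves of \<open>bs\<close> from the maximum and from the symmetric term add
    up to \<open>bs\<close>, so the symmetric formula takes the one-sided form.\<close>
  have meq: "m = \<lfloor>ks - bs + (ks + ko - bo - n) / 2 - 9 * log 2 (1 / \<epsilon>) - 1\<rfloor>"
    unfolding m by (rule arg_cong[of _ _ floor]) (auto simp: defs fst_src_def field_simps)
  from ES n p obtain m' where dd: "real (d n k bs e) \<le> K * (log 2 (real n / 2 powr (- real e))) ^ 3"
    and m': "real m' \<ge> real (d n k bs e) + real k - real bs - 8 * log 2 (real k - real bs) - 8 * real e - \<kappa>"
    and F: "seeded_extractor n (d n k bs e) m' (real k) (2 powr (- real e)) bs (E\<^sub>S n k bs e)"
    unfolding dpvr_extractor_def by blast
  have dl': "d n k bs e \<le> l" by (rule dl[OF dd])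
  have "two_source_extractor n (nat m) k1 k2 \<epsilon> b1 b2 (deor A d E\<^sub>S n fst_src l k bs e (nat m))"
  proof (rule deor_two_source_extractor[where d = d and E\<^sub>S = E\<^sub>S and n = n and k = k and b = bs and e = e and l = l
        and m' = m' and \<epsilon>' = "2 powr - real e" and b' = bo, OF A _ p(6) F dl' ml[OF dl' m' meq]])
    show "1 \<le> n" using n by simp
    show "if fst_src then bs = b1 \<and> bo = b2 \<and> real k \<le> k1 else bs = b2 \<and> bo = b1 \<and> real k \<le> k2"
      using p(5) by (auto simp: defs)
    show "2 powr ((real bo + real l + real n - k1 - k2) / 2) + 2 * 2 powr (- real e) \<le> 2 * \<epsilon>"
      using eps by (auto simp: ks_def ko_def algebra_simps split: if_splits)
  qed
  moreover have "deor_params d n l k bs e" using n p dl' by (simp add: deor_params_def)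
  ultimately show ?thesis by blast
qed

theorem theorem2:
  fixes K \<kappa> :: real
  shows "\<exists>C > 0. \<exists>c > 0. \<exists>\<delta> :: nat \<Rightarrow> real.
    (\<forall>n. \<delta> n \<in> {0..1}) \<and> \<delta> \<longlonglongrightarrow> 0 \<and>
    (\<forall>A d E\<^sub>S. deor_matrices A \<and> dpvr_extractor K \<kappa> d E\<^sub>S \<longrightarrow>
       deor_explicit A d E\<^sub>S \<and>
       (\<forall>(n :: nat) (k1 :: real) (k2 :: real) (b1 :: nat) (b2 :: nat) (\<epsilon> :: real) (m :: int).
          2 \<le> n \<and> k1 \<in> {0..real n} \<and> k2 \<in> {0..real n} \<and> \<epsilon> \<in> {0<..<1} \<and>
          k1 + k2 - real (max b1 b2) > real n + C * (log 2 (real n / \<epsilon>)) ^ 3 \<and>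
          m = \<lfloor>(1 - \<delta> n) * max (k1 - real b1 / 2) (k2 - real b2 / 2)
                + 1 / 2 * (k1 - real b1 + k2 - real b2 - real n)
                - 9 * log 2 (1 / \<epsilon>) - c\<rfloor> \<and>
          m \<ge> 1
          \<longrightarrow> (\<exists>fst_src l k b e. deor_params d n l k b e \<and>
                two_source_extractor n (nat m) k1 k2 \<epsilon> b1 b2
                  (deor A d E\<^sub>S n fst_src l k b e (nat m)))))"
proof (rule exI[of _ "27 * max K 0 + 2 * max \<kappa> 0 + 100"], rule conjI,
    simp add: add_nonneg_pos, rule exI[of _ 1], rule conjI, simp,
    rule exI[of _ "\<lambda>_. 0"], intro conjI allI impI)
  \<comment> \<open>The witnesses are c = 1 and \<delta> = 0: the hidden constants of the seeded
    extractor are charged to \<open>C\<close>, which depends on \<open>K\<close> and \<kappa> alone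
    and is fixed before the matrices and the extractor.\<close>
  let ?C = "27 * max K 0 + 2 * max \<kappa> 0 + 100"
  show "(0 :: real) \<in> {0..1}" by simp
  show "(\<lambda>_ :: nat. 0 :: real) \<longlonglongrightarrow> 0" by simp
  fix A d E\<^sub>S
  assume "deor_matrices A \<and> dpvr_extractor K \<kappa> d E\<^sub>S"
  hence A: "deor_matrices A" and ES: "dpvr_extractor K \<kappa> d E\<^sub>S" by auto
  show "deor_explicit A d E\<^sub>S" by (rule deor_explicitI[OF A ES])
  fix n b1 b2 :: nat and k1 k2 \<epsilon> :: real and m :: int
  assume *: "2 \<le> n \<and> k1 \<in> {0..real n} \<and> k2 \<in> {0..real n} \<and> \<epsilon> \<in> {0<..<1} \<and>
    k1 + k2 - real (max b1 b2) > real n + ?C * (log 2 (real n / \<epsilon>)) ^ 3 \<and>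
    m = \<lfloor>(1 - 0) * max (k1 - real b1 / 2) (k2 - real b2 / 2)
          + 1 / 2 * (k1 - real b1 + k2 - real b2 - real n) - 9 * log 2 (1 / \<epsilon>) - 1\<rfloor> \<and> m \<ge> 1"
  show "\<exists>fst_src l k b e. deor_params d n l k b e \<and>
      two_source_extractor n (nat m) k1 k2 \<epsilon> b1 b2 (deor A d E\<^sub>S n fst_src l k b e (nat m))"
    by (rule deor_two_source_theorem[OF A ES]) (use * in auto)
qed

end
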